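(* Let $n\ge 1$ and let $g$ be the Semi-Riemannian metric on $GL_n=GL_n(\mathbb{R})$ given by $g_A(V,W)=\mathrm{tr}(A^{-1}VA^{-1}W)$ for $A\in GL_n$, $V,W\in T_A(GL_n)=M_n(\mathbb{R})$; denote also by $g$ its restriction to the submanifold $SL_n=SL_n(\mathbb{R})$. Then $(SL_n,g)$ is a symmetric Semi-Riemannian submanifold of $(GL_n,g)$ with signature $\left(\frac{n(n+1)}{2}-1,\frac{n(n-1)}{2}\right)$. It is homogeneous and among its isometries there are the left and right translations $L_G(X)=GX$, $R_G(X)=XG$ and the congruences $\Gamma_G(X)=G^TXG$ (for $G\in SL_n$), the conjugacies $C_G(X)=G^{-1}XG$ (for $G\in GL_n$), the transposition $X\mapsto X^T$, the inversion $\varphi(X)=X^{-1}$, and all their compositions, so in particular the symmetries $\psi_P=R_P\circ L_P\circ\varphi$ ($P\in SL_n$).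
   Context: $SL_n(\mathbb{R})$ is the group of real $n\times n$ matrices of determinant $1$. The signature $(p,q)$ lists first the index of positivity and then the index of negativity. A Semi-Riemannian manifold $(M,g)$ is homogeneous if its isometries act transitively. A Semi-Riemannian (globally) symmetric space is a connected Semi-Riemannian manifold $M$ such that for each $p\in M$ there is a (unique) isometry $\zeta_p:M\to M$ fixing $p$ with differential $-\mathrm{id}$ on $T_pM$ (the symmetry with respect to $p$). *)

theory Defs
  imports "HOL-Analysis.Analysis"
begin

section \<open>Smooth maps and submanifolds of Euclidean spaces\<close>

text \<open>To be used for open sets \<open>U\<close>. By induction all iterated directional derivatives
  up to order \<open>k\<close> exist and are continuous, so this is the class of \<open>k\<close> times continuously
  differentiable maps.\<close>

primrec higher_differentiable_on ::
  "('a::euclidean_space) set \<Rightarrow> ('a \<Rightarrow> 'b::euclidean_space) \<Rightarrow> nat \<Rightarrow> bool" where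
  "higher_differentiable_on U f 0 \<longleftrightarrow> continuous_on U f"
| "higher_differentiable_on U f (Suc k) \<longleftrightarrow>
     (\<forall>x\<in>U. f differentiable (at x)) \<and>
     (\<forall>v. higher_differentiable_on U (\<lambda>x. frechet_derivative f (at x) v) k)"

definition smooth_on ::
  "('a::euclidean_space) set \<Rightarrow> ('a \<Rightarrow> 'b::euclidean_space) \<Rightarrow> bool" where
  "smooth_on U f \<longleftrightarrow> (\<forall>k. higher_differentiable_on U f k)"

text \<open>On an arbitrary subset \<open>M\<close>, a map is smooth if it locally extends to a smooth map on an open
  set of the ambient space; only the values of \<open>f\<close> on \<open>M\<close> matter.\<close>

definition smooth_map ::
  "('a::euclidean_space) set \<Rightarrow> ('a \<Rightarrow> 'b::euclidean_space) \<Rightarrow> bool" where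
  "smooth_map M f \<longleftrightarrow>
     (\<forall>p\<in>M. \<exists>U F. open U \<and> p \<in> U \<and> smooth_on U F \<and> (\<forall>x\<in>U \<inter> M. F x = f x))"

definition diffeomorphism ::
  "('a::euclidean_space) set \<Rightarrow> ('b::euclidean_space) set \<Rightarrow> ('a \<Rightarrow> 'b) \<Rightarrow> bool" where
  "diffeomorphism M N f \<longleftrightarrow>
     bij_betw f M N \<and> smooth_map M f \<and> smooth_map N (inv_into M f)"

definition manifold_of_dim :: "nat \<Rightarrow> ('a::euclidean_space) set \<Rightarrow> bool" where
  "manifold_of_dim m M \<longleftrightarrow>
     (\<forall>p\<in>M. \<exists>U V S (\<phi>::'a \<Rightarrow> 'a). open U \<and> p \<in> U \<and> open V \<and> diffeomorphism U V \<phi> \<and>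
        subspace S \<and> dim S = m \<and> \<phi> ` (U \<inter> M) = V \<inter> S)"

definition manifold :: "('a::euclidean_space) set \<Rightarrow> bool" where
  "manifold M \<longleftrightarrow> (\<exists>m. manifold_of_dim m M)"

text \<open>As \<open>N\<close> and \<open>M\<close> are both embedded in the same Euclidean space, an inclusion \<open>N \<subseteq> M\<close> is
  automatically a smooth embedding of manifolds.\<close>

definition submanifold :: "('a::euclidean_space) set \<Rightarrow> 'a set \<Rightarrow> bool" where
  "submanifold N M \<longleftrightarrow> manifold N \<and> manifold M \<and> N \<subseteq> M"

text \<open>\<open>\<gamma>\<close> is (near 0) a smooth curve in \<open>M\<close> with \<open>\<gamma>(0) = p\<close> and velocity \<open>\<gamma>'(0) = v\<close>.\<close>

definition curve_through ::
  "('a::euclidean_space) set \<Rightarrow> 'a \<Rightarrow> 'a \<Rightarrow> (real \<Rightarrow> 'a) \<Rightarrow> bool" where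
  "curve_through M p v \<gamma> \<longleftrightarrow>
     (\<exists>e>0. smooth_on {-e<..<e} \<gamma> \<and> \<gamma> ` {-e<..<e} \<subseteq> M) \<and> \<gamma> 0 = p \<and>
     (\<gamma> has_vector_derivative v) (at 0)"

definition tangent_space :: "('a::euclidean_space) set \<Rightarrow> 'a \<Rightarrow> 'a set" where
  "tangent_space M p = {v. \<exists>\<gamma>. curve_through M p v \<gamma>}"

text \<open>The differential \<open>\<gamma>'(0) \<mapsto> (f \<circ> \<gamma>)'(0)\<close>. It is meaningful for \<open>f\<close> smooth on \<open>M\<close>,
  \<open>p\<close> in \<open>M\<close> and \<open>v\<close> tangent to \<open>M\<close> at \<open>p\<close>, where the value does not depend on the curve.\<close>

definition differential ::
  "('a::euclidean_space) set \<Rightarrow> ('a \<Rightarrow> 'b::euclidean_space) \<Rightarrow> 'a \<Rightarrow> 'a \<Rightarrow> 'b" where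
  "differential M f p v =
     (THE w. \<forall>\<gamma>. curve_through M p v \<gamma> \<longrightarrow> ((f \<circ> \<gamma>) has_vector_derivative w) (at 0))"

definition vector_field :: "('a::euclidean_space) set \<Rightarrow> ('a \<Rightarrow> 'a) \<Rightarrow> bool" where
  "vector_field M X \<longleftrightarrow> smooth_map M X \<and> (\<forall>p\<in>M. X p \<in> tangent_space M p)"


section \<open>Semi-Riemannian geometry\<close>

text \<open>A metric is a family \<open>g p\<close> of forms indexed by the points \<open>p\<close>; only the values of \<open>g p\<close> on
  the tangent space at \<open>p\<close> matter, so that \<open>g\<close> itself also denotes its restriction to a submanifold.\<close>

definition bilinear_form_on ::
  "('a::euclidean_space) set \<Rightarrow> ('a \<Rightarrow> 'a \<Rightarrow> real) \<Rightarrow> bool" where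
  "bilinear_form_on V b \<longleftrightarrow>
     (\<forall>u\<in>V. \<forall>v\<in>V. \<forall>w\<in>V. \<forall>c d. b (c *\<^sub>R u + d *\<^sub>R v) w = c * b u w + d * b v w \<and>
        b w (c *\<^sub>R u + d *\<^sub>R v) = c * b w u + d * b w v)"

definition positivity_index :: "('a::euclidean_space) set \<Rightarrow> ('a \<Rightarrow> 'a \<Rightarrow> real) \<Rightarrow> nat" where
  "positivity_index V b =
     Max {dim W | W. subspace W \<and> W \<subseteq> V \<and> (\<forall>w\<in>W - {0}. b w w > 0)}"

definition negativity_index :: "('a::euclidean_space) set \<Rightarrow> ('a \<Rightarrow> 'a \<Rightarrow> real) \<Rightarrow> nat" where
  "negativity_index V b =
     Max {dim W | W. subspace W \<and> W \<subseteq> V \<and> (\<forall>w\<in>W - {0}. b w w < 0)}"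

definition has_signature ::
  "('a::euclidean_space) set \<Rightarrow> ('a \<Rightarrow> 'a \<Rightarrow> 'a \<Rightarrow> real) \<Rightarrow> nat \<times> nat \<Rightarrow> bool" where
  "has_signature M g s \<longleftrightarrow>
     (\<forall>p\<in>M. (positivity_index (tangent_space M p) (g p),
             negativity_index (tangent_space M p) (g p)) = s)"

definition semi_riemannian_metric ::
  "('a::euclidean_space) set \<Rightarrow> ('a \<Rightarrow> 'a \<Rightarrow> 'a \<Rightarrow> real) \<Rightarrow> bool" where
  "semi_riemannian_metric M g \<longleftrightarrow>
     (\<forall>p\<in>M. bilinear_form_on (tangent_space M p) (g p)) \<and>
     (\<forall>p\<in>M. \<forall>v\<in>tangent_space M p. \<forall>w\<in>tangent_space M p. g p v w = g p w v) \<and>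
     (\<forall>p\<in>M. \<forall>v\<in>tangent_space M p. (\<forall>w\<in>tangent_space M p. g p v w = 0) \<longrightarrow> v = 0) \<and>
     (\<forall>X Y. vector_field M X \<and> vector_field M Y \<longrightarrow> smooth_map M (\<lambda>p. g p (X p) (Y p))) \<and>
     (\<exists>s. has_signature M g s)"

definition semi_riemannian_manifold ::
  "('a::euclidean_space) set \<Rightarrow> ('a \<Rightarrow> 'a \<Rightarrow> 'a \<Rightarrow> real) \<Rightarrow> bool" where
  "semi_riemannian_manifold M g \<longleftrightarrow> manifold M \<and> semi_riemannian_metric M g"

definition semi_riemannian_submanifold ::
  "('a::euclidean_space) set \<Rightarrow> 'a set \<Rightarrow> ('a \<Rightarrow> 'a \<Rightarrow> 'a \<Rightarrow> real) \<Rightarrow> bool" where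
  "semi_riemannian_submanifold N M g \<longleftrightarrow>
     submanifold N M \<and> semi_riemannian_manifold M g \<and> semi_riemannian_manifold N g"

definition isometry ::
  "('a::euclidean_space) set \<Rightarrow> ('a \<Rightarrow> 'a \<Rightarrow> 'a \<Rightarrow> real) \<Rightarrow> ('a \<Rightarrow> 'a) \<Rightarrow> bool" where
  "isometry M g f \<longleftrightarrow> diffeomorphism M M f \<and>
     (\<forall>p\<in>M. \<forall>v\<in>tangent_space M p. \<forall>w\<in>tangent_space M p.
        g (f p) (differential M f p v) (differential M f p w) = g p v w)"

definition homogeneous ::
  "('a::euclidean_space) set \<Rightarrow> ('a \<Rightarrow> 'a \<Rightarrow> 'a \<Rightarrow> real) \<Rightarrow> bool" where
  "homogeneous M g \<longleftrightarrow> (\<forall>p\<in>M. \<forall>q\<in>M. \<exists>f. isometry M g f \<and> f p = q)"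

definition symmetry_at ::
  "('a::euclidean_space) set \<Rightarrow> ('a \<Rightarrow> 'a \<Rightarrow> 'a \<Rightarrow> real) \<Rightarrow> 'a \<Rightarrow> ('a \<Rightarrow> 'a) \<Rightarrow> bool" where
  "symmetry_at M g p \<zeta> \<longleftrightarrow> isometry M g \<zeta> \<and> \<zeta> p = p \<and>
     (\<forall>v\<in>tangent_space M p. differential M \<zeta> p v = - v)"

text \<open>Uniqueness of the symmetry is uniqueness as a map on \<open>M\<close>.\<close>

definition symmetric_space ::
  "('a::euclidean_space) set \<Rightarrow> ('a \<Rightarrow> 'a \<Rightarrow> 'a \<Rightarrow> real) \<Rightarrow> bool" where
  "symmetric_space M g \<longleftrightarrow> semi_riemannian_manifold M g \<and> connected M \<and>
     (\<forall>p\<in>M. \<exists>\<zeta>. symmetry_at M g p \<zeta> \<and>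
        (\<forall>\<zeta>'. symmetry_at M g p \<zeta>' \<longrightarrow> (\<forall>x\<in>M. \<zeta>' x = \<zeta> x)))"

inductive_set compositions :: "('a \<Rightarrow> 'a) set \<Rightarrow> ('a \<Rightarrow> 'a) set" for F where
  base: "f \<in> F \<Longrightarrow> f \<in> compositions F"
| comp: "f \<in> compositions F \<Longrightarrow> h \<in> compositions F \<Longrightarrow> f \<circ> h \<in> compositions F"


section \<open>The matrix groups\<close>

definition GL :: "(real^'n^'n) set" where
  "GL = {A. invertible A}"

definition SL :: "(real^'n^'n) set" where
  "SL = {A. det A = 1}"

definition trace_metric :: "real^'n^'n \<Rightarrow> real^'n^'n \<Rightarrow> real^'n^'n \<Rightarrow> real" where
  "trace_metric A V W = trace (matrix_inv A ** V ** matrix_inv A ** W)"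

definition left_translation :: "real^'n^'n \<Rightarrow> real^'n^'n \<Rightarrow> real^'n^'n" where
  "left_translation G X = G ** X"

definition right_translation :: "real^'n^'n \<Rightarrow> real^'n^'n \<Rightarrow> real^'n^'n" where
  "right_translation G X = X ** G"

definition congruence :: "real^'n^'n \<Rightarrow> real^'n^'n \<Rightarrow> real^'n^'n" where
  "congruence G X = transpose G ** X ** G"

definition conjugacy :: "real^'n^'n \<Rightarrow> real^'n^'n \<Rightarrow> real^'n^'n" where
  "conjugacy G X = matrix_inv G ** X ** G"

end

theory Submission
  imports Defs
begin

text \<open>Everything but the uniqueness of the symmetries is a computation with the derivatives of
  \<open>det\<close> and \<open>matrix_inv\<close>. For uniqueness one has to show that an isometry \<open>f\<close> fixing a point to first
  order is the identity. In left invariant frames the differential of \<open>f\<close> becomes a field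
  \<open>A x \<xi> = f(x)\<^sup>-\<^sup>1 Df\<^sub>x(x \<xi>)\<close> of linear maps preserving the trace form. Symmetry of second derivatives gives
  \<open>D\<^sub>\<eta>A \<xi> - D\<^sub>\<xi>A \<eta> = A[\<eta>, \<xi>] - [A \<eta>, A \<xi>]\<close>; with the invariance of the trace form this forces
  \<open>2 D\<^sub>\<eta>A \<xi> = A[\<eta>, \<xi>] - [A \<eta>, A \<xi>]\<close>. The constant field \<open>id\<close> solves this differential equation, so
  \<open>A = id\<close> propagates along segments by Gronwall's inequality, and then \<open>f(x) x\<^sup>-\<^sup>1\<close> is locally constant.\<close>

section \<open>Calculus of smooth maps\<close>

text \<open>The classical uniqueness proof follows geodesics from the fixed point, and for an
  indefinite metric there is no distance function to use instead. Left invariant frames bypass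
  geodesics: in them the metric is one constant form on matrices, so being an isometry is a
  pointwise condition on \<open>A\<close>, and the derivative of \<open>A\<close> obeys a closed
  equation along straight segments. The price is that \<open>f\<close> must be differentiated in
  every matrix direction, whereas an isometry of \<open>SL\<close> only controls the directions
  tangent to \<open>SL\<close>. Hence it is extended to the open cone \<open>GLplus\<close> over
  \<open>SL\<close>, by a map that remains isometric there because the radial direction is
  orthogonal to the level sets of \<open>det\<close>. This is also why connectedness is proved for
  \<open>GLplus\<close>: the local rigidity has to spread over that set, and \<open>SL\<close> is
  its continuous image under \<open>normalize_det\<close>. Rigidity is finally applied to the
  composition of two symmetries at one point: their differentials are both minus the identity, so
  the composition fixes the point to first order.\<close>

lemma higher_differentiable_on_cong:
  assumes "open U" "\<And>x. x \<in> U \<Longrightarrow> f x = g x" "higher_differentiable_on U f k"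
  shows "higher_differentiable_on U g k"
  using assms(2,3)
proof (induction k arbitrary: f g)
  case 0
  then show ?case by (simp cong: continuous_on_cong)
next
  case (Suc k)
  have "g differentiable at x \<and> frechet_derivative f (at x) v = frechet_derivative g (at x) v"
    if "x \<in> U" for x v
  proof -
    have df: "(f has_derivative frechet_derivative f (at x)) (at x)"
      using Suc.prems that by (simp add: frechet_derivative_works[symmetric])
    then have "(g has_derivative frechet_derivative f (at x)) (at x)"
      using has_derivative_transform_within_open[OF df \<open>open U\<close> that] Suc.prems by simp
    then show ?thesis
      using frechet_derivative_at by (metis differentiable_def)
  qed
  then show ?case
    using Suc.prems Suc.IH[of "\<lambda>x. frechet_derivative f (at x) v" "\<lambda>x. frechet_derivative g (at x) v" for v]
    by auto
qed

lemma higher_differentiable_on_subset: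
  assumes "higher_differentiable_on U f k" "V \<subseteq> U"
  shows "higher_differentiable_on V f k"
  using assms(1)
  by (induction k arbitrary: f) (use assms(2) continuous_on_subset in auto)

lemma higher_differentiable_on_Suc_imp:
  "higher_differentiable_on U f (Suc k) \<Longrightarrow> higher_differentiable_on U f k"
  by (induction k arbitrary: f)
    (auto intro!: continuous_at_imp_continuous_on differentiable_imp_continuous_within)

lemma higher_differentiable_on_SucI:
  assumes "open U" "\<And>x. x \<in> U \<Longrightarrow> (f has_derivative f' x) (at x)"
    and "\<And>v. higher_differentiable_on U (\<lambda>x. f' x v) k"
  shows "higher_differentiable_on U f (Suc k)"
proof -
  have "f differentiable at x \<and> f' x v = frechet_derivative f (at x) v" if "x \<in> U" for x v
    using assms(2)[OF that] frechet_derivative_at by (metis differentiable_def)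
  then show ?thesis
    using higher_differentiable_on_cong[OF assms(1) _ assms(3)] by auto
qed

lemma higher_differentiable_on_SucD:
  assumes "higher_differentiable_on U f (Suc k)" "x \<in> U"
  shows "(f has_derivative frechet_derivative f (at x)) (at x)"
  using assms by (simp add: frechet_derivative_works[symmetric])

text \<open>The recursion only speaks of derivatives \<open>at x\<close>, which do not see the set,
  so each clause can be checked on a neighbourhood of its point.\<close>

lemma higher_differentiable_on_local:
  assumes "\<And>x. x \<in> U \<Longrightarrow> \<exists>N. open N \<and> x \<in> N \<and> higher_differentiable_on N f k"
  shows "higher_differentiable_on U f k"
  using assms
proof (induction k arbitrary: f)
  case 0
  then show ?case
    by (auto intro!: continuous_at_imp_continuous_on)
      (metis continuous_on_eq_continuous_at)
next
  case (Suc k)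
  show ?case
  proof (simp, intro conjI ballI allI)
    fix x assume "x \<in> U"
    then show "f differentiable at x"
      using Suc.prems by fastforce
  next
    fix v
    show "higher_differentiable_on U (\<lambda>x. frechet_derivative f (at x) v) k"
      by (rule Suc.IH) (use Suc.prems in fastforce)
  qed
qed

lemma higher_differentiable_on_const [simp]: "higher_differentiable_on U (\<lambda>x. c) k"
  by (induction k arbitrary: c) auto

lemma higher_differentiable_on_bounded_linear:
  assumes "bounded_linear f" "open U"
  shows "higher_differentiable_on U f k"
proof (cases k)
  case 0
  then show ?thesis using assms by (simp add: linear_continuous_on)
next
  case (Suc m)
  show ?thesis unfolding Suc
    by (rule higher_differentiable_on_SucI[where f' = "\<lambda>x. f"])
      (use assms bounded_linear_imp_has_derivative in auto)
qed

lemma higher_differentiable_on_add: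
  assumes "open U" "higher_differentiable_on U f k" "higher_differentiable_on U g k"
  shows "higher_differentiable_on U (\<lambda>x. f x + g x) k"
  using assms(2,3)
proof (induction k arbitrary: f g)
  case 0
  then show ?case by (simp add: continuous_on_add)
next
  case (Suc k)
  show ?case
    by (rule higher_differentiable_on_SucI[OF \<open>open U\<close>
          has_derivative_add[OF higher_differentiable_on_SucD higher_differentiable_on_SucD]])
      (use Suc in auto)
qed

lemma higher_differentiable_on_sum:
  assumes "open U" "\<And>i. i \<in> I \<Longrightarrow> higher_differentiable_on U (f i) k"
  shows "higher_differentiable_on U (\<lambda>x. \<Sum>i\<in>I. f i x) k"
  using assms(2)
  by (induction I rule: infinite_finite_induct) (auto intro!: higher_differentiable_on_add assms(1))

text \<open>A single product rule for real, scalar, inner and matrix products: the derivative is a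
  sum of two products of the same kind, so the induction closes on itself.\<close>

lemma higher_differentiable_on_bilinear:
  assumes "bounded_bilinear mul" "open U"
    and "higher_differentiable_on U f k" "higher_differentiable_on U g k"
  shows "higher_differentiable_on U (\<lambda>x. mul (f x) (g x)) k"
  using assms(3,4)
proof (induction k arbitrary: f g)
  case 0
  then show ?case using bounded_bilinear.continuous_on[OF assms(1)] by simp
next
  case (Suc k)
  show ?case
  proof (rule higher_differentiable_on_SucI[OF \<open>open U\<close>])
    fix x assume "x \<in> U"
    then show "((\<lambda>x. mul (f x) (g x)) has_derivative (\<lambda>v. mul (f x) (frechet_derivative g (at x) v)
      + mul (frechet_derivative f (at x) v) (g x))) (at x)"
      using Suc.prems by (intro bounded_bilinear.FDERIV[OF assms(1)] higher_differentiable_on_SucD)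
  next
    fix v
    show "higher_differentiable_on U (\<lambda>x. mul (f x) (frechet_derivative g (at x) v)
      + mul (frechet_derivative f (at x) v) (g x)) k"
      using Suc.prems higher_differentiable_on_Suc_imp[OF Suc.prems(1)] higher_differentiable_on_Suc_imp[OF Suc.prems(2)]
      by (intro higher_differentiable_on_add \<open>open U\<close> Suc.IH) auto
  qed
qed

text \<open>The chain rule yields \<open>g' (f x) (f' x v)\<close>, whose direction moves with
  \<open>x\<close>, while the recursion only knows fixed directions. Expanding \<open>f' x v\<close>
  in \<open>Basis\<close> turns this into a sum of products to which the induction hypothesis
  applies.\<close>

lemma higher_differentiable_on_compose:
  fixes f :: "'a::euclidean_space \<Rightarrow> 'b::euclidean_space"
  assumes "open U" "open V" "f ` U \<subseteq> V"
    and "higher_differentiable_on U f k" "higher_differentiable_on V g k"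
  shows "higher_differentiable_on U (\<lambda>x. g (f x)) k"
  using assms(4,5)
proof (induction k arbitrary: g)
  case 0
  then show ?case using assms(3) by (auto intro: continuous_on_compose2)
next
  case (Suc k)
  define f' where "f' = (\<lambda>x. frechet_derivative f (at x))"
  define g' where "g' = (\<lambda>y. frechet_derivative g (at y))"
  have df: "(f has_derivative f' x) (at x)" if "x \<in> U" for x
    using higher_differentiable_on_SucD[OF Suc.prems(1) that] by (simp add: f'_def)
  have dg: "(g has_derivative g' y) (at y)" if "y \<in> V" for y
    using higher_differentiable_on_SucD[OF Suc.prems(2) that] by (simp add: g'_def)
  have expand: "(\<Sum>b\<in>Basis. (f' x v \<bullet> b) *\<^sub>R g' (f x) b) = g' (f x) (f' x v)" if "x \<in> U" for x v
  proof -
    have lin: "linear (g' (f x))"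
      using dg[of "f x"] that assms(3) has_derivative_linear by blast
    have "g' (f x) (f' x v) = g' (f x) (\<Sum>b\<in>Basis. (f' x v \<bullet> b) *\<^sub>R b)"
      by (simp add: euclidean_representation)
    then show ?thesis
      using lin by (simp add: linear_sum linear_scale)
  qed
  have "higher_differentiable_on U (\<lambda>x. \<Sum>b\<in>Basis. (f' x v \<bullet> b) *\<^sub>R g' (f x) b) k" for v
  proof (intro higher_differentiable_on_sum \<open>open U\<close>
      higher_differentiable_on_bilinear[OF bounded_bilinear_scaleR])
    fix b :: 'b
    show "higher_differentiable_on U (\<lambda>x. f' x v \<bullet> b) k"
      using Suc.prems(1)
      by (intro higher_differentiable_on_bilinear[OF bounded_bilinear_inner] \<open>open U\<close>)
        (auto simp: f'_def)
    show "higher_differentiable_on U (\<lambda>x. g' (f x) b) k"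
      using Suc.IH[of "\<lambda>y. g' y b"] Suc.prems higher_differentiable_on_Suc_imp[OF Suc.prems(1)]
      by (simp add: g'_def)
  qed
  then have "higher_differentiable_on U (\<lambda>x. g' (f x) (f' x v)) k" for v
    by (rule higher_differentiable_on_cong[OF \<open>open U\<close>, rotated]) (rule expand)
  then show ?case
    using assms(3)
    by (intro higher_differentiable_on_SucI[OF \<open>open U\<close>, of _ "\<lambda>x v. g' (f x) (f' x v)"])
      (auto intro!: has_derivative_compose[OF df dg])
qed

lemma smooth_on_imp_has_derivative:
  assumes "smooth_on U f" "x \<in> U"
  shows "(f has_derivative frechet_derivative f (at x)) (at x)"
  using assms higher_differentiable_on_SucD unfolding smooth_on_def by blast

lemma smooth_on_frechet_derivative:
  assumes "smooth_on U f"
  shows "smooth_on U (\<lambda>x. frechet_derivative f (at x) v)"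
  using assms higher_differentiable_on.simps(2) unfolding smooth_on_def by blast

lemma smooth_on_imp_continuous_on: "smooth_on U f \<Longrightarrow> continuous_on U f"
  using higher_differentiable_on.simps(1) unfolding smooth_on_def by blast

lemma smooth_on_cong:
  "open U \<Longrightarrow> (\<And>x. x \<in> U \<Longrightarrow> f x = g x) \<Longrightarrow> smooth_on U f \<Longrightarrow> smooth_on U g"
  unfolding smooth_on_def using higher_differentiable_on_cong by blast

lemma smooth_on_subset: "smooth_on U f \<Longrightarrow> V \<subseteq> U \<Longrightarrow> smooth_on V f"
  unfolding smooth_on_def using higher_differentiable_on_subset by blast

lemma smooth_on_local:
  "(\<And>x. x \<in> U \<Longrightarrow> \<exists>N. open N \<and> x \<in> N \<and> smooth_on N f) \<Longrightarrow> smooth_on U f"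
  unfolding smooth_on_def using higher_differentiable_on_local by metis

lemma smooth_on_const [simp]: "smooth_on U (\<lambda>x. c)"
  unfolding smooth_on_def using higher_differentiable_on_const by blast

lemma smooth_on_bounded_linear: "bounded_linear f \<Longrightarrow> open U \<Longrightarrow> smooth_on U f"
  unfolding smooth_on_def using higher_differentiable_on_bounded_linear by blast

lemma smooth_on_id: "open U \<Longrightarrow> smooth_on U (\<lambda>x. x)"
  by (rule smooth_on_bounded_linear[OF bounded_linear_ident])

lemma smooth_on_add:
  "open U \<Longrightarrow> smooth_on U f \<Longrightarrow> smooth_on U g \<Longrightarrow> smooth_on U (\<lambda>x. f x + g x)"
  unfolding smooth_on_def using higher_differentiable_on_add by blast

lemma smooth_on_sum:
  "open U \<Longrightarrow> (\<And>i. i \<in> I \<Longrightarrow> smooth_on U (f i)) \<Longrightarrow> smooth_on U (\<lambda>x. \<Sum>i\<in>I. f i x)"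
  unfolding smooth_on_def using higher_differentiable_on_sum by metis

lemma smooth_on_bilinear:
  "bounded_bilinear mul \<Longrightarrow> open U \<Longrightarrow> smooth_on U f \<Longrightarrow> smooth_on U g
    \<Longrightarrow> smooth_on U (\<lambda>x. mul (f x) (g x))"
  unfolding smooth_on_def using higher_differentiable_on_bilinear by metis

lemmas smooth_on_mult = smooth_on_bilinear[OF bounded_bilinear_mult]
lemmas smooth_on_scaleR = smooth_on_bilinear[OF bounded_bilinear_scaleR]

lemma smooth_on_diff:
  assumes "open U" "smooth_on U f" "smooth_on U g"
  shows "smooth_on U (\<lambda>x. f x - g x)"
  using smooth_on_add[OF assms(1,2) smooth_on_scaleR[OF assms(1) smooth_on_const[of U "-1"] assms(3)]]
  by simp

lemma smooth_on_prod:
  fixes f :: "'i \<Rightarrow> 'a::euclidean_space \<Rightarrow> real"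
  assumes "open U" "\<And>i. i \<in> I \<Longrightarrow> smooth_on U (f i)"
  shows "smooth_on U (\<lambda>x. \<Prod>i\<in>I. f i x)"
  using assms(2)
  by (induction I rule: infinite_finite_induct) (auto intro!: smooth_on_mult assms(1))

lemma smooth_on_compose:
  "open U \<Longrightarrow> open V \<Longrightarrow> f ` U \<subseteq> V \<Longrightarrow> smooth_on U f \<Longrightarrow> smooth_on V g
    \<Longrightarrow> smooth_on U (\<lambda>x. g (f x))"
  unfolding smooth_on_def using higher_differentiable_on_compose by metis

lemma smooth_on_powr: "smooth_on {0<..} (\<lambda>x::real. x powr a)"
proof -
  \<comment> \<open>The factor \<open>c\<close> is carried along because differentiation produces
    \<open>a * x powr (a - 1)\<close>; the induction hypothesis is needed for other exponents and
    factors.\<close>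
  have "higher_differentiable_on {0<..} (\<lambda>x::real. c * x powr a) k" for k c
  proof (induction k arbitrary: a c)
    case 0
    then show ?case by (auto intro!: continuous_intros)
  next
    case (Suc k)
    show ?case
    proof (rule higher_differentiable_on_SucI[where f' = "\<lambda>x v. (c * a) * x powr (a - 1) * v"])
      show "higher_differentiable_on {0<..} (\<lambda>x. (c * a) * x powr (a - 1) * v) k" for v
        using Suc.IH[of "c * a * v" "a - 1"] by (simp add: mult_ac)
      fix x :: real assume x: "x \<in> {0<..}"
      then have "((\<lambda>x. c * x powr a) has_real_derivative c * (a * x powr (a - 1))) (at x)"
        by (intro DERIV_cmult has_real_derivative_powr) auto
      then show "((\<lambda>x. c * x powr a) has_derivative (\<lambda>v. (c * a) * x powr (a - 1) * v)) (at x)"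
        unfolding has_field_derivative_def by (rule has_derivative_eq_rhs) (simp add: fun_eq_iff)
    qed simp
  qed
  from this[of 1] show ?thesis unfolding smooth_on_def by auto
qed

lemma smooth_on_inverse: "smooth_on (- {0}) (inverse :: real \<Rightarrow> real)"
proof -
  have "higher_differentiable_on (- {0}) (inverse :: real \<Rightarrow> real) k" for k
  proof (induction k)
    case 0
    then show ?case by (auto intro!: continuous_intros)
  next
    case (Suc k)
    show ?case
    proof (rule higher_differentiable_on_SucI)
      show "(inverse has_derivative (\<lambda>v. - (inverse x * v * inverse x))) (at x)"
        if "x \<in> - {0}" for x :: real
        using that by (auto intro!: derivative_eq_intros)
      have "higher_differentiable_on (- {0}) (\<lambda>x. (- v) * (inverse x * inverse x)) k" for v :: real
        by (intro higher_differentiable_on_bilinear[OF bounded_bilinear_mult] Suc) auto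
      then show "higher_differentiable_on (- {0}) (\<lambda>x. - (inverse x * v * inverse x)) k" for v :: real
        by (simp add: mult_ac)
    qed auto
  qed
  then show ?thesis unfolding smooth_on_def by blast
qed

section \<open>Smooth maps on arbitrary subsets\<close>

lemma smooth_on_imp_smooth_map: "open U \<Longrightarrow> smooth_on U f \<Longrightarrow> M \<subseteq> U \<Longrightarrow> smooth_map M f"
  unfolding smooth_map_def by blast

lemma smooth_map_imp_smooth_on:
  assumes "open U" "smooth_map U f"
  shows "smooth_on U f"
proof (rule smooth_on_local)
  fix x assume "x \<in> U"
  then obtain V F where V: "open V" "x \<in> V" "smooth_on V F" "\<forall>y\<in>V \<inter> U. F y = f y"
    using assms(2) unfolding smooth_map_def by blast
  then have "smooth_on (V \<inter> U) f"
    using smooth_on_cong[of "V \<inter> U" F f] smooth_on_subset[of V F] assms(1) by auto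
  then show "\<exists>N. open N \<and> x \<in> N \<and> smooth_on N f"
    using V \<open>x \<in> U\<close> assms(1) by blast
qed

lemma smooth_map_cong:
  "smooth_map M f \<Longrightarrow> (\<And>x. x \<in> M \<Longrightarrow> f x = g x) \<Longrightarrow> smooth_map M g"
  unfolding smooth_map_def by (metis IntE)

lemma smooth_map_compose:
  assumes "smooth_map M f" "f ` M \<subseteq> N" "smooth_map N g"
  shows "smooth_map M (\<lambda>x. g (f x))"
  unfolding smooth_map_def
proof
  fix p assume p: "p \<in> M"
  obtain U F where U: "open U" "p \<in> U" "smooth_on U F" "\<forall>x\<in>U \<inter> M. F x = f x"
    using assms(1) p unfolding smooth_map_def by blast
  have "f p \<in> N"
    using assms(2) p by blast
  then obtain V G where V: "open V" "f p \<in> V" "smooth_on V G" "\<forall>x\<in>V \<inter> N. G x = g x"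
    using assms(3) unfolding smooth_map_def by blast
  \<comment> \<open>Outside \<open>M\<close> the extension \<open>F\<close> may leave the domain
    \<open>V\<close> of \<open>G\<close>, so it is restricted to the part of \<open>U\<close> that
    it sends into \<open>V\<close>.\<close>
  define W where "W = U \<inter> F -` V"
  have W: "open W"
    unfolding W_def by (rule continuous_open_preimage[OF smooth_on_imp_continuous_on[OF U(3)] U(1) V(1)])
  have "smooth_on W (\<lambda>x. G (F x))"
    by (rule smooth_on_compose[OF W V(1) _ _ V(3)]) (auto simp: W_def intro: smooth_on_subset[OF U(3)])
  moreover have "G (F x) = g (f x)" if x: "x \<in> W \<inter> M" for x
  proof -
    have "F x = f x" "F x \<in> V"
      using U(4) x by (auto simp: W_def)
    moreover have "f x \<in> N"
      using assms(2) x by blast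
    ultimately show ?thesis
      using V(4) by simp
  qed
  moreover have "p \<in> W"
    using U(2,4) V(2) p by (simp add: W_def)
  ultimately show "\<exists>W H. open W \<and> p \<in> W \<and> smooth_on W H \<and> (\<forall>x\<in>W \<inter> M. H x = g (f x))"
    using W by (intro exI[of _ W] exI[of _ "\<lambda>x. G (F x)"]) simp
qed

lemma smooth_map_bilinear:
  assumes "bounded_bilinear mul" "smooth_map M f" "smooth_map M g"
  shows "smooth_map M (\<lambda>x. mul (f x) (g x))"
  unfolding smooth_map_def
proof
  fix p assume p: "p \<in> M"
  obtain U F where U: "open U" "p \<in> U" "smooth_on U F" "\<forall>x\<in>U \<inter> M. F x = f x"
    using assms(2) p unfolding smooth_map_def by blast
  obtain V G where V: "open V" "p \<in> V" "smooth_on V G" "\<forall>x\<in>V \<inter> M. G x = g x"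
    using assms(3) p unfolding smooth_map_def by blast
  have "smooth_on (U \<inter> V) (\<lambda>x. mul (F x) (G x))"
    using U V by (intro smooth_on_bilinear[OF assms(1)]) (auto intro: smooth_on_subset)
  then show "\<exists>W H. open W \<and> p \<in> W \<and> smooth_on W H \<and> (\<forall>x\<in>W \<inter> M. H x = mul (f x) (g x))"
    using U(1,2,4) V(1,2,4) by (intro exI[of _ "U \<inter> V"] exI[of _ "\<lambda>x. mul (F x) (G x)"]) (simp add: open_Int)
qed

section \<open>Matrix calculus\<close>

lemma bounded_bilinear_matrix_mult:
  "bounded_bilinear ((**) :: real^'n^'n \<Rightarrow> real^'n^'n \<Rightarrow> real^'n^'n)"
  by (rule bilinear_conv_bounded_bilinear[THEN iffD1])
    (auto simp: bilinear_def intro!: linearI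
      simp: matrix_matrix_mult_def vec_eq_iff algebra_simps sum.distrib sum_distrib_left)

interpretation matrix_mult: bounded_bilinear "(**) :: real^'n^'n \<Rightarrow> real^'n^'n \<Rightarrow> real^'n^'n"
  by (rule bounded_bilinear_matrix_mult)

lemmas smooth_on_matrix_mult = smooth_on_bilinear[OF bounded_bilinear_matrix_mult]

lemma bounded_linear_trace: "bounded_linear (trace :: real^'n^'n \<Rightarrow> real)"
  by (rule linear_conv_bounded_linear[THEN iffD1])
    (auto simp: trace_def sum.distrib sum_distrib_left intro!: linearI)

lemma trace_scaleR: "trace (c *\<^sub>R A :: real^'n^'n) = c * trace A"
  by (simp add: trace_def sum_distrib_left)

lemma bounded_linear_transpose:
  "bounded_linear (transpose :: real^'n^'n \<Rightarrow> real^'n^'n)"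
  by (rule linear_conv_bounded_linear[THEN iffD1])
    (auto simp: transpose_def vec_eq_iff intro!: linearI)

lemma bounded_linear_entry: "bounded_linear (\<lambda>X::real^'n^'n. X $ i $ j)"
  by (rule bounded_linear_compose[OF bounded_linear_vec_nth bounded_linear_vec_nth])

lemmas smooth_on_entry = smooth_on_bounded_linear[OF bounded_linear_entry]

lemma sum_axis_axis: "(\<Sum>i\<in>UNIV. \<Sum>j\<in>UNIV. (X $ i $ j) *\<^sub>R (axis i (axis j 1) :: real^'n^'n)) = X"
proof -
  have "((X $ i $ j) *\<^sub>R (axis i (axis j 1) :: real^'n^'n)) $ k $ l
      = (if j = l then if i = k then X $ k $ l else 0 else 0)" for i j k l
    by (auto simp: axis_def)
  then have "(\<Sum>i\<in>UNIV. \<Sum>j\<in>UNIV. (X $ i $ j) *\<^sub>R (axis i (axis j 1) :: real^'n^'n)) $ k $ l = X $ k $ l" for k l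
    by (simp only: sum_component) simp
  then show ?thesis by (simp only: vec_eq_iff simp_thms)
qed

lemma smooth_on_matrixI:
  fixes f :: "'a::euclidean_space \<Rightarrow> real^'n^'n"
  assumes "open U" "\<And>i j. smooth_on U (\<lambda>x. f x $ i $ j)"
  shows "smooth_on U f"
proof -
  have "smooth_on U (\<lambda>x. \<Sum>i\<in>UNIV. \<Sum>j\<in>UNIV. (f x $ i $ j) *\<^sub>R (axis i (axis j 1) :: real^'n^'n))"
    by (intro smooth_on_sum smooth_on_scaleR assms smooth_on_const)
  then show ?thesis by (simp only: sum_axis_axis)
qed

lemma smooth_on_det:
  assumes "open U" "smooth_on U f"
  shows "smooth_on U (\<lambda>x. det (f x :: real^'n^'n))"
proof -
  have "smooth_on UNIV (det :: real^'n^'n \<Rightarrow> real)"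
    unfolding det_def[abs_def]
    by (intro smooth_on_sum smooth_on_mult smooth_on_prod smooth_on_const smooth_on_entry open_UNIV)
  then show ?thesis
    using smooth_on_compose[OF assms(1) open_UNIV _ assms(2)] by auto
qed

lemma continuous_on_det: "continuous_on U (det :: real^'n^'n \<Rightarrow> real)"
  using smooth_on_imp_continuous_on[OF smooth_on_det[OF open_UNIV smooth_on_id[OF open_UNIV]]]
    continuous_on_subset by blast

lemma smooth_on_divide:
  fixes f g :: "'a::euclidean_space \<Rightarrow> real"
  assumes "open U" "smooth_on U f" "smooth_on U g" "\<And>x. x \<in> U \<Longrightarrow> g x \<noteq> 0"
  shows "smooth_on U (\<lambda>x. f x / g x)"
  unfolding divide_inverse
  using assms by (intro smooth_on_mult smooth_on_compose[OF _ _ _ _ smooth_on_inverse]) auto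

section \<open>Inverse matrices and the derivative of the determinant\<close>

lemma GL_iff: "A \<in> GL \<longleftrightarrow> det A \<noteq> 0"
  by (simp add: GL_def invertible_det_nz)

lemma open_GL: "open (GL :: (real^'n^'n) set)"
proof -
  have *: "GL = (det :: real^'n^'n \<Rightarrow> real) -` (- {0})"
    by (auto simp: GL_iff)
  show ?thesis
    unfolding * by (intro open_vimage continuous_on_det open_Compl closed_singleton)
qed

lemma SL_subset_GL: "SL \<subseteq> GL"
  by (auto simp: SL_def GL_iff)

lemma
  assumes "A \<in> GL"
  shows matrix_inv_right: "A ** matrix_inv A = mat 1"
    and matrix_inv_left: "matrix_inv A ** A = mat 1"
proof -
  have "A ** matrix_inv A = mat 1 \<and> matrix_inv A ** A = mat 1"
    using assms someI_ex[of "\<lambda>B. A ** B = mat 1 \<and> B ** A = mat 1"]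
    by (simp add: GL_def invertible_def matrix_inv_def)
  then show "A ** matrix_inv A = mat 1" "matrix_inv A ** A = mat 1" by auto
qed

lemma matrix_inv_unique:
  fixes A :: "real^'n^'n"
  assumes "A ** B = mat 1"
  shows "matrix_inv A = B"
proof -
  have "B ** A = mat 1"
    using assms matrix_left_right_inverse by blast
  then have "A \<in> GL"
    using assms by (auto simp: GL_def invertible_def)
  then have "matrix_inv A = matrix_inv A ** (A ** B)"
    using assms by simp
  then show ?thesis
    using \<open>A \<in> GL\<close> by (simp only: matrix_mul_assoc matrix_inv_left matrix_mul_lid)
qed

lemma det_matrix_inv:
  assumes "A \<in> GL"
  shows "det (matrix_inv A) = inverse (det A)"
proof -
  have "det A * det (matrix_inv A) = 1"
    using matrix_inv_right[OF assms] by (metis det_I det_mul)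
  then show ?thesis
    by (metis inverse_unique)
qed

lemma matrix_inv_mult:
  assumes "A \<in> GL" "B \<in> GL"
  shows "matrix_inv (A ** B) = matrix_inv B ** matrix_inv A"
proof (rule matrix_inv_unique)
  have "A ** B ** (matrix_inv B ** matrix_inv A) = A ** (B ** matrix_inv B) ** matrix_inv A"
    by (simp add: matrix_mul_assoc)
  then show "A ** B ** (matrix_inv B ** matrix_inv A) = mat 1"
    using assms by (simp add: matrix_inv_right)
qed

lemma matrix_inv_cancel:
  assumes "A \<in> GL"
  shows "A ** (matrix_inv A ** X) = X" "matrix_inv A ** (A ** X) = X"
    "X ** A ** matrix_inv A = X" "X ** matrix_inv A ** A = X"
  using matrix_inv_right[OF assms] matrix_inv_left[OF assms]
  by (simp_all add: matrix_mul_assoc) (simp_all flip: matrix_mul_assoc)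

lemma matrix_inv_in_GL: "A \<in> GL \<Longrightarrow> matrix_inv A \<in> GL"
  by (simp add: GL_iff[of "matrix_inv A"] det_matrix_inv) (simp add: GL_iff)

lemma matrix_inv_matrix_inv: "A \<in> GL \<Longrightarrow> matrix_inv (matrix_inv A) = A"
  by (rule matrix_inv_unique) (rule matrix_inv_left)

lemma matrix_inv_in_SL: "A \<in> SL \<Longrightarrow> matrix_inv A \<in> SL"
  using SL_subset_GL by (auto simp: SL_def det_matrix_inv subset_iff)

lemma matrix_mult_in_SL: "A \<in> SL \<Longrightarrow> B \<in> SL \<Longrightarrow> A ** B \<in> SL"
  by (simp add: SL_def det_mul)

lemma matrix_inv_entry:
  fixes A :: "real^'n^'n"
  assumes "A \<in> GL"
  shows "matrix_inv A $ i $ j = det (\<chi> k l. if l = i then axis j 1 $ k else A $ k $ l) / det A"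
proof -
  have "A *v (matrix_inv A *v axis j 1) = axis j 1"
    using assms by (simp add: matrix_vector_mul_assoc matrix_inv_right)
  then have "matrix_inv A *v axis j 1 = (\<chi> k. det (\<chi> m l. if l = k then axis j 1 $ m else A $ m $ l) / det A)"
    using assms by (subst cramer[symmetric]) (auto simp: GL_iff)
  from arg_cong[OF this, of "\<lambda>v. v $ i"] show ?thesis
    by (simp add: matrix_vector_mult_basis column_def)
qed

text \<open>Cramer's rule exhibits the entries of the inverse as rational functions.\<close>

lemma smooth_on_matrix_inv_GL: "smooth_on GL (matrix_inv :: real^'n^'n \<Rightarrow> real^'n^'n)"
proof (rule smooth_on_matrixI[OF open_GL])
  fix i j :: 'n
  let ?C = "\<lambda>A::real^'n^'n. (\<chi> k l. if l = i then axis j 1 $ k else A $ k $ l) :: real^'n^'n"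
  have "smooth_on GL ?C"
  proof (rule smooth_on_matrixI[OF open_GL])
    fix k l :: 'n
    show "smooth_on GL (\<lambda>A. ?C A $ k $ l)"
      using smooth_on_entry[OF open_GL] by (cases "l = i") auto
  qed
  then have "smooth_on GL (\<lambda>A. det (?C A) / det A)"
    by (intro smooth_on_divide open_GL smooth_on_det smooth_on_id) (auto simp: GL_iff)
  then show "smooth_on GL (\<lambda>A. matrix_inv A $ i $ j)"
    by (rule smooth_on_cong[OF open_GL, rotated]) (simp only: matrix_inv_entry)
qed

lemma smooth_on_matrix_inv:
  fixes f :: "'a::euclidean_space \<Rightarrow> real^'n^'n"
  assumes "open U" "smooth_on U f" "\<And>x. x \<in> U \<Longrightarrow> f x \<in> GL"
  shows "smooth_on U (\<lambda>x. matrix_inv (f x))"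
  using assms by (intro smooth_on_compose[OF _ open_GL _ _ smooth_on_matrix_inv_GL]) auto

text \<open>Smoothness already supplies some derivative \<open>D\<close>; its value follows by
  differentiating the constant \<open>X ** matrix_inv X\<close> and solving for
  \<open>D V\<close>.\<close>

lemma has_derivative_matrix_inv:
  fixes A :: "real^'n^'n"
  assumes "A \<in> GL"
  shows "(matrix_inv has_derivative (\<lambda>V. - (matrix_inv A ** V ** matrix_inv A))) (at A)"
proof -
  obtain D where D: "(matrix_inv has_derivative D) (at A)"
    using smooth_on_imp_has_derivative[OF smooth_on_matrix_inv_GL assms] by blast
  have "((\<lambda>X. X ** matrix_inv X) has_derivative (\<lambda>V. A ** D V + V ** matrix_inv A)) (at A)"
    by (rule matrix_mult.FDERIV[OF has_derivative_ident D])
  then have "((\<lambda>X. mat 1) has_derivative (\<lambda>V. A ** D V + V ** matrix_inv A)) (at A)"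
    by (rule has_derivative_transform_within_open[OF _ open_GL assms]) (rule matrix_inv_right)
  from has_derivative_unique[OF this has_derivative_const]
  have *: "A ** D V + V ** matrix_inv A = 0" for V
    by (rule fun_cong)
  have "D V = - (matrix_inv A ** V ** matrix_inv A)" for V
  proof -
    have "matrix_inv A ** (A ** D V + V ** matrix_inv A) = 0"
      unfolding * by (rule matrix_mult.zero_right)
    then have "D V + matrix_inv A ** V ** matrix_inv A = 0"
      unfolding matrix_mult.add_right matrix_mul_assoc matrix_inv_left[OF assms] matrix_mul_lid .
    then show ?thesis
      by (simp only: eq_neg_iff_add_eq_0)
  qed
  then have "D = (\<lambda>V. - (matrix_inv A ** V ** matrix_inv A))"
    by (rule ext)
  with D show ?thesis by (simp only:)
qed

text \<open>A diagonal matrix or a row operation on \<open>mat 1\<close>. It serves twice: for the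
  derivative of \<open>det\<close> at \<open>mat 1\<close>, and to keep the lines of transvections
  inside \<open>GL\<close>.\<close>

lemma det_add_elementary:
  "det (mat 1 + t *\<^sub>R axis i (axis j 1) :: real^'n^'n) = (if i = j then 1 + t else 1)"
proof (cases "i = j")
  case True
  have "det (mat 1 + t *\<^sub>R axis i (axis i 1) :: real^'n^'n) = (\<Prod>k\<in>UNIV. (mat 1 + t *\<^sub>R axis i (axis i 1) :: real^'n^'n) $ k $ k)"
    by (rule det_diagonal) (auto simp: mat_def axis_def)
  also have "\<dots> = (\<Prod>k\<in>UNIV. if k = i then 1 + t else 1)"
    by (rule prod.cong) (auto simp: mat_def axis_def)
  finally show ?thesis using True by simp
next
  case False
  have "mat 1 + t *\<^sub>R axis i (axis j 1) = (\<chi> k. if k = i then row i (mat 1) + t *s row j (mat 1) else row k (mat 1) :: real^'n^'n)"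
    by (auto simp: vec_eq_iff mat_def axis_def row_def)
  then show ?thesis
    using det_row_operation[OF False, of "mat 1 :: real^'n^'n" t] False by simp
qed

text \<open>Jacobi's formula. On elementary directions at \<open>mat 1\<close> the determinant is
  affine, which identifies the derivative there with the trace; multiplicativity of
  \<open>det\<close> carries the result to \<open>A\<close>.\<close>

lemma has_derivative_det:
  fixes A :: "real^'n^'n"
  assumes "A \<in> GL"
  shows "(det has_derivative (\<lambda>V. det A * trace (matrix_inv A ** V))) (at A)"
proof -
  obtain L where L: "(det has_derivative L) (at (mat 1 :: real^'n^'n))"
    using smooth_on_imp_has_derivative[OF smooth_on_det[OF open_UNIV smooth_on_id[OF open_UNIV]]] by blast
  then interpret L: linear L by (rule has_derivative_linear)
  have L_axis: "L (axis i (axis j 1)) = (if i = j then 1 else 0)" for i j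
  proof -
    let ?E = "axis i (axis j 1) :: real^'n^'n"
    have "((\<lambda>t. mat 1 + t *\<^sub>R ?E) has_derivative (\<lambda>t. t *\<^sub>R ?E)) (at 0)"
      by (auto intro!: derivative_eq_intros)
    moreover have "(det has_derivative L) (at (mat 1 + 0 *\<^sub>R ?E))"
      using L by simp
    ultimately have "((\<lambda>t. det (mat 1 + t *\<^sub>R ?E)) has_derivative (\<lambda>t. L (t *\<^sub>R ?E))) (at 0)"
      using has_derivative_compose by blast
    then have "((\<lambda>t. if i = j then 1 + t else 1) has_derivative (\<lambda>t. L (t *\<^sub>R ?E))) (at 0)"
      by (simp add: det_add_elementary)
    moreover have "((\<lambda>t. if i = j then 1 + t else 1) has_derivative (\<lambda>t::real. if i = j then t else 0)) (at 0)"
      by (cases "i = j") (auto intro!: derivative_eq_intros)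
    ultimately have "(\<lambda>t. L (t *\<^sub>R ?E)) = (\<lambda>t. if i = j then t else 0)"
      by (rule has_derivative_unique)
    from fun_cong[OF this, of 1] show ?thesis by simp
  qed
  have L_trace: "L W = trace W" for W
  proof -
    have "L W = L (\<Sum>i\<in>UNIV. \<Sum>j\<in>UNIV. (W $ i $ j) *\<^sub>R axis i (axis j 1))"
      by (simp add: sum_axis_axis)
    also have "\<dots> = trace W"
      by (simp add: L.sum L.scale L_axis trace_def if_distrib cong: if_cong)
    finally show ?thesis .
  qed
  have "((\<lambda>X. matrix_inv A ** X) has_derivative (\<lambda>V. matrix_inv A ** V)) (at A)"
    by (rule bounded_linear_imp_has_derivative[OF matrix_mult.bounded_linear_right])
  moreover have "(det has_derivative L) (at (matrix_inv A ** A))"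
    using L by (simp add: matrix_inv_left[OF assms])
  ultimately have "((\<lambda>X. det (matrix_inv A ** X)) has_derivative (\<lambda>V. L (matrix_inv A ** V))) (at A)"
    using has_derivative_compose by blast
  then have "((\<lambda>X. det A * det (matrix_inv A ** X)) has_derivative (\<lambda>V. det A * L (matrix_inv A ** V))) (at A)"
    by (rule has_derivative_mult_right)
  moreover have "det A * det (matrix_inv A ** X) = det X" for X
    using assms by (simp add: det_mul det_matrix_inv GL_iff)
  ultimately show ?thesis by (simp add: L_trace)
qed

lemma det_scaleR: "det (c *\<^sub>R A :: real^'n^'n) = c ^ CARD('n) * det A"
proof -
  have "c *\<^sub>R A = (\<chi> i. c *s A $ i)"
    by (simp add: vec_eq_iff)
  then show ?thesis
    using det_rows_mul[of "\<lambda>i. c" "\<lambda>i. A $ i"] by simp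
qed

section \<open>Matrices of positive determinant and their normalization\<close>

definition GLplus :: "(real^'n^'n) set" where
  "GLplus = {A. 0 < det A}"

lemma open_GLplus: "open (GLplus :: (real^'n^'n) set)"
proof -
  have *: "GLplus = (det :: real^'n^'n \<Rightarrow> real) -` {0<..}"
    by (auto simp: GLplus_def)
  show ?thesis
    unfolding * by (intro open_vimage continuous_on_det open_greaterThan)
qed

lemma GLplus_subset_GL: "GLplus \<subseteq> GL"
  by (auto simp: GLplus_def GL_iff)

lemma SL_subset_GLplus: "SL \<subseteq> GLplus"
  by (auto simp: GLplus_def SL_def)

text \<open>The radial coordinate of \<open>GLplus\<close>. The root of order
  \<open>CARD('n)\<close> makes it homogeneous of degree one, so that dividing a matrix by it gives
  determinant \<open>1\<close>.\<close>

definition det_root :: "real^'n^'n \<Rightarrow> real" where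
  "det_root A = det A powr (1 / real CARD('n))"

lemma det_root_pos: "A \<in> GLplus \<Longrightarrow> 0 < det_root A"
  by (simp add: det_root_def GLplus_def)

lemma det_root_eq_1: "A \<in> SL \<Longrightarrow> det_root A = 1"
  by (simp add: det_root_def SL_def)

lemma smooth_on_det_root: "smooth_on GLplus (det_root :: real^'n^'n \<Rightarrow> real)"
  unfolding det_root_def[abs_def]
  by (rule smooth_on_compose[OF open_GLplus _ _ smooth_on_det[OF open_GLplus smooth_on_id] smooth_on_powr])
    (auto simp: GLplus_def open_GLplus[unfolded GLplus_def])

lemma has_derivative_det_root:
  fixes A :: "real^'n^'n"
  assumes "A \<in> GLplus"
  shows "(det_root has_derivative (\<lambda>V. det_root A * trace (matrix_inv A ** V) / CARD('n))) (at A)"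
proof -
  have "A \<in> GL" "0 < det A"
    using assms GLplus_subset_GL by (auto simp: GLplus_def)
  then have "((\<lambda>X. det X powr (1 / real CARD('n))) has_derivative
      (\<lambda>V. (det A * trace (matrix_inv A ** V)) * (1 / CARD('n) * det A powr (1 / CARD('n) - 1)))) (at A)"
    using has_derivative_compose[OF has_derivative_det
        has_real_derivative_powr[of _ "1 / CARD('n)", unfolded has_field_derivative_def]]
    by (simp add: mult.commute)
  moreover have "det A powr (1 / real CARD('n)) = det A * det A powr (1 / real CARD('n) - 1)"
    using \<open>0 < det A\<close> by (simp add: powr_diff)
  ultimately show ?thesis
    unfolding det_root_def[abs_def] by (simp add: mult_ac)
qed

text \<open>A smooth retraction of the open set \<open>GLplus\<close> onto \<open>SL\<close>. It
  yields the tangent vectors of \<open>SL\<close>, the connectedness of \<open>SL\<close>, and the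
  extension of maps from \<open>SL\<close> to an open set.\<close>

definition normalize_det :: "real^'n^'n \<Rightarrow> real^'n^'n" where
  "normalize_det A = inverse (det_root A) *\<^sub>R A"

lemma normalize_det_in_SL:
  fixes A :: "real^'n^'n"
  assumes "A \<in> GLplus"
  shows "normalize_det A \<in> SL"
proof -
  have "det_root A ^ CARD('n) = det A"
    using assms by (simp add: det_root_def GLplus_def powr_realpow[symmetric] powr_powr)
  then show ?thesis
    using assms det_root_pos[OF assms]
    by (simp add: SL_def normalize_det_def det_scaleR power_inverse GLplus_def)
qed

lemma normalize_det_id: "A \<in> SL \<Longrightarrow> normalize_det A = A"
  by (simp add: normalize_det_def det_root_eq_1)

lemma smooth_on_normalize_det: "smooth_on GLplus (normalize_det :: real^'n^'n \<Rightarrow> real^'n^'n)"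
proof -
  have "smooth_on GLplus (\<lambda>A::real^'n^'n. inverse (det_root A))"
    using det_root_pos
    by (intro smooth_on_compose[OF open_GLplus _ _ smooth_on_det_root smooth_on_inverse]) force+
  then show ?thesis
    unfolding normalize_det_def[abs_def]
    by (intro smooth_on_scaleR smooth_on_id open_GLplus)
qed

text \<open>Up to the scalar in front this is the projection along the ray through \<open>A\<close>
  onto the kernel of \<open>trace (matrix_inv A ** V)\<close>; the division by
  \<open>CARD('n)\<close> compensates \<open>trace (mat 1)\<close>.\<close>

lemma has_derivative_normalize_det:
  fixes A :: "real^'n^'n"
  assumes "A \<in> GLplus"
  shows "(normalize_det has_derivative
    (\<lambda>V. inverse (det_root A) *\<^sub>R (V - (trace (matrix_inv A ** V) / CARD('n)) *\<^sub>R A))) (at A)"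
proof -
  let ?\<tau> = "\<lambda>V. trace (matrix_inv A ** V) / CARD('n)"
  have "((\<lambda>A. inverse (det_root A)) has_derivative
      (\<lambda>V. - (inverse (det_root A) * (det_root A * trace (matrix_inv A ** V) / CARD('n)) * inverse (det_root A)))) (at A)"
    using det_root_pos[OF assms] by (intro Deriv.has_derivative_inverse has_derivative_det_root assms) auto
  then have "((\<lambda>A. inverse (det_root A)) has_derivative (\<lambda>V. - (inverse (det_root A) * ?\<tau> V))) (at A)"
    by (rule has_derivative_eq_rhs) (use det_root_pos[OF assms] in \<open>simp add: fun_eq_iff field_simps\<close>)
  from has_derivative_scaleR[OF this has_derivative_ident] show ?thesis
    unfolding normalize_det_def[abs_def]
    by (rule has_derivative_eq_rhs) (simp add: fun_eq_iff algebra_simps)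
qed

section \<open>Curves and differentials\<close>

lemma curve_through_eventually_in:
  assumes "curve_through M p v \<gamma>" "open U" "p \<in> U"
  shows "\<exists>d>0. smooth_on {-d<..<d} \<gamma> \<and> \<gamma> ` {-d<..<d} \<subseteq> U \<inter> M"
proof -
  obtain e where e: "e > 0" "smooth_on {-e<..<e} \<gamma>" "\<gamma> ` {-e<..<e} \<subseteq> M" and "\<gamma> 0 = p"
    using assms(1) unfolding curve_through_def by blast
  have "open ({-e<..<e} \<inter> \<gamma> -` U)"
    by (rule continuous_open_preimage[OF smooth_on_imp_continuous_on[OF e(2)] open_greaterThanLessThan assms(2)])
  moreover have "0 \<in> {-e<..<e} \<inter> \<gamma> -` U"
    using e(1) assms(3) \<open>\<gamma> 0 = p\<close> by simp
  ultimately obtain d where d: "d > 0" "ball 0 d \<subseteq> {-e<..<e} \<inter> \<gamma> -` U"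
    using open_contains_ball by blast
  have "{-d<..<d} \<subseteq> {-e<..<e} \<inter> \<gamma> -` U"
    using d(2) by (auto simp: subset_iff dist_real_def)
  then show ?thesis
    using d(1) e(3) smooth_on_subset[OF e(2), of "{-d<..<d}"] by (intro exI[of _ d]) auto
qed

lemma curve_through_compose_has_vector_derivative:
  assumes "curve_through M p v \<gamma>" "open U" "p \<in> U"
    and "(F has_derivative F') (at p)" "\<And>x. x \<in> U \<inter> M \<Longrightarrow> F x = f x"
  shows "((f \<circ> \<gamma>) has_vector_derivative F' v) (at 0)"
proof -
  obtain d where d: "d > 0" "\<gamma> ` {-d<..<d} \<subseteq> U \<inter> M"
    using curve_through_eventually_in[OF assms(1-3)] by blast
  have "\<gamma> 0 = p" and \<gamma>': "(\<gamma> has_derivative (\<lambda>t. t *\<^sub>R v)) (at 0)"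
    using assms(1) unfolding curve_through_def has_vector_derivative_def by auto
  then have "((\<lambda>t. F (\<gamma> t)) has_derivative (\<lambda>t. F' (t *\<^sub>R v))) (at 0)"
    using assms(4) has_derivative_compose by blast
  then have "((\<lambda>t. F (\<gamma> t)) has_derivative (\<lambda>t. t *\<^sub>R F' v)) (at 0)"
    using has_derivative_linear[OF assms(4)] by (simp add: linear_scale)
  then have "((f \<circ> \<gamma>) has_derivative (\<lambda>t. t *\<^sub>R F' v)) (at 0)"
    by (rule has_derivative_transform_within_open[of _ _ _ _ "{-d<..<d}"]) (use d assms(5) in \<open>auto simp: image_subset_iff\<close>)
  then show ?thesis
    unfolding has_vector_derivative_def .
qed

text \<open>This gives the definite description in \<open>differential\<close> its meaning: along
  every curve the chain rule for a local extension produces the same vector, and a tangent vector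
  comes with at least one curve. The extension may be chosen freely, since only the values on
  \<open>M\<close> enter.\<close>

lemma differential_eq:
  assumes "v \<in> tangent_space M p" "open U" "p \<in> U"
    and "(F has_derivative F') (at p)" "\<And>x. x \<in> U \<inter> M \<Longrightarrow> F x = f x"
  shows "differential M f p v = F' v"
  unfolding differential_def
proof (rule the_equality)
  show *: "\<forall>\<gamma>. curve_through M p v \<gamma> \<longrightarrow> ((f \<circ> \<gamma>) has_vector_derivative F' v) (at 0)"
    using curve_through_compose_has_vector_derivative[OF _ assms(2-)] by blast
  obtain \<gamma> where \<gamma>: "curve_through M p v \<gamma>"
    using assms(1) unfolding tangent_space_def by blast
  fix w assume "\<forall>\<gamma>. curve_through M p v \<gamma> \<longrightarrow> ((f \<circ> \<gamma>) has_vector_derivative w) (at 0)"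
  then show "w = F' v"
    using * \<gamma> vector_derivative_unique_at by blast
qed

lemma smooth_map_local_extension:
  assumes "smooth_map M f" "p \<in> M"
  obtains U F where "open U" "p \<in> U" "smooth_on U F" "\<And>x. x \<in> U \<inter> M \<Longrightarrow> F x = f x"
    "(F has_derivative frechet_derivative F (at p)) (at p)"
  using assms unfolding smooth_map_def by (metis smooth_on_imp_has_derivative)

lemma curve_through_compose:
  assumes "smooth_map M f" "p \<in> M" "f ` M \<subseteq> N" "curve_through M p v \<gamma>"
  shows "curve_through N (f p) (differential M f p v) (f \<circ> \<gamma>)"
proof -
  obtain U F where F: "open U" "p \<in> U" "smooth_on U F" "\<And>x. x \<in> U \<inter> M \<Longrightarrow> F x = f x"
    "(F has_derivative frechet_derivative F (at p)) (at p)"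
    using smooth_map_local_extension[OF assms(1,2)] by blast
  have "v \<in> tangent_space M p"
    using assms(4) unfolding tangent_space_def by blast
  then have "((f \<circ> \<gamma>) has_vector_derivative differential M f p v) (at 0)"
    using differential_eq[OF _ F(1,2,5,4)] curve_through_compose_has_vector_derivative[OF assms(4) F(1,2,5,4)]
    by simp
  moreover obtain d where d: "d > 0" "smooth_on {-d<..<d} \<gamma>" "\<gamma> ` {-d<..<d} \<subseteq> U \<inter> M"
    using curve_through_eventually_in[OF assms(4) F(1,2)] by blast
  have "smooth_on {-d<..<d} (\<lambda>t. F (\<gamma> t))"
    using d by (intro smooth_on_compose[OF _ F(1) _ _ F(3)]) auto
  then have "smooth_on {-d<..<d} (f \<circ> \<gamma>)"
    by (rule smooth_on_cong[OF open_greaterThanLessThan, rotated]) (use d F(4) in \<open>auto simp: image_subset_iff\<close>)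
  moreover have "(f \<circ> \<gamma>) ` {-d<..<d} \<subseteq> N"
    using d(3) assms(3) by (auto simp: image_subset_iff)
  moreover have "(f \<circ> \<gamma>) 0 = f p"
    using assms(4) by (simp add: curve_through_def)
  ultimately show ?thesis
    unfolding curve_through_def using d(1) by blast
qed

lemma differential_in_tangent_space:
  "smooth_map M f \<Longrightarrow> p \<in> M \<Longrightarrow> f ` M \<subseteq> N \<Longrightarrow> v \<in> tangent_space M p
    \<Longrightarrow> differential M f p v \<in> tangent_space N (f p)"
  using curve_through_compose unfolding tangent_space_def by blast

lemma differential_compose:
  assumes "smooth_map M f" "p \<in> M" "f ` M \<subseteq> N" "smooth_map N g" "v \<in> tangent_space M p"
  shows "differential M (g \<circ> f) p v = differential N g (f p) (differential M f p v)"
proof -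
  obtain \<gamma> where \<gamma>: "curve_through M p v \<gamma>"
    using assms(5) unfolding tangent_space_def by blast
  have "smooth_map M (g \<circ> f)"
    using smooth_map_compose[OF assms(1,3,4)] by (simp add: comp_def)
  then have "((g \<circ> f) \<circ> \<gamma> has_vector_derivative differential M (g \<circ> f) p v) (at 0)"
    using curve_through_compose[OF _ assms(2) _ \<gamma>, of "g \<circ> f" UNIV] unfolding curve_through_def by blast
  moreover have "(g \<circ> (f \<circ> \<gamma>) has_vector_derivative differential N g (f p) (differential M f p v)) (at 0)"
    using curve_through_compose[OF assms(4) _ _ curve_through_compose[OF assms(1-3) \<gamma>], of UNIV] assms(2,3)
    unfolding curve_through_def by blast
  ultimately show ?thesis
    using vector_derivative_unique_at by (metis comp_assoc)
qed

lemma tangent_space_open: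
  assumes "open U" "p \<in> U"
  shows "tangent_space U p = UNIV"
proof -
  have "v \<in> tangent_space U p" for v
  proof -
    let ?\<gamma> = "\<lambda>t::real. p + t *\<^sub>R v"
    have "open (?\<gamma> -` U)"
      by (intro open_vimage assms(1) continuous_intros)
    moreover have "0 \<in> ?\<gamma> -` U"
      using assms(2) by simp
    ultimately obtain e where "e > 0" and e: "ball 0 e \<subseteq> ?\<gamma> -` U"
      using open_contains_ball by blast
    have "{-e<..<e} \<subseteq> ball 0 e"
      by (auto simp: dist_real_def)
    then have "?\<gamma> ` {-e<..<e} \<subseteq> U"
      using e by blast
    moreover have "smooth_on {-e<..<e} ?\<gamma>"
      by (intro smooth_on_add smooth_on_scaleR smooth_on_id smooth_on_const) auto
    moreover have "(?\<gamma> has_vector_derivative v) (at 0)"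
      by (auto intro!: derivative_eq_intros)
    ultimately have "curve_through U p v ?\<gamma>"
      unfolding curve_through_def using \<open>e > 0\<close> by auto
    then show ?thesis unfolding tangent_space_def by blast
  qed
  then show ?thesis by blast
qed

section \<open>Diffeomorphisms and isometries\<close>

lemma diffeomorphismI:
  assumes "smooth_map M f" "smooth_map N g" "f ` M \<subseteq> N" "g ` N \<subseteq> M"
    and "\<And>x. x \<in> M \<Longrightarrow> g (f x) = x" "\<And>y. y \<in> N \<Longrightarrow> f (g y) = y"
  shows "diffeomorphism M N f"
proof -
  have bij: "bij_betw f M N"
    by (rule bij_betwI[of _ _ _ g]) (use assms in auto)
  have "smooth_map N (inv_into M f)"
  proof (rule smooth_map_cong[OF assms(2)])
    fix y assume "y \<in> N"
    then have "inv_into M f (f (g y)) = g y"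
      using bij assms(4) by (intro inv_into_f_f) (auto simp: bij_betw_def)
    then show "g y = inv_into M f y"
      using assms(6)[OF \<open>y \<in> N\<close>] by simp
  qed
  then show ?thesis
    using bij assms(1) unfolding diffeomorphism_def by blast
qed

lemma diffeomorphism_compose:
  assumes "diffeomorphism M N f" "diffeomorphism N K h"
  shows "diffeomorphism M K (h \<circ> f)"
proof -
  have f: "bij_betw f M N" "smooth_map M f" "smooth_map N (inv_into M f)"
    and h: "bij_betw h N K" "smooth_map N h" "smooth_map K (inv_into N h)"
    using assms unfolding diffeomorphism_def by auto
  have im: "f ` M = N" "h ` N = K" "inv_into M f ` N = M" "inv_into N h ` K = N"
    using bij_betw_imp_surj_on[OF f(1)] bij_betw_imp_surj_on[OF h(1)]
      bij_betw_imp_surj_on[OF bij_betw_inv_into[OF f(1)]] bij_betw_imp_surj_on[OF bij_betw_inv_into[OF h(1)]]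
    by auto
  show ?thesis
  proof (rule diffeomorphismI[where g = "\<lambda>y. inv_into M f (inv_into N h y)"])
    show "smooth_map M (h \<circ> f)"
      using smooth_map_compose[OF f(2) _ h(2)] im by (simp add: comp_def)
    show "smooth_map K (\<lambda>y. inv_into M f (inv_into N h y))"
      using smooth_map_compose[OF h(3) _ f(3)] im by simp
    show "(h \<circ> f) ` M \<subseteq> K" "(\<lambda>y. inv_into M f (inv_into N h y)) ` K \<subseteq> M"
      by (simp_all only: im flip: image_image image_comp)
    show "inv_into M f (inv_into N h ((h \<circ> f) x)) = x" if "x \<in> M" for x
    proof -
      have "f x \<in> N" using that im by blast
      then show ?thesis
        using that by (simp add: bij_betw_inv_into_left[OF f(1)] bij_betw_inv_into_left[OF h(1)])
    qed
    show "(h \<circ> f) (inv_into M f (inv_into N h y)) = y" if "y \<in> K" for y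
    proof -
      have "inv_into N h y \<in> N" using that im by blast
      then show ?thesis
        using that by (simp add: bij_betw_inv_into_right[OF f(1)] bij_betw_inv_into_right[OF h(1)])
    qed
  qed
qed

lemma isometry_image: "isometry M g f \<Longrightarrow> f ` M = M"
  unfolding isometry_def diffeomorphism_def bij_betw_def by blast

lemma isometry_smooth_map: "isometry M g f \<Longrightarrow> smooth_map M f"
  unfolding isometry_def diffeomorphism_def by blast

lemma isometry_compose:
  assumes "isometry M g f" "isometry M g h"
  shows "isometry M g (f \<circ> h)"
  unfolding isometry_def
proof (intro conjI ballI)
  show "diffeomorphism M M (f \<circ> h)"
    using assms diffeomorphism_compose unfolding isometry_def by blast
next
  fix p v w assume p: "p \<in> M" and v: "v \<in> tangent_space M p" and w: "w \<in> tangent_space M p"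
  note h = isometry_smooth_map[OF assms(2)] and f = isometry_smooth_map[OF assms(1)]
  have im: "h ` M \<subseteq> M" "h p \<in> M"
    using isometry_image[OF assms(2)] p by auto
  have "g (f (h p)) (differential M f (h p) (differential M h p v)) (differential M f (h p) (differential M h p w))
      = g (h p) (differential M h p v) (differential M h p w)"
    using assms(1) im differential_in_tangent_space[OF h p im(1) v] differential_in_tangent_space[OF h p im(1) w]
    unfolding isometry_def by blast
  also have "\<dots> = g p v w"
    using assms(2) p v w unfolding isometry_def by blast
  finally show "g ((f \<circ> h) p) (differential M (f \<circ> h) p v) (differential M (f \<circ> h) p w) = g p v w"
    using differential_compose[OF h p im(1) f v] differential_compose[OF h p im(1) f w] by simp
qed

text \<open>Meant for maps given by formulas on an open set of matrices. Invariance is checked for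
  all ambient vectors, so that the tangent spaces of \<open>M\<close> do not enter the
  computations.\<close>

lemma isometryI:
  assumes "open U" "M \<subseteq> U" "smooth_on U f" "smooth_on U k"
    and "f ` M \<subseteq> M" "k ` M \<subseteq> M" "\<And>x. x \<in> M \<Longrightarrow> k (f x) = x" "\<And>x. x \<in> M \<Longrightarrow> f (k x) = x"
    and "\<And>p. p \<in> M \<Longrightarrow> (f has_derivative f' p) (at p)"
    and "\<And>p v w. p \<in> M \<Longrightarrow> g (f p) (f' p v) (f' p w) = g p v w"
  shows "isometry M g f"
  unfolding isometry_def
proof (intro conjI ballI)
  show "diffeomorphism M M f"
    using assms by (intro diffeomorphismI[where g = k] smooth_on_imp_smooth_map[of U])
  show "g (f p) (differential M f p v) (differential M f p w) = g p v w"
    if "p \<in> M" "v \<in> tangent_space M p" "w \<in> tangent_space M p" for p v w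
    using differential_eq[OF that(2) assms(1) _ assms(9)] differential_eq[OF that(3) assms(1) _ assms(9)]
      that(1) assms(2,10) by auto
qed

section \<open>The groups as manifolds\<close>

lemma manifold_open:
  assumes "open (M :: 'a::euclidean_space set)"
  shows "manifold_of_dim DIM('a) M"
proof -
  have "diffeomorphism M M (\<lambda>x. x)"
    using assms by (intro diffeomorphismI[where g = "\<lambda>x. x"] smooth_on_imp_smooth_map[OF _ smooth_on_id]) auto
  moreover have "subspace (UNIV :: 'a set)" "dim (UNIV :: 'a set) = DIM('a)"
    by (auto simp: dim_UNIV)
  ultimately show ?thesis
    unfolding manifold_of_dim_def using assms
    by (intro ballI exI[of _ M] exI[of _ UNIV] exI[of _ "\<lambda>x. x"]) auto
qed

section \<open>The special linear group as a hypersurface\<close>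

definition cofactor :: "'n \<Rightarrow> 'n \<Rightarrow> real^'n^'n \<Rightarrow> real" where
  "cofactor i j X = det (\<chi> k. if k = i then axis j 1 else X $ k)"

lemma cofactor_add_elementary:
  fixes X :: "real^'n^'n"
  shows "cofactor i j (X + t *\<^sub>R axis i (axis j 1)) = cofactor i j X"
proof -
  have "(\<chi> k. if k = i then axis j 1 else (X + t *\<^sub>R axis i (axis j 1)) $ k)
      = (\<chi> k. if k = i then axis j 1 else X $ k :: real^'n^'n)"
    by (auto simp: vec_eq_iff axis_def)
  then show ?thesis by (simp only: cofactor_def)
qed

text \<open>Linearity of \<open>det\<close> in row \<open>i\<close>. Writing the slope as a
  determinant with that row replaced by a unit row avoids minors of smaller size.\<close>

lemma det_add_elementary_cofactor:
  fixes X :: "real^'n^'n"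
  shows "det (X + t *\<^sub>R axis i (axis j 1)) = det X + t * cofactor i j X"
proof -
  have "X + t *\<^sub>R axis i (axis j 1) = ((\<chi> k. if k = i then X $ k + t *s axis j 1 else X $ k) :: real^'n^'n)"
    by (auto simp: vec_eq_iff axis_def)
  then show ?thesis
    by (simp only: det_row_add det_row_mul cofactor_def if_cancel vec_lambda_eta)
qed

text \<open>Expanding row \<open>i\<close> in unit rows writes \<open>det X\<close> as a combination
  of the cofactors of this row, which therefore cannot all vanish.\<close>

lemma exists_cofactor_nonzero:
  fixes X :: "real^'n^'n"
  assumes "det X \<noteq> 0"
  shows "\<exists>j. cofactor i j X \<noteq> 0"
proof (rule ccontr)
  assume "\<nexists>j. cofactor i j X \<noteq> 0"
  then have *: "det (\<chi> k. if k = i then axis j 1 else X $ k) = 0" for j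
    by (simp add: cofactor_def)
  define r where "r = (\<Sum>j\<in>UNIV. X $ i $ j *s axis j 1)"
  have "X $ i = r"
    by (simp add: r_def basis_expansion)
  then have "X = (\<chi> k. if k = i then r else X $ k)"
    by (simp add: vec_eq_iff)
  then have "det X = det (\<chi> k. if k = i then r else X $ k)"
    by (rule arg_cong)
  also have "\<dots> = (\<Sum>j\<in>UNIV. det (\<chi> k. if k = i then X $ i $ j *s axis j 1 else X $ k))"
    unfolding r_def by (rule det_linear_row_sum[OF finite_class.finite_UNIV])
  also have "\<dots> = 0"
    by (simp add: det_row_mul *)
  finally show False using assms by simp
qed

lemma smooth_on_cofactor:
  assumes "open U"
  shows "smooth_on U (cofactor i j :: real^'n^'n \<Rightarrow> real)"
proof -
  have "smooth_on U (\<lambda>X::real^'n^'n. (\<chi> k. if k = i then axis j 1 else X $ k) :: real^'n^'n)"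
  proof (rule smooth_on_matrixI[OF assms])
    show "smooth_on U (\<lambda>X. (\<chi> k. if k = i then axis j 1 else X $ k :: real^'n^'n) $ k $ l)" for k l
      using smooth_on_entry[OF assms] by (cases "k = i") auto
  qed
  then show ?thesis
    unfolding cofactor_def[abs_def] by (rule smooth_on_det[OF assms])
qed

lemma inner_axis_axis:
  fixes X :: "real^'n^'n"
  shows "axis i (axis j 1) \<bullet> X = X $ i $ j"
  by (simp add: inner_axis')

text \<open>The determinant is affine in the entry \<open>(i, j)\<close> with slope the cofactor, so that where the
  cofactor does not vanish this entry can be traded for \<open>det X - 1\<close>.\<close>

lemma manifold_SL: "manifold_of_dim (DIM(real^'n^'n) - 1) (SL :: (real^'n^'n) set)"
  unfolding manifold_of_dim_def
proof
  fix P :: "real^'n^'n"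
  assume P: "P \<in> SL"
  obtain i :: 'n where True by blast
  obtain j where j: "cofactor i j P \<noteq> 0"
    using exists_cofactor_nonzero[of P i] P by (auto simp: SL_def)
  define U where "U = {X. cofactor i j X \<noteq> 0}"
  define E :: "real^'n^'n" where "E = axis i (axis j 1)"
  define \<phi> where "\<phi> X = X + (det X - 1 - X $ i $ j) *\<^sub>R E" for X
  \<comment> \<open>The preimage has the form \<open>Y + t *\<^sub>R E\<close> with
    \<open>det Y + t * cofactor i j Y - 1 = Y $ i $ j\<close>, and this is solved for
    \<open>t\<close>. The cofactor is the same before and after, as it ignores the entry that
    changes.\<close>
  define \<psi> where "\<psi> Y = Y + ((1 + Y $ i $ j - det Y) / cofactor i j Y) *\<^sub>R E" for Y
  have entry: "(X + t *\<^sub>R E) $ i $ j = X $ i $ j + t" for X t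
    by (simp add: E_def axis_def)
  have det: "det (X + t *\<^sub>R E) = det X + t * cofactor i j X" for X t
    unfolding E_def by (rule det_add_elementary_cofactor)
  have cof: "cofactor i j (X + t *\<^sub>R E) = cofactor i j X" for X t
    unfolding E_def by (rule cofactor_add_elementary)
  have U_eq: "U = cofactor i j -` (- {0})"
    by (auto simp: U_def)
  have "open U"
    unfolding U_eq
    by (intro open_vimage smooth_on_imp_continuous_on smooth_on_cofactor) auto
  have collect: "X + s *\<^sub>R E + t *\<^sub>R E = X" if "s + t = 0" for X s t
    using that by (simp add: add.assoc flip: scaleR_add_left)
  have \<psi>\<phi>: "\<psi> (\<phi> X) = X" if "X \<in> U" for X
    unfolding \<psi>_def \<phi>_def entry det cof
    by (rule collect) (use that in \<open>simp add: U_def field_simps\<close>)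
  have \<phi>\<psi>: "\<phi> (\<psi> X) = X" if "X \<in> U" for X
    unfolding \<psi>_def \<phi>_def entry det cof
    by (rule collect) (use that in \<open>simp add: U_def field_simps\<close>)
  have im: "\<phi> ` U \<subseteq> U" "\<psi> ` U \<subseteq> U"
    by (auto simp: U_def \<phi>_def \<psi>_def cof)
  have diffeo: "diffeomorphism U U \<phi>"
  proof (rule diffeomorphismI[OF _ _ im \<psi>\<phi> \<phi>\<psi>])
    have "smooth_on U \<phi>"
      unfolding \<phi>_def[abs_def] using \<open>open U\<close>
      by (intro smooth_on_add smooth_on_diff smooth_on_scaleR smooth_on_id smooth_on_det smooth_on_const smooth_on_entry)
    then show "smooth_map U \<phi>"
      by (rule smooth_on_imp_smooth_map[OF \<open>open U\<close>]) simp
    have "smooth_on U \<psi>"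
      unfolding \<psi>_def[abs_def] using \<open>open U\<close>
      by (intro smooth_on_add smooth_on_diff smooth_on_scaleR smooth_on_divide smooth_on_id smooth_on_det
          smooth_on_const smooth_on_entry smooth_on_cofactor) (auto simp: U_def)
    then show "smooth_map U \<psi>"
      by (rule smooth_on_imp_smooth_map[OF \<open>open U\<close>]) simp
  qed
  let ?S = "{Y. E \<bullet> Y = 0}"
  have E: "E \<bullet> Y = Y $ i $ j" for Y
    unfolding E_def by (rule inner_axis_axis)
  have "E \<noteq> 0"
    using entry[of 0 1] by auto
  have \<phi>_entry: "\<phi> X $ i $ j = det X - 1" for X
    unfolding \<phi>_def entry by simp
  have "\<phi> ` (U \<inter> SL) = U \<inter> ?S"
  proof (intro equalityI subsetI)
    fix Y assume "Y \<in> \<phi> ` (U \<inter> SL)"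
    then show "Y \<in> U \<inter> ?S"
      using im by (auto simp: E \<phi>_entry SL_def)
  next
    fix Y assume Y: "Y \<in> U \<inter> ?S"
    then have "\<phi> (\<psi> Y) = Y" "\<psi> Y \<in> U"
      using \<phi>\<psi> im by auto
    moreover from this have "\<psi> Y \<in> SL"
      using Y \<phi>_entry[of "\<psi> Y"] by (simp add: E SL_def)
    ultimately show "Y \<in> \<phi> ` (U \<inter> SL)"
      by (intro image_eqI[of _ _ "\<psi> Y"]) auto
  qed
  moreover have "P \<in> U"
    using j by (simp add: U_def)
  ultimately show "\<exists>U V S (\<phi> :: real^'n^'n \<Rightarrow> real^'n^'n). open U \<and> P \<in> U \<and> open V \<and> diffeomorphism U V \<phi> \<and>
      subspace S \<and> dim S = DIM(real^'n^'n) - 1 \<and> \<phi> ` (U \<inter> SL) = V \<inter> S"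
    using \<open>open U\<close> diffeo subspace_hyperplane[of E] dim_hyperplane[OF \<open>E \<noteq> 0\<close>]
    by (intro exI[of _ U] exI[of _ ?S] exI[of _ \<phi>] conjI)
qed

text \<open>One inclusion differentiates \<open>det\<close> along curves. For the other,
  \<open>normalize_det\<close> moves curves of \<open>GLplus\<close> into \<open>SL\<close>, and its
  derivative at a point of \<open>SL\<close> fixes every vector of the kernel.\<close>

lemma tangent_space_SL:
  fixes P :: "real^'n^'n"
  assumes "P \<in> SL"
  shows "tangent_space SL P = {V. trace (matrix_inv P ** V) = 0}"
proof (intro equalityI subsetI CollectI)
  have P: "P \<in> GL" "P \<in> GLplus" "det P = 1"
    using assms SL_subset_GL SL_subset_GLplus by (auto simp: SL_def)
  fix V assume "V \<in> tangent_space SL P"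
  then have "differential SL det P V = det P * trace (matrix_inv P ** V)"
    by (rule differential_eq[OF _ open_GL P(1) has_derivative_det[OF P(1)]]) simp
  \<comment> \<open>A second extension of the same map: on \<open>SL\<close> the determinant agrees
    with the constant \<open>1\<close>.\<close>
  moreover have "differential SL det P V = 0"
    by (rule differential_eq[OF \<open>V \<in> tangent_space SL P\<close> open_GL P(1) has_derivative_const[of 1]])
      (simp add: SL_def)
  ultimately show "trace (matrix_inv P ** V) = 0"
    using P by simp
next
  have P: "P \<in> GL" "P \<in> GLplus"
    using assms SL_subset_GL SL_subset_GLplus by auto
  fix V assume V: "V \<in> {V. trace (matrix_inv P ** V) = 0}"
  have tan: "V \<in> tangent_space GLplus P"
    using tangent_space_open[OF open_GLplus P(2)] by blast
  have "differential GLplus normalize_det P V \<in> tangent_space SL (normalize_det P)"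
    using normalize_det_in_SL
    by (intro differential_in_tangent_space[OF _ P(2) _ tan]
        smooth_on_imp_smooth_map[OF open_GLplus smooth_on_normalize_det]) auto
  moreover have "differential GLplus normalize_det P V
      = inverse (det_root P) *\<^sub>R (V - (trace (matrix_inv P ** V) / CARD('n)) *\<^sub>R P)"
    by (rule differential_eq[OF tan open_GLplus P(2) has_derivative_normalize_det[OF P(2)]]) simp
  ultimately show "V \<in> tangent_space SL P"
    using V assms by (simp add: normalize_det_id det_root_eq_1)
qed

section \<open>Signature\<close>

text \<open>Sylvester's law of inertia. A positive and a negative definite subspace meet only in
  \<open>0\<close>, so their dimensions add up to at most \<open>dim V\<close>; since
  \<open>S\<close> and \<open>T\<close> attain this bound, neither index can be larger.\<close>

lemma index_decomposition:
  fixes V :: "'a::euclidean_space set"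
  assumes "subspace V" "subspace S" "subspace T" "S \<subseteq> V" "T \<subseteq> V" "dim S + dim T = dim V"
    and "\<And>v. v \<in> S - {0} \<Longrightarrow> b v v > (0::real)" "\<And>v. v \<in> T - {0} \<Longrightarrow> b v v < 0"
  shows "positivity_index V b = dim S" "negativity_index V b = dim T"
proof -
  have bound: "dim W + dim W' \<le> dim V"
    if "subspace W" "subspace W'" "W \<subseteq> V" "W' \<subseteq> V"
      "\<And>v. v \<in> W - {0} \<Longrightarrow> b v v > 0" "\<And>v. v \<in> W' - {0} \<Longrightarrow> b v v < 0" for W W'
  proof -
    have "v = 0" if "v \<in> W \<inter> W'" for v
      using that \<open>\<And>v. v \<in> W - {0} \<Longrightarrow> b v v > 0\<close>[of v] \<open>\<And>v. v \<in> W' - {0} \<Longrightarrow> b v v < 0\<close>[of v]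
      by (cases "v = 0") auto
    then have "W \<inter> W' = {0}"
      using that(1,2) subspace_0 by blast
    then have "dim {x + y |x y. x \<in> W \<and> y \<in> W'} = dim W + dim W'"
      using dim_sums_Int[OF that(1,2)] by simp
    moreover have "{x + y |x y. x \<in> W \<and> y \<in> W'} \<subseteq> V"
      using that(3,4) assms(1) by (auto intro: subspace_add)
    ultimately show ?thesis
      using dim_subset[of "{x + y |x y. x \<in> W \<and> y \<in> W'}" V] by linarith
  qed
  have fin: "finite {dim W |W :: 'a set. P W}" for P
    by (rule finite_subset[of _ "{..DIM('a)}"]) (auto intro: dim_subset_UNIV)
  show "positivity_index V b = dim S"
    unfolding positivity_index_def
  proof (rule Max_eqI[OF fin])
    show "dim S \<in> {dim W |W. subspace W \<and> W \<subseteq> V \<and> (\<forall>w\<in>W - {0}. 0 < b w w)}"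
      using assms by blast
    fix k assume "k \<in> {dim W |W. subspace W \<and> W \<subseteq> V \<and> (\<forall>w\<in>W - {0}. 0 < b w w)}"
    then obtain W where "k = dim W" "subspace W" "W \<subseteq> V" "\<And>w. w\<in>W - {0} \<Longrightarrow> 0 < b w w"
      by blast
    then show "k \<le> dim S"
      using bound[of W T] assms by fastforce
  qed
  show "negativity_index V b = dim T"
    unfolding negativity_index_def
  proof (rule Max_eqI[OF fin])
    show "dim T \<in> {dim W |W. subspace W \<and> W \<subseteq> V \<and> (\<forall>w\<in>W - {0}. b w w < 0)}"
      using assms by blast
    fix k assume "k \<in> {dim W |W. subspace W \<and> W \<subseteq> V \<and> (\<forall>w\<in>W - {0}. b w w < 0)}"
    then obtain W where "k = dim W" "subspace W" "W \<subseteq> V" "\<And>w. w\<in>W - {0} \<Longrightarrow> b w w < 0"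
      by blast
    then show "k \<le> dim T"
      using bound[of S W] assms by fastforce
  qed
qed

section \<open>Symmetric and skew matrices\<close>

definition symmetric_matrices :: "(real^'n^'n) set" where
  "symmetric_matrices = {A. transpose A = A}"

definition skew_matrices :: "(real^'n^'n) set" where
  "skew_matrices = {A. transpose A = - A}"

lemma transpose_simps:
  fixes A B :: "real^'n^'n"
  shows "transpose (A + B) = transpose A + transpose B"
    and "transpose (A - B) = transpose A - transpose B"
    and "transpose (- A) = - transpose A"
    and "transpose (c *\<^sub>R A) = c *\<^sub>R transpose A"
    and "transpose (0 :: real^'n^'n) = 0"
  by (simp_all add: transpose_def vec_eq_iff)

lemma trace_transpose: "trace (transpose A) = trace (A :: real^'n^'n)"
  by (simp add: trace_def transpose_def)

lemma subspace_symmetric_matrices: "subspace symmetric_matrices"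
  by (auto simp: subspace_def symmetric_matrices_def transpose_simps)

lemma subspace_skew_matrices: "subspace skew_matrices"
  by (auto simp: subspace_def skew_matrices_def transpose_simps)

lemma trace_skew: "A \<in> skew_matrices \<Longrightarrow> trace A = 0"
  using trace_transpose[of A] trace_scaleR[of "-1" A] by (simp add: skew_matrices_def)

lemma trace_mult_transpose: "trace (A ** transpose A) = A \<bullet> (A :: real^'n^'n)"
  by (simp add: trace_def matrix_matrix_mult_def transpose_def inner_vec_def)

lemma inner_mat_1: "mat 1 \<bullet> A = trace (A :: real^'n^'n)"
proof -
  have "mat 1 $ i $ j * A $ i $ j = (if i = j then A $ i $ i else 0)" for i j
    by (simp add: mat_def)
  then show ?thesis
    by (simp add: inner_vec_def trace_def)
qed

lemma card_ordered_pairs: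
  fixes h :: "'n::finite \<Rightarrow> nat"
  assumes "inj h"
  shows "card {(i, j). h i < h j} = CARD('n) * (CARD('n) - 1) div 2"
proof -
  let ?L = "{(i, j). h i < h j}" and ?R = "{(i, j). h j < h i}" and ?D = "range (\<lambda>i::'n. (i, i))"
  have "?R = prod.swap ` ?L"
    by auto
  then have R: "card ?R = card ?L"
    by (simp add: card_image)
  have "(UNIV :: ('n \<times> 'n) set) = (?L \<union> ?R) \<union> ?D"
    using assms by (auto simp: inj_def)
  then have "card (UNIV :: ('n \<times> 'n) set) = card ((?L \<union> ?R) \<union> ?D)"
    by simp
  also have "\<dots> = card ?L + card ?R + card ?D"
    by (subst card_Un_disjoint; (subst card_Un_disjoint)?) auto
  also have "card ?D = CARD('n)"
    by (rule card_image) (auto simp: inj_def)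
  finally have "CARD('n) * CARD('n) = 2 * card ?L + CARD('n)"
    using R by simp
  then have "CARD('n) * (CARD('n) - 1) = 2 * card ?L"
    by (simp add: diff_mult_distrib2)
  then show ?thesis by simp
qed

text \<open>A skew matrix is determined by its strictly upper triangular part, with respect to an arbitrary
  linear order \<open>h\<close> of the index type.\<close>

lemma dim_skew_matrices: "dim (skew_matrices :: (real^'n^'n) set) = CARD('n) * (CARD('n) - 1) div 2"
proof -
  obtain h :: "'n \<Rightarrow> nat" where h: "inj h"
    using finite_imp_inj_to_nat_seg[of "UNIV :: 'n set"] by auto
  define d :: "(real^'n^'n) set" where "d = (\<lambda>(i, j). axis i (axis j 1)) ` {(i, j). h i < h j}"
  have inj_axis: "inj (\<lambda>(i, j). axis i (axis j 1) :: real^'n^'n)"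
    by (auto simp: inj_def axis_eq_axis)
  have "card d = card {(i, j). h i < h j}"
    unfolding d_def by (rule card_image) (rule inj_on_subset[OF inj_axis subset_UNIV])
  then have card_d: "card d = CARD('n) * (CARD('n) - 1) div 2"
    using card_ordered_pairs[OF h] by simp
  have in_d: "axis i (axis j 1) \<in> d \<longleftrightarrow> h i < h j" for i j
    unfolding d_def by (auto simp: axis_eq_axis)
  define T :: "(real^'n^'n) set" where "T = {X. \<forall>b\<in>Basis. b \<notin> d \<longrightarrow> X \<bullet> b = 0}"
  have T: "X \<in> T \<longleftrightarrow> (\<forall>i j. \<not> h i < h j \<longrightarrow> X $ i $ j = 0)" for X
    unfolding T_def by (auto simp: Basis_vec_def in_d inner_axis_axis inner_commute[of X])
  have "d \<subseteq> Basis"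
    by (auto simp: d_def Basis_vec_def)
  then have dim_T: "dim T = card d" "subspace T"
    unfolding T_def by (auto intro: dim_substandard subspace_substandard)
  \<comment> \<open>\<open>u\<close> maps skew matrices into \<open>T\<close> by forgetting the
    lower part, and \<open>a\<close> maps \<open>T\<close> back by antisymmetrization. Both are
    injective there, which gives the two inequalities between the dimensions.\<close>
  define u :: "real^'n^'n \<Rightarrow> real^'n^'n" where "u X = (\<chi> i j. if h i < h j then X $ i $ j else 0)" for X
  define a :: "real^'n^'n \<Rightarrow> real^'n^'n" where "a X = X - transpose X" for X
  have u: "linear u" and a: "linear a"
    by (auto simp: u_def a_def vec_eq_iff transpose_def algebra_simps intro!: linearI)
  have "dim (skew_matrices :: (real^'n^'n) set) = dim (u ` skew_matrices)"
  proof (rule dim_image_eq[OF u, symmetric])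
    have "X = 0" if X: "X \<in> skew_matrices" "u X = 0" for X
    proof -
      have *: "transpose X $ i $ j = - X $ i $ j" for i j
        using X(1) by (simp add: skew_matrices_def)
      have skew: "X $ j $ i = - X $ i $ j" for i j
        using *[of i j] by (simp add: transpose_def)
      have "u X $ i $ j = 0" for i j
        using X(2) by simp
      then have upper: "X $ i $ j = 0" if "h i < h j" for i j
        using that by (simp add: u_def) metis
      have "X $ i $ j = 0" for i j
        using upper[of i j] upper[of j i] skew[of i j] skew[of i i] h
        by (cases "h i" "h j" rule: linorder_cases) (auto simp: inj_def)
      then show ?thesis by (simp add: vec_eq_iff)
    qed
    then show "inj_on u (span skew_matrices)"
      unfolding span_eq_iff[THEN iffD2, OF subspace_skew_matrices]
        linear_injective_on_subspace_0[OF u subspace_skew_matrices] by blast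
  qed
  also have "\<dots> \<le> dim T"
    by (rule dim_subset) (auto simp: T u_def)
  finally have "dim (skew_matrices :: (real^'n^'n) set) \<le> card d"
    by (simp add: dim_T)
  moreover have "card d \<le> dim (skew_matrices :: (real^'n^'n) set)"
  proof -
    have "X = 0" if X: "X \<in> T" "a X = 0" for X
    proof -
      have "a X $ i $ j = 0" for i j
        using X(2) by simp
      then have "X $ i $ j = X $ j $ i" for i j
        by (simp add: a_def transpose_def)
      then have "X $ i $ j = 0" for i j
        using X(1) unfolding T by (metis less_asym)
      then show ?thesis by (simp add: vec_eq_iff)
    qed
    then have "inj_on a (span T)"
      unfolding span_eq_iff[THEN iffD2, OF dim_T(2)] linear_injective_on_subspace_0[OF a dim_T(2)] by blast
    then have "card d = dim (a ` T)"
      using dim_image_eq[OF a] dim_T(1) by metis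
    also have "\<dots> \<le> dim (skew_matrices :: (real^'n^'n) set)"
      by (rule dim_subset) (auto simp: a_def skew_matrices_def transpose_simps)
    finally show ?thesis .
  qed
  ultimately show ?thesis
    using card_d by simp
qed

text \<open>\<open>V\<close> will be the space of all matrices or of those with trace
  \<open>0\<close>. The two assumptions on it keep both halves of the splitting of \<open>A\<close>
  into \<open>A + transpose A\<close> and \<open>A - transpose A\<close> inside
  \<open>V\<close>.\<close>

lemma dim_symmetric_part:
  fixes V :: "(real^'n^'n) set"
  assumes "subspace V" "skew_matrices \<subseteq> V" "\<And>A. A \<in> V \<Longrightarrow> transpose A \<in> V"
  shows "dim (symmetric_matrices \<inter> V) + dim (skew_matrices :: (real^'n^'n) set) = dim V"
proof -
  have sub: "subspace (symmetric_matrices \<inter> V)"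
    by (rule subspace_inter[OF subspace_symmetric_matrices assms(1)])
  have "A = 0" if "A \<in> symmetric_matrices" "A \<in> skew_matrices" for A :: "real^'n^'n"
    using that by (simp add: symmetric_matrices_def skew_matrices_def eq_neg_iff_add_eq_0 flip: scaleR_2)
  then have "(symmetric_matrices \<inter> V) \<inter> skew_matrices = {0}"
    using subspace_0[OF sub] subspace_0[OF subspace_skew_matrices] by blast
  moreover have "{x + y |x y. x \<in> symmetric_matrices \<inter> V \<and> y \<in> skew_matrices} = V" (is "?L = V")
  proof (intro equalityI subsetI)
    show "A \<in> V" if "A \<in> ?L" for A
      using that assms(1,2) by (auto intro: subspace_add)
    fix A assume A: "A \<in> V"
    let ?s = "(1/2) *\<^sub>R (A + transpose A)"
    let ?k = "(1/2) *\<^sub>R (A - transpose A)"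
    have "?s \<in> V"
      using A assms by (intro subspace_scale subspace_add)
    moreover have "?s \<in> symmetric_matrices" "?k \<in> skew_matrices"
      by (simp_all add: symmetric_matrices_def skew_matrices_def transpose_simps add.commute flip: scaleR_minus_right)
    moreover have "A = ?s + ?k"
      by (simp add: algebra_simps flip: scaleR_add_left)
    ultimately show "A \<in> ?L" by blast
  qed
  ultimately show ?thesis
    using dim_sums_Int[OF sub subspace_skew_matrices] by simp
qed

text \<open>Left translation to the point \<open>P\<close> turns the metric into one form that does
  not depend on \<open>P\<close>; signature, nondegeneracy and rigidity all rest on this.\<close>

lemma trace_metric_left_mult:
  "P \<in> GL \<Longrightarrow> trace_metric P (P ** A) (P ** B) = trace (A ** B)"
  unfolding trace_metric_def by (simp only: matrix_mul_assoc matrix_inv_left matrix_mul_lid matrix_inv_cancel(4))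

text \<open>On symmetric matrices \<open>trace (A ** A)\<close> equals \<open>A \<bullet> A\<close>,
  on skew ones \<open>- (A \<bullet> A)\<close>, so the symmetric and the skew part of
  \<open>V\<close> are the definite subspaces required by
  \<open>index_decomposition\<close>.\<close>

lemma indices_trace_metric:
  fixes V :: "(real^'n^'n) set"
  assumes "subspace V" "skew_matrices \<subseteq> V" "\<And>A. A \<in> V \<Longrightarrow> transpose A \<in> V"
    and P: "P \<in> GL"
  shows "positivity_index ((**) P ` V) (trace_metric P) = dim V - CARD('n) * (CARD('n) - 1) div 2"
    and "negativity_index ((**) P ` V) (trace_metric P) = CARD('n) * (CARD('n) - 1) div 2"
proof -
  have lin: "linear ((**) P :: real^'n^'n \<Rightarrow> real^'n^'n)"
    by (rule bounded_linear.linear[OF matrix_mult.bounded_linear_right])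
  have inj: "inj ((**) P :: real^'n^'n \<Rightarrow> real^'n^'n)"
    by (rule inj_on_inverseI[where g = "(**) (matrix_inv P)"]) (simp add: matrix_inv_cancel(2) P)
  have dim: "dim ((**) P ` S) = dim S" for S :: "(real^'n^'n) set"
    by (rule dim_image_eq[OF lin]) (rule inj_on_subset[OF inj subset_UNIV])
  have sub: "subspace ((**) P ` S)" if "subspace S" for S :: "(real^'n^'n) set"
    by (rule linear_subspace_image[OF lin that])
  have pos: "trace_metric P v v > 0" if v: "v \<in> (**) P ` (symmetric_matrices \<inter> V) - {0}" for v
  proof -
    obtain A where A: "v = P ** A" "transpose A = A" "A \<noteq> 0"
      using v matrix_mult.zero_right[of P] unfolding symmetric_matrices_def by blast
    then show ?thesis
      using trace_mult_transpose[of A] by (simp add: trace_metric_left_mult[OF P])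
  qed
  have neg: "trace_metric P v v < 0" if v: "v \<in> (**) P ` skew_matrices - {0}" for v
  proof -
    obtain A where A: "v = P ** A" "transpose A = - A" "A \<noteq> 0"
      using v matrix_mult.zero_right[of P] unfolding skew_matrices_def by blast
    then have "- trace (A ** A) = A \<bullet> A"
      using trace_mult_transpose[of A] trace_scaleR[of "-1" "A ** A"] by (simp add: matrix_mult.minus_right)
    then show ?thesis
      using A by (simp add: trace_metric_left_mult[OF P]) (metis inner_gt_zero_iff neg_0_less_iff_less)
  qed
  have "dim ((**) P ` (symmetric_matrices \<inter> V)) + dim ((**) P ` (skew_matrices :: (real^'n^'n) set)) = dim ((**) P ` V)"
    unfolding dim by (rule dim_symmetric_part[OF assms(1-3)])
  note * = index_decomposition[OF sub[OF assms(1)] sub[OF subspace_inter[OF subspace_symmetric_matrices assms(1)]]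
      sub[OF subspace_skew_matrices] _ _ this, of "trace_metric P", OF _ _ pos neg]
  show "positivity_index ((**) P ` V) (trace_metric P) = dim V - CARD('n) * (CARD('n) - 1) div 2"
    using *(1) assms(2) dim_symmetric_part[OF assms(1-3)] by (simp add: dim dim_skew_matrices image_mono)
  show "negativity_index ((**) P ` V) (trace_metric P) = CARD('n) * (CARD('n) - 1) div 2"
    using *(2) assms(2) by (simp add: dim dim_skew_matrices image_mono)
qed

lemma tangent_space_SL_image:
  fixes P :: "real^'n^'n"
  assumes "P \<in> SL"
  shows "tangent_space SL P = (**) P ` {A. trace A = 0}"
proof -
  have P: "P \<in> GL" using assms SL_subset_GL by blast
  have "V \<in> (**) P ` {A. trace A = 0}" if "trace (matrix_inv P ** V) = 0" for V
    using that matrix_inv_cancel(1)[OF P, of V] by (intro image_eqI[of _ _ "matrix_inv P ** V"]) auto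
  then show ?thesis
    unfolding tangent_space_SL[OF assms] by (auto simp: matrix_inv_cancel(2)[OF P])
qed

lemma tangent_space_GL_image:
  fixes P :: "real^'n^'n"
  assumes "P \<in> GL"
  shows "tangent_space GL P = (**) P ` UNIV"
  unfolding tangent_space_open[OF open_GL assms] using matrix_inv_cancel(1)[OF assms] by (metis surj_def)

lemma half_square_sum: "(n::nat) * (n + 1) div 2 = n * n - n * (n - 1) div 2"
proof (cases n)
  case (Suc m)
  \<comment> \<open>The evenness of \<open>m * Suc m\<close> makes both divisions by
    \<open>2\<close> exact.\<close>
  have "even (m * Suc m)" by simp
  then obtain k where "m * Suc m = 2 * k" by (rule evenE)
  then have "n * (n - 1) div 2 = k" "n * n = 2 * k + n" "n * (n + 1) = 2 * (k + n)"
    by (simp_all add: Suc algebra_simps)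
  then show ?thesis by simp
qed simp

lemma has_signature_GL:
  "has_signature (GL :: (real^'n^'n) set) trace_metric
    (CARD('n) * (CARD('n) + 1) div 2, CARD('n) * (CARD('n) - 1) div 2)"
  unfolding has_signature_def
proof
  fix P :: "real^'n^'n" assume P: "P \<in> GL"
  show "(positivity_index (tangent_space GL P) (trace_metric P),
      negativity_index (tangent_space GL P) (trace_metric P))
    = (CARD('n) * (CARD('n) + 1) div 2, CARD('n) * (CARD('n) - 1) div 2)"
    using indices_trace_metric[of UNIV, OF subspace_UNIV _ _ P]
    unfolding tangent_space_GL_image[OF P] half_square_sum by (simp add: dim_UNIV)
qed

lemma has_signature_SL:
  "has_signature (SL :: (real^'n^'n) set) trace_metric
    (CARD('n) * (CARD('n) + 1) div 2 - 1, CARD('n) * (CARD('n) - 1) div 2)"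
  unfolding has_signature_def
proof
  fix P :: "real^'n^'n" assume P: "P \<in> SL"
  let ?V = "{A :: real^'n^'n. trace A = 0}"
  \<comment> \<open>The trace is the inner product with \<open>mat 1\<close>, so the trace-free
    matrices form a hyperplane once this normal vector is nonzero.\<close>
  have "(mat 1 :: real^'n^'n) \<noteq> 0"
    using trace_I[where 'a = real and 'n = 'n] by (auto simp: trace_def)
  then have V: "dim ?V = CARD('n) * CARD('n) - 1" "subspace ?V"
    using dim_hyperplane[of "mat 1 :: real^'n^'n"] subspace_hyperplane[of "mat 1 :: real^'n^'n"]
    by (simp_all add: inner_mat_1)
  show "(positivity_index (tangent_space SL P) (trace_metric P),
      negativity_index (tangent_space SL P) (trace_metric P))
    = (CARD('n) * (CARD('n) + 1) div 2 - 1, CARD('n) * (CARD('n) - 1) div 2)"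
    using indices_trace_metric[of ?V, OF V(2) _ _ subsetD[OF SL_subset_GL P]] trace_skew
    unfolding tangent_space_SL_image[OF P] half_square_sum V(1) by (auto simp: trace_transpose)
qed

section \<open>The trace metric\<close>

lemma bilinear_trace_metric: "bilinear_form_on V (trace_metric P)"
  unfolding bilinear_form_on_def trace_metric_def
  by (simp add: matrix_mult.add_left matrix_mult.add_right matrix_mult.scaleR_left matrix_mult.scaleR_right
      trace_add trace_scaleR)

lemma trace_metric_commute: "trace_metric P V W = trace_metric P W (V :: real^'n^'n)"
  unfolding trace_metric_def
  using trace_mul_sym[of "matrix_inv P ** V" "matrix_inv P ** W"] by (simp add: matrix_mul_assoc)

text \<open>Testing \<open>P ** A\<close> against \<open>P ** transpose A\<close> gives
  \<open>A \<bullet> A\<close>; hence the closure of \<open>V\<close> under transposition.\<close>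

lemma trace_metric_nondegenerate:
  fixes V :: "(real^'n^'n) set"
  assumes "P \<in> GL" "\<And>A. A \<in> V \<Longrightarrow> transpose A \<in> V"
    and "v \<in> (**) P ` V" "\<And>w. w \<in> (**) P ` V \<Longrightarrow> trace_metric P v w = 0"
  shows "v = 0"
proof -
  obtain A where A: "v = P ** A" "A \<in> V" using assms(3) by blast
  then have "A \<bullet> A = 0"
    using assms(4)[of "P ** transpose A"] assms(2)
    by (simp add: trace_metric_left_mult[OF assms(1)] trace_mult_transpose)
  then show ?thesis using A by (simp add: matrix_mult.zero_right)
qed

lemma smooth_map_trace_metric:
  fixes X Y :: "real^'n^'n \<Rightarrow> real^'n^'n"
  assumes "M \<subseteq> GL" "smooth_map M X" "smooth_map M Y"
  shows "smooth_map M (\<lambda>p. trace_metric p (X p) (Y p))"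
proof -
  have inv: "smooth_map M matrix_inv"
    by (rule smooth_on_imp_smooth_map[OF open_GL smooth_on_matrix_inv_GL assms(1)])
  have "smooth_map M (\<lambda>p. matrix_inv p ** X p ** matrix_inv p ** Y p)"
    by (intro smooth_map_bilinear[OF bounded_bilinear_matrix_mult] inv assms)
  moreover have "smooth_map UNIV (trace :: real^'n^'n \<Rightarrow> real)"
    by (rule smooth_on_imp_smooth_map[OF open_UNIV smooth_on_bounded_linear[OF bounded_linear_trace]]) auto
  ultimately show ?thesis
    unfolding trace_metric_def by (intro smooth_map_compose[of M _ UNIV trace]) auto
qed

lemma semi_riemannian_GL: "semi_riemannian_manifold (GL :: (real^'n^'n) set) trace_metric"
  unfolding semi_riemannian_manifold_def semi_riemannian_metric_def
proof (intro conjI ballI allI impI)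
  show "manifold (GL :: (real^'n^'n) set)"
    unfolding manifold_def using manifold_open[OF open_GL] by blast
  show "\<exists>s. has_signature (GL :: (real^'n^'n) set) trace_metric s"
    using has_signature_GL by blast
  show "v = 0" if "p \<in> GL" "v \<in> tangent_space GL p" "\<forall>w\<in>tangent_space GL p. trace_metric p v w = 0"
    for p v :: "real^'n^'n"
    using trace_metric_nondegenerate[of p UNIV v] that tangent_space_GL_image[OF that(1)] by blast
qed (auto simp: bilinear_trace_metric trace_metric_commute vector_field_def intro!: smooth_map_trace_metric)

lemma semi_riemannian_SL: "semi_riemannian_manifold (SL :: (real^'n^'n) set) trace_metric"
  unfolding semi_riemannian_manifold_def semi_riemannian_metric_def
proof (intro conjI ballI allI impI)
  show "manifold (SL :: (real^'n^'n) set)"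
    unfolding manifold_def using manifold_SL by blast
  show "\<exists>s. has_signature (SL :: (real^'n^'n) set) trace_metric s"
    using has_signature_SL by blast
  show "v = 0" if "p \<in> SL" "v \<in> tangent_space SL p" "\<forall>w\<in>tangent_space SL p. trace_metric p v w = 0"
    for p v :: "real^'n^'n"
    using that SL_subset_GL unfolding tangent_space_SL_image[OF that(1)]
    by (intro trace_metric_nondegenerate[of p "{A. trace A = 0}" v]) (auto simp: trace_transpose)
qed (auto simp: bilinear_trace_metric trace_metric_commute vector_field_def intro!: smooth_map_trace_metric[OF SL_subset_GL])

lemma semi_riemannian_submanifold_SL: "semi_riemannian_submanifold (SL :: (real^'n^'n) set) GL trace_metric"
  using semi_riemannian_GL semi_riemannian_SL SL_subset_GL
  unfolding semi_riemannian_submanifold_def submanifold_def semi_riemannian_manifold_def by blast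

section \<open>Isometries\<close>

text \<open>Translations, congruences and conjugacies are all of this form. Constraining only the
  product of the determinants admits conjugacies by arbitrary elements of \<open>GL\<close>.\<close>

lemma isometry_mult:
  fixes A B :: "real^'n^'n"
  assumes "det A * det B = 1"
  shows "isometry SL trace_metric (\<lambda>X. A ** X ** B)"
proof -
  have AB: "A \<in> GL" "B \<in> GL"
    using assms by (auto simp: GL_iff)
  have der: "((\<lambda>X. C ** X ** D) has_derivative (\<lambda>V. C ** V ** D)) (at X)" for C D X :: "real^'n^'n"
    by (intro bounded_linear_imp_has_derivative bounded_linear_compose[OF matrix_mult.bounded_linear_left]
        matrix_mult.bounded_linear_right)
  have smooth: "smooth_on UNIV (\<lambda>X. C ** X ** D)" for C D :: "real^'n^'n"
    by (intro smooth_on_matrix_mult smooth_on_const smooth_on_id open_UNIV)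
  show ?thesis
  proof (rule isometryI[OF open_UNIV subset_UNIV smooth smooth[of "matrix_inv A" "matrix_inv B"] _ _ _ _ der])
    show "(\<lambda>X. A ** X ** B) ` SL \<subseteq> SL"
      using assms by (auto simp: SL_def det_mul)
    have "inverse (det A) * inverse (det B) = 1"
      using assms by (simp flip: inverse_mult_distrib)
    then show "(\<lambda>X. matrix_inv A ** X ** matrix_inv B) ` SL \<subseteq> SL"
      using AB by (auto simp: SL_def det_mul det_matrix_inv)
    show "matrix_inv A ** (A ** X ** B) ** matrix_inv B = X" for X
      using AB by (simp only: matrix_mul_assoc matrix_inv_left matrix_inv_cancel(3) matrix_mul_lid)
    show "A ** (matrix_inv A ** X ** matrix_inv B) ** B = X" for X
      using AB by (simp only: matrix_mul_assoc matrix_inv_right matrix_inv_cancel(4) matrix_mul_lid)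
  next
    fix X V W :: "real^'n^'n"
    assume "X \<in> SL"
    then have X: "X \<in> GL" "A ** X \<in> GL"
      using SL_subset_GL AB by (auto simp: GL_iff det_mul)
    have "trace_metric (A ** X ** B) (A ** V ** B) (A ** W ** B)
        = trace (matrix_inv B ** matrix_inv X ** V ** matrix_inv X ** W ** B)"
      unfolding trace_metric_def matrix_inv_mult[OF X(2) AB(2)] matrix_inv_mult[OF AB(1) X(1)]
      by (simp only: matrix_mul_assoc matrix_inv_cancel(3,4) AB)
    also have "\<dots> = trace (B ** (matrix_inv B ** matrix_inv X ** V ** matrix_inv X ** W))"
      by (rule trace_mul_sym)
    also have "\<dots> = trace_metric X V W"
      unfolding trace_metric_def
      by (simp only: matrix_mul_assoc matrix_inv_right AB matrix_mul_lid)
    finally show "trace_metric (A ** X ** B) (A ** V ** B) (A ** W ** B) = trace_metric X V W" .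
  qed
qed

lemma isometry_left_translation: "G \<in> SL \<Longrightarrow> isometry SL trace_metric (left_translation G)"
  using isometry_mult[of G "mat 1"] by (simp add: SL_def left_translation_def[abs_def])

lemma isometry_right_translation: "G \<in> SL \<Longrightarrow> isometry SL trace_metric (right_translation G)"
  using isometry_mult[of "mat 1" G] by (simp add: SL_def right_translation_def[abs_def])

lemma isometry_congruence: "G \<in> SL \<Longrightarrow> isometry SL trace_metric (congruence G)"
  unfolding congruence_def[abs_def] by (rule isometry_mult) (simp add: SL_def)

lemma isometry_conjugacy: "G \<in> GL \<Longrightarrow> isometry SL trace_metric (conjugacy G)"
  unfolding conjugacy_def[abs_def]
  by (rule isometry_mult) (simp add: det_matrix_inv GL_iff)

lemma isometry_transpose:
  "isometry (SL :: (real^'n^'n) set) trace_metric transpose"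
proof (rule isometryI[OF open_UNIV subset_UNIV smooth_on_bounded_linear[OF bounded_linear_transpose open_UNIV]
      smooth_on_bounded_linear[OF bounded_linear_transpose open_UNIV] _ _ _ _
      bounded_linear_imp_has_derivative[OF bounded_linear_transpose]])
  fix X V W :: "real^'n^'n"
  assume "X \<in> SL"
  then have X: "X \<in> GL" using SL_subset_GL by blast
  have "transpose X ** transpose (matrix_inv X) = mat 1"
    unfolding matrix_transpose_mul[symmetric] matrix_inv_left[OF X] by (rule transpose_mat)
  then have "matrix_inv (transpose X) = transpose (matrix_inv X)"
    by (rule matrix_inv_unique)
  then have "trace_metric (transpose X) (transpose V)
      (transpose W) = trace (transpose (W ** matrix_inv X ** V ** matrix_inv X))"
    by (simp only: trace_metric_def matrix_transpose_mul matrix_mul_assoc)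
  also have "\<dots> = trace (W ** (matrix_inv X ** V ** matrix_inv X))"
    by (simp only: trace_transpose matrix_mul_assoc)
  also have "\<dots> = trace_metric X V W"
    unfolding trace_metric_def by (rule trace_mul_sym)
  finally show "trace_metric (transpose X) (transpose V)
      (transpose W) = trace_metric X V W" .
qed (auto simp: SL_def)

lemma isometry_matrix_inv: "isometry (SL :: (real^'n^'n) set) trace_metric matrix_inv"
proof (rule isometryI[OF open_GL SL_subset_GL smooth_on_matrix_inv_GL smooth_on_matrix_inv_GL])
  show "matrix_inv ` SL \<subseteq> (SL :: (real^'n^'n) set)" "matrix_inv ` SL \<subseteq> (SL :: (real^'n^'n) set)"
    using matrix_inv_in_SL by auto
  fix X :: "real^'n^'n" assume "X \<in> SL"
  then have X: "X \<in> GL" using SL_subset_GL by blast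
  then show "matrix_inv (matrix_inv X) = X" "matrix_inv (matrix_inv X) = X"
    by (rule matrix_inv_matrix_inv)+
  show "(matrix_inv has_derivative (\<lambda>V. - (matrix_inv X ** V ** matrix_inv X))) (at X)"
    by (rule has_derivative_matrix_inv[OF X])
  fix V W
  have "trace_metric (matrix_inv X) (- (matrix_inv X ** V ** matrix_inv X)) (- (matrix_inv X ** W ** matrix_inv X))
      = trace (V ** (matrix_inv X ** W ** matrix_inv X))"
    unfolding trace_metric_def matrix_inv_matrix_inv[OF X]
    by (simp only: matrix_mult.minus_left matrix_mult.minus_right minus_minus matrix_mul_assoc
        matrix_inv_right[OF X] matrix_mul_lid matrix_inv_cancel(4)[OF X])
  also have "\<dots> = trace_metric X W V"
    unfolding trace_metric_def by (rule trace_mul_sym)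
  also have "\<dots> = trace_metric X V W"
    by (rule trace_metric_commute)
  finally show "trace_metric (matrix_inv X) (- (matrix_inv X ** V ** matrix_inv X)) (- (matrix_inv X ** W ** matrix_inv X))
      = trace_metric X V W" .
qed

section \<open>Homogeneity, compositions and the symmetries\<close>

lemma homogeneous_SL: "homogeneous (SL :: (real^'n^'n) set) trace_metric"
  unfolding homogeneous_def
proof (intro ballI)
  fix P Q :: "real^'n^'n" assume PQ: "P \<in> SL" "Q \<in> SL"
  have "isometry SL trace_metric (left_translation (Q ** matrix_inv P))"
    by (rule isometry_left_translation[OF matrix_mult_in_SL[OF PQ(2) matrix_inv_in_SL[OF PQ(1)]]])
  moreover have "P \<in> GL" using PQ SL_subset_GL by blast
  then have "left_translation (Q ** matrix_inv P) P = Q"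
    by (simp only: left_translation_def matrix_inv_cancel(4))
  ultimately show "\<exists>f. isometry SL trace_metric f \<and> f P = Q" by blast
qed

lemma isometry_compositions:
  assumes "f \<in> compositions F" "\<And>f. f \<in> F \<Longrightarrow> isometry M g f"
  shows "isometry M g f"
  using assms(1) by induction (rule assms(2) isometry_compose; assumption)+

text \<open>The map \<open>X \<mapsto> P ** matrix_inv X ** P\<close> is matrix inversion, which is
  the symmetry at \<open>mat 1\<close>, carried to \<open>P\<close> by left translation. In its
  derivative at \<open>P\<close> all factors \<open>P\<close> cancel and the sign of the derivative
  of the inverse remains.\<close>

lemma symmetry_at_SL:
  fixes P :: "real^'n^'n"
  assumes P: "P \<in> SL"
  shows "symmetry_at SL trace_metric P (right_translation P \<circ> left_translation P \<circ> matrix_inv)"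
    (is "symmetry_at _ _ _ ?\<psi>")
  unfolding symmetry_at_def
proof (intro conjI ballI)
  have GL: "P \<in> GL" using P SL_subset_GL by blast
  show "isometry SL trace_metric ?\<psi>"
    by (intro isometry_compose isometry_left_translation isometry_right_translation isometry_matrix_inv P)
  show "?\<psi> P = P"
    by (simp add: left_translation_def right_translation_def matrix_inv_right[OF GL])
  fix v assume v: "v \<in> tangent_space SL P"
  have "((\<lambda>X. P ** X ** P) has_derivative (\<lambda>V. P ** V ** P)) (at (matrix_inv P))"
    by (intro bounded_linear_imp_has_derivative bounded_linear_compose[OF matrix_mult.bounded_linear_left]
        matrix_mult.bounded_linear_right)
  then have "((\<lambda>X. P ** matrix_inv X ** P) has_derivative
      (\<lambda>V. P ** (- (matrix_inv P ** V ** matrix_inv P)) ** P)) (at P)"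
    by (rule has_derivative_compose[OF has_derivative_matrix_inv[OF GL]])
  then have "differential SL ?\<psi> P v = P ** (- (matrix_inv P ** v ** matrix_inv P)) ** P"
    by (rule differential_eq[OF v open_UNIV UNIV_I]) (simp add: left_translation_def right_translation_def)
  also have "\<dots> = - v"
    by (simp only: matrix_mult.minus_left matrix_mult.minus_right matrix_mul_assoc
        matrix_inv_right[OF GL] matrix_mul_lid matrix_inv_cancel(4)[OF GL])
  finally show "differential SL ?\<psi> P v = - v" .
qed

section \<open>Connectedness\<close>

text \<open>Using connected sets instead of paths makes compatibility with products immediate: the
  image of a product of two connected sets under multiplication is connected.\<close>

definition GL_connected :: "real^'n^'n \<Rightarrow> real^'n^'n \<Rightarrow> bool" where
  "GL_connected A B \<longleftrightarrow> (\<exists>T\<subseteq>GL. connected T \<and> A \<in> T \<and> B \<in> T)"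

lemma GL_connected_trans: "GL_connected A B \<Longrightarrow> GL_connected B C \<Longrightarrow> GL_connected A C"
  unfolding GL_connected_def by (metis (no_types, lifting) IntI UnI1 UnI2 Un_least connected_Un empty_iff)

lemma GL_connected_refl: "A \<in> GL \<Longrightarrow> GL_connected A A"
  unfolding GL_connected_def by (rule exI[of _ "{A}"]) auto

lemma GL_mult: "A \<in> GL \<Longrightarrow> B \<in> GL \<Longrightarrow> A ** B \<in> GL"
  by (simp add: GL_iff det_mul)

lemma GL_connected_mult:
  assumes "GL_connected A A'" "GL_connected B B'"
  shows "GL_connected (A ** B) (A' ** B')"
proof -
  obtain T S where T: "T \<subseteq> GL" "connected T" "A \<in> T" "A' \<in> T" and S: "S \<subseteq> GL" "connected S" "B \<in> S" "B' \<in> S"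
    using assms unfolding GL_connected_def by blast
  have "connected ((\<lambda>(X, Y). X ** Y) ` (T \<times> S))"
    by (rule connected_continuous_image[OF _ connected_Times[OF T(2) S(2)]])
      (auto simp: case_prod_unfold intro!: matrix_mult.continuous_on continuous_intros)
  moreover have "(\<lambda>(X, Y). X ** Y) ` (T \<times> S) \<subseteq> GL"
    using T(1) S(1) GL_mult by auto
  moreover have "A ** B \<in> (\<lambda>(X, Y). X ** Y) ` (T \<times> S)" "A' ** B' \<in> (\<lambda>(X, Y). X ** Y) ` (T \<times> S)"
    using T(3,4) S(3,4) by (auto intro: image_eqI[of _ _ "(A, B)"] image_eqI[of _ _ "(A', B')"])
  ultimately show ?thesis
    unfolding GL_connected_def by blast
qed

lemma GL_connected_segment:
  assumes "\<And>t. 0 \<le> t \<Longrightarrow> t \<le> 1 \<Longrightarrow> A + t *\<^sub>R B \<in> GL"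
  shows "GL_connected A (A + B)"
proof -
  let ?T = "(\<lambda>t::real. A + t *\<^sub>R B) ` {0..1}"
  have "connected ?T"
    by (intro connected_continuous_image continuous_intros) auto
  moreover have "A \<in> ?T" "A + B \<in> ?T"
    by (auto intro: image_eqI[of _ _ 0] image_eqI[of _ _ 1])
  ultimately show ?thesis
    unfolding GL_connected_def using assms by (intro exI[of _ ?T]) auto
qed

lemma GL_connected_transvection:
  assumes "i \<noteq> j"
  shows "GL_connected (mat 1) (mat 1 + c *\<^sub>R axis i (axis j 1) :: real^'n^'n)"
  by (rule GL_connected_segment) (use assms in \<open>simp add: GL_iff det_add_elementary\<close>)

definition diag :: "('n::finite \<Rightarrow> real) \<Rightarrow> real^'n^'n" where
  "diag d = (\<chi> i j. if i = j then d i else 0)"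

lemma diag_mult_left: "diag d ** A = (\<chi> i. d i *\<^sub>R A $ i)"
proof -
  have "diag d $ i $ k * A $ k $ j = (if i = k then d i * A $ i $ j else 0)" for i j k
    by (simp add: diag_def)
  then show ?thesis
    by (simp add: matrix_matrix_mult_def vec_eq_iff)
qed

lemma diag_mult: "diag d ** diag e = diag (\<lambda>i. d i * e i)"
  unfolding diag_mult_left by (simp add: diag_def vec_eq_iff)

lemma det_diag: "det (diag d) = (\<Prod>i\<in>UNIV. d i)"
  by (subst det_diagonal) (auto simp: diag_def)

lemma diag_1: "diag (\<lambda>i. 1) = mat 1"
  by (simp add: diag_def mat_def)

lemma transvection_mult:
  fixes A :: "real^'n^'n"
  shows "(mat 1 + c *\<^sub>R axis i (axis j 1)) ** A = (\<chi> k. if k = i then A $ i + c *\<^sub>R A $ j else A $ k)"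
proof -
  have "axis i (axis j 1) $ k $ m * A $ m $ l = (if m = j then if k = i then A $ m $ l else 0 else 0)" for k l m
    by (simp add: axis_def)
  then have "axis i (axis j 1) ** A = (\<chi> k. if k = i then A $ j else 0)"
    by (simp add: vec_eq_iff matrix_matrix_mult_def)
  then show ?thesis
    by (simp add: matrix_mult.add_left matrix_mult.scaleR_left vec_eq_iff)
qed

text \<open>A swap of two rows has determinant \<open>-1\<close> and cannot be joined to
  \<open>mat 1\<close> within \<open>GL\<close>. With one sign changed it becomes a rotation, which
  is a product of three transvections.\<close>

definition quarter_turn :: "'n::finite \<Rightarrow> 'n \<Rightarrow> real^'n^'n" where
  "quarter_turn i j = (\<chi> k. if k = i then axis j 1 else if k = j then - axis i 1 else axis k 1)"

lemma quarter_turn_transvections: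
  assumes "i \<noteq> j"
  shows "quarter_turn i j = (mat 1 + 1 *\<^sub>R axis i (axis j 1)) **
    ((mat 1 + (- 1) *\<^sub>R axis j (axis i 1)) ** (mat 1 + 1 *\<^sub>R axis i (axis j 1)))"
  using assms unfolding transvection_mult by (auto simp: quarter_turn_def vec_eq_iff mat_def axis_def)

lemma quarter_turn_mult:
  fixes A :: "real^'n^'n"
  assumes "i \<noteq> j"
  shows "quarter_turn i j ** A = (\<chi> k. if k = i then A $ j else if k = j then - (A $ i) else A $ k)"
  unfolding quarter_turn_transvections[OF assms] matrix_mul_assoc[symmetric]
  unfolding transvection_mult
  using assms by (auto simp: vec_eq_iff)

lemma GL_connected_quarter_turn:
  assumes "i \<noteq> j"
  shows "GL_connected (mat 1) (quarter_turn i j)"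
proof -
  let ?T = "\<lambda>i j c. mat 1 + c *\<^sub>R axis i (axis j 1) :: real^'a^'a"
  have "GL_connected (mat 1 ** (mat 1 ** mat 1)) (?T i j 1 ** (?T j i (- 1) ** ?T i j 1))"
    by (intro GL_connected_mult GL_connected_transvection assms assms[symmetric])
  then show ?thesis
    by (simp only: quarter_turn_transvections[OF assms] matrix_mul_lid)
qed

definition reflection :: "'n::finite \<Rightarrow> real^'n^'n" where
  "reflection i = diag (\<lambda>k. if k = i then - 1 else 1)"

lemma quarter_turn_square:
  assumes "i \<noteq> j"
  shows "quarter_turn i j ** quarter_turn i j = reflection i ** reflection j"
  unfolding reflection_def diag_mult quarter_turn_mult[OF assms] using assms
  by (auto simp: quarter_turn_def diag_def vec_eq_iff axis_def)

lemma reflection_square: "reflection i ** reflection i = mat 1"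
  unfolding reflection_def diag_mult diag_1[symmetric] by (rule arg_cong[of _ _ diag]) auto

lemma reflection_GL: "reflection i \<in> GL"
  by (simp add: GL_iff reflection_def det_diag)

text \<open>The half turn \<open>quarter_turn i j ** quarter_turn i j\<close> changes the signs of
  both coordinates, so it trades one reflection for the other while being joined to
  \<open>mat 1\<close>.\<close>

lemma GL_connected_reflections: "GL_connected (reflection i) (reflection j)"
proof (cases "i = j")
  case True
  then show ?thesis using GL_connected_refl[OF reflection_GL] by simp
next
  case False
  have "GL_connected (reflection i ** (mat 1 ** mat 1)) (reflection i ** (quarter_turn i j ** quarter_turn i j))"
    by (intro GL_connected_mult GL_connected_refl reflection_GL GL_connected_quarter_turn False)
  also have "reflection i ** (quarter_turn i j ** quarter_turn i j) = reflection j"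
    by (simp only: quarter_turn_square[OF False] matrix_mul_assoc reflection_square matrix_mul_lid)
  finally show ?thesis by simp
qed

lemma GL_connected_sym: "GL_connected A B \<Longrightarrow> GL_connected B A"
  unfolding GL_connected_def by blast

text \<open>\<open>mat 1\<close> and \<open>reflection k\<close> form a group of order two, so the
  claim passes from factors to products. It remains to treat the elementary matrices; a matrix with
  a zero row is not in \<open>GL\<close>.\<close>

lemma GL_connected_normal_form:
  fixes A :: "real^'n^'n" and k :: 'n
  assumes "A \<in> GL"
  shows "GL_connected A (mat 1) \<or> GL_connected A (reflection k)"
  using assms
proof (induction A rule: induct_matrix_elementary_alt)
  case (1 A B)
  then have "A \<in> GL" "B \<in> GL"
    by (auto simp: GL_iff det_mul)
  then have *: "GL_connected A (mat 1) \<or> GL_connected A (reflection k)"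
    "GL_connected B (mat 1) \<or> GL_connected B (reflection k)"
    using 1 by auto
  show ?case
    using * GL_connected_mult[of A _ B] by (metis matrix_mul_lid matrix_mul_rid reflection_square)
next
  case (2 A i)
  from 2(1) have "det A = 0"
    by (simp add: det_zero_row)
  then show ?case using 2 by (simp add: GL_iff)
next
  case (3 A)
  \<comment> \<open>Induction on a set containing the positions of the diagonal entries different
    from \<open>1\<close>; in each step one entry is split off as a diagonal factor.\<close>
  have diag: "GL_connected (diag d) (mat 1) \<or> GL_connected (diag d) (reflection k)"
    if "finite S" "\<And>i. i \<notin> S \<Longrightarrow> d i = 1" "\<And>i. d i \<noteq> 0" for S d
    using that
  proof (induction S arbitrary: d rule: finite_induct)
    case empty
    then have "d = (\<lambda>i. 1)" by auto
    then show ?case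
      using GL_connected_refl[of "mat 1 :: real^'n^'n"] by (simp add: diag_1 GL_iff)
  next
    case (insert i S)
    let ?e = "\<lambda>l. if l = i then d i else 1"
    have split: "diag d = diag (d(i := 1)) ** diag ?e"
      unfolding diag_mult by (rule arg_cong[of _ _ diag]) auto
    have *: "GL_connected (diag (d(i := 1))) (mat 1) \<or> GL_connected (diag (d(i := 1))) (reflection k)"
      using insert.prems insert.hyps by (intro insert.IH) auto
    \<comment> \<open>Used with \<open>s = 1\<close> or \<open>s = - 1\<close>: an entry can be
      moved linearly to the unit of its own sign without passing through \<open>0\<close>.\<close>
    have seg: "GL_connected (diag (\<lambda>l. if l = i then s else 1)) (diag (\<lambda>l. if l = i then d i else 1))"
      if "s * d i > 0" for s
    proof -
      have eq: "diag (\<lambda>l. if l = i then s else 1) + t *\<^sub>R (diag (\<lambda>l. if l = i then d i - s else 0))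
          = diag (\<lambda>l. if l = i then (1 - t) * s + t * d i else 1)" for t
        by (auto simp: diag_def vec_eq_iff algebra_simps)
      have "(1 - t) * s + t * d i \<noteq> 0" if "0 \<le> t" "t \<le> 1" for t
      proof
        assume "(1 - t) * s + t * d i = 0"
        \<comment> \<open>Multiplying by \<open>s + d i\<close>, which has the common sign of
          \<open>s\<close> and \<open>d i\<close>, leaves four nonnegative terms that cannot all
          vanish.\<close>
        then have "((1 - t) * s + t * d i) * s + ((1 - t) * s + t * d i) * d i = 0" by simp
        moreover have "(1 - t) * (s * s) + t * (d i * s) + (1 - t) * (s * d i) + t * (d i * d i) > 0"
        proof (cases "t = 0")
          case True
          then show ?thesis using \<open>s * d i > 0\<close> by (simp add: add_nonneg_pos)
        next
          case False
          then have "t * (d i * s) > 0"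
            using \<open>s * d i > 0\<close> that by (simp add: mult.commute)
          moreover have "(1 - t) * (s * s) \<ge> 0" "(1 - t) * (s * d i) \<ge> 0" "t * (d i * d i) \<ge> 0"
            using \<open>s * d i > 0\<close> that by auto
          ultimately show ?thesis by linarith
        qed
        ultimately show False by (simp add: algebra_simps)
      qed
      then have "GL_connected (diag (\<lambda>l. if l = i then s else 1))
        (diag (\<lambda>l. if l = i then s else 1) + diag (\<lambda>l. if l = i then d i - s else 0))"
        by (intro GL_connected_segment) (simp add: eq GL_iff det_diag)
      then show ?thesis using eq[of 1] by (simp cong: if_cong)
    qed
    have "GL_connected (diag ?e) (mat 1) \<or> GL_connected (diag ?e) (reflection k)"
    proof (cases "d i > 0")
      case True
      then show ?thesis using GL_connected_sym[OF seg[of 1]] by (simp add: diag_1)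
    next
      case False
      then have "(- 1) * d i > 0" using insert.prems(2)[of i] by simp
      then have "GL_connected (diag ?e) (reflection i)"
        using GL_connected_sym[OF seg[of "- 1"]] by (simp add: reflection_def)
      then show ?thesis using GL_connected_trans GL_connected_reflections by blast
    qed
    then show ?case
      unfolding split using * GL_connected_mult[of "diag (d(i := 1))" _ "diag ?e"]
      by (metis matrix_mul_lid matrix_mul_rid reflection_square)
  qed
  have A: "A = diag (\<lambda>i. A $ i $ i)"
    using 3 by (auto simp: diag_def vec_eq_iff)
  have "det A \<noteq> 0"
    using 3 by (simp add: GL_iff)
  then have "det (diag (\<lambda>i. A $ i $ i)) \<noteq> 0"
    using A by simp
  then have "A $ i $ i \<noteq> 0" for i
    by (simp add: det_diag)
  then show ?case
    using diag[of UNIV "\<lambda>i. A $ i $ i"] A by simp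
next
  case (4 m n)
  \<comment> \<open>The swap is a rotation times a reflection, as its determinant is
    \<open>-1\<close>.\<close>
  have "(\<chi> i j. mat 1 $ i $ Transposition.transpose m n j) = quarter_turn m n ** reflection m"
    unfolding quarter_turn_mult[OF 4(1)] using 4(1)
    by (auto simp: reflection_def diag_def mat_def vec_eq_iff Transposition.transpose_def)
  moreover have "GL_connected (quarter_turn m n ** reflection m) (mat 1 ** reflection k)"
    using 4(1) by (intro GL_connected_mult GL_connected_sym[OF GL_connected_quarter_turn] GL_connected_reflections)
  ultimately show ?case by simp
next
  case (5 m n)
  have "(\<chi> i j. of_bool (i = m \<and> j = n \<or> i = j)) = (mat 1 + 1 *\<^sub>R axis m (axis n 1) :: real^'n^'n)"
    using 5(1) by (auto simp: vec_eq_iff mat_def axis_def)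
  then show ?case
    using GL_connected_sym[OF GL_connected_transvection[OF 5(1), of 1]] by simp
qed

text \<open>The sign of \<open>det\<close> is constant on connected subsets of \<open>GL\<close>.
  This rules out the reflection in the normal form, and it keeps the set joining a matrix to
  \<open>mat 1\<close> inside \<open>GLplus\<close>.\<close>

lemma connected_GLplus: "connected (GLplus :: (real^'n^'n) set)"
proof -
  obtain k :: 'n where True by blast
  have sign: "0 < det A" if "GL_connected A B" "0 < det B" for A B :: "real^'n^'n"
  proof (rule ccontr)
    assume "\<not> 0 < det A"
    obtain T where T: "T \<subseteq> GL" "connected T" "A \<in> T" "B \<in> T"
      using \<open>GL_connected A B\<close> unfolding GL_connected_def by blast
    have "connected (det ` T)"
      by (rule connected_continuous_image[OF continuous_on_det T(2)])
    then have "0 \<in> det ` T"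
      using connectedD_interval[of "det ` T" "det A" "det B" 0] T \<open>0 < det B\<close> \<open>\<not> 0 < det A\<close> by auto
    then show False using T(1) by (auto simp: GL_iff)
  qed
  have joined: "GL_connected (mat 1) A" if "A \<in> GLplus" for A :: "real^'n^'n"
  proof -
    have "\<not> GL_connected A (reflection k)"
    proof
      assume "GL_connected A (reflection k)"
      then have "0 < det (reflection k)"
        using sign GL_connected_sym that by (auto simp: GLplus_def)
      then show False
        by (simp add: reflection_def det_diag)
    qed
    then show ?thesis
      using GL_connected_normal_form[of A k] GL_connected_sym that GLplus_subset_GL by blast
  qed
  have "\<exists>T. connected T \<and> T \<subseteq> GLplus \<and> mat 1 \<in> T \<and> A \<in> T" if A: "A \<in> GLplus" for A :: "real^'n^'n"
  proof -
    obtain T where T: "T \<subseteq> GL" "connected T" "mat 1 \<in> T" "A \<in> T"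
      using joined[OF A] unfolding GL_connected_def by blast
    have "X \<in> GLplus" if "X \<in> T" for X
      using sign[of X "mat 1"] T that unfolding GL_connected_def GLplus_def by auto
    then show ?thesis using T by blast
  qed
  then have "GLplus = \<Union>{T. connected T \<and> T \<subseteq> GLplus \<and> (mat 1 :: real^'n^'n) \<in> T}"
    by blast
  moreover have "connected (\<Union>{T. connected T \<and> T \<subseteq> GLplus \<and> (mat 1 :: real^'n^'n) \<in> T})"
    by (rule connected_Union) auto
  ultimately show ?thesis by metis
qed

lemma connected_SL: "connected (SL :: (real^'n^'n) set)"
proof -
  have "SL \<subseteq> normalize_det ` (GLplus :: (real^'n^'n) set)"
    using normalize_det_id SL_subset_GLplus by (metis image_eqI subsetD subsetI)
  then have "SL = normalize_det ` (GLplus :: (real^'n^'n) set)"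
    using normalize_det_in_SL by blast
  then show ?thesis
    using connected_continuous_image[OF smooth_on_imp_continuous_on[OF smooth_on_normalize_det] connected_GLplus]
    by metis
qed

section \<open>Second derivatives\<close>

lemma DERIV_along_line:
  fixes F :: "'a::real_normed_vector \<Rightarrow> real"
  assumes "(F has_derivative F') (at (c + t *\<^sub>R u))"
  shows "((\<lambda>t. F (c + t *\<^sub>R u)) has_real_derivative F' u) (at t)"
proof -
  have "((\<lambda>t. c + t *\<^sub>R u) has_derivative (\<lambda>h. h *\<^sub>R u)) (at t)"
    by (auto intro!: derivative_eq_intros)
  then have "((\<lambda>t. F (c + t *\<^sub>R u)) has_derivative (\<lambda>h. F' (h *\<^sub>R u))) (at t)"
    using assms has_derivative_compose by blast
  moreover have "F' (h *\<^sub>R u) = F' u * h" for h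
    using linear_scale[OF has_derivative_linear[OF assms]] by simp
  ultimately show ?thesis
    by (simp add: has_field_derivative_def)
qed

text \<open>The mean value theorem is applied twice: along \<open>u\<close> to the difference of
  \<open>f\<close> in direction \<open>v\<close>, then along \<open>v\<close> to the derivative in
  direction \<open>u\<close>.\<close>

lemma second_difference_mean_value:
  fixes f :: "'a::real_normed_vector \<Rightarrow> real"
  assumes "h > 0" "h * (norm u + norm v) < r"
    and D: "\<And>y. y \<in> ball x r \<Longrightarrow> (f has_derivative D y) (at y)"
    and DD: "\<And>y. y \<in> ball x r \<Longrightarrow> ((\<lambda>y. D y u) has_derivative DD y) (at y)"
  shows "\<exists>p\<in>ball x r. f (x + h *\<^sub>R u + h *\<^sub>R v) - f (x + h *\<^sub>R u) - f (x + h *\<^sub>R v) + f x = h * h * DD p v"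
proof -
  have in_ball: "x + b *\<^sub>R v + a *\<^sub>R u \<in> ball x r" if "0 \<le> a" "a \<le> h" "0 \<le> b" "b \<le> h" for a b
  proof -
    have "norm (b *\<^sub>R v + a *\<^sub>R u) \<le> b * norm v + a * norm u"
      using norm_triangle_ineq[of "b *\<^sub>R v" "a *\<^sub>R u"] that by simp
    also have "\<dots> \<le> h * norm v + h * norm u"
      using that by (intro add_mono mult_right_mono) auto
    also have "\<dots> < r"
      using assms(2) by (simp add: distrib_left add.commute)
    finally have "norm (b *\<^sub>R v + a *\<^sub>R u) < r" .
    moreover have "dist x (x + w) = norm w" for w
      by (simp add: dist_norm)
    ultimately show ?thesis by (simp only: mem_ball add.assoc)
  qed
  define \<phi> where "\<phi> a = f (x + h *\<^sub>R v + a *\<^sub>R u) - f (x + a *\<^sub>R u)" for a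
  have "(\<phi> has_real_derivative D (x + h *\<^sub>R v + a *\<^sub>R u) u - D (x + a *\<^sub>R u) u) (at a)"
    if "0 \<le> a" "a \<le> h" for a
    unfolding \<phi>_def
    using in_ball[of a h] in_ball[of a 0] that assms(1)
    by (intro derivative_intros DERIV_along_line D) auto
  from MVT2[OF assms(1) this] obtain a where a: "0 < a" "a < h"
    "\<phi> h - \<phi> 0 = h * (D (x + h *\<^sub>R v + a *\<^sub>R u) u - D (x + a *\<^sub>R u) u)"
    by auto
  have "((\<lambda>b. D (x + a *\<^sub>R u + b *\<^sub>R v) u) has_real_derivative DD (x + a *\<^sub>R u + b *\<^sub>R v) v) (at b)"
    if "0 \<le> b" "b \<le> h" for b
    using in_ball[of a b] that a by (intro DERIV_along_line DD) (simp add: add_ac)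
  from MVT2[OF assms(1) this] obtain b where b: "0 < b" "b < h"
    "D (x + a *\<^sub>R u + h *\<^sub>R v) u - D (x + a *\<^sub>R u) u = h * DD (x + a *\<^sub>R u + b *\<^sub>R v) v"
    by auto
  have "f (x + h *\<^sub>R u + h *\<^sub>R v) - f (x + h *\<^sub>R u) - f (x + h *\<^sub>R v) + f x = \<phi> h - \<phi> 0"
    by (simp add: \<phi>_def add_ac)
  also have "\<dots> = h * h * DD (x + a *\<^sub>R u + b *\<^sub>R v) v"
    using a(3) b(3) by (simp add: add_ac)
  finally show ?thesis
    using in_ball[of a b] a b by (intro bexI[of _ "x + a *\<^sub>R u + b *\<^sub>R v"]) (auto simp: add_ac)
qed

text \<open>The second difference is symmetric in \<open>u\<close> and \<open>v\<close>, so the two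
  mixed derivatives agree at two possibly different points near \<open>x\<close>; continuity moves
  both points to \<open>x\<close>.\<close>

lemma symmetric_second_derivative_real:
  fixes f :: "'a::real_normed_vector \<Rightarrow> real"
  assumes "open U" "x \<in> U"
    and D: "\<And>y. y \<in> U \<Longrightarrow> (f has_derivative D y) (at y)"
    and DD: "\<And>w y. y \<in> U \<Longrightarrow> ((\<lambda>y. D y w) has_derivative DD w y) (at y)"
    and cont: "\<And>w z. continuous_on U (\<lambda>y. DD w y z)"
  shows "DD u x v = DD v x u"
proof (rule ccontr)
  assume neq: "DD u x v \<noteq> DD v x u"
  define e where "e = \<bar>DD u x v - DD v x u\<bar> / 2"
  have "e > 0" using neq by (simp add: e_def)
  have near: "\<exists>d>0. \<forall>y\<in>ball x d. y \<in> U \<and> \<bar>DD w y z - DD w x z\<bar> < e" for w z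
  proof -
    have "isCont (\<lambda>y. DD w y z) x"
      using cont assms(1,2) by (simp add: continuous_on_eq_continuous_at)
    then obtain d where "d > 0" "\<forall>y. dist y x < d \<longrightarrow> dist (DD w y z) (DD w x z) < e"
      using \<open>e > 0\<close> unfolding continuous_at_eps_delta dist_norm by blast
    moreover obtain d' where "d' > 0" "ball x d' \<subseteq> U"
      using assms(1,2) open_contains_ball by blast
    ultimately show ?thesis
      by (intro exI[of _ "min d d'"]) (auto simp: dist_real_def dist_commute subset_iff)
  qed
  obtain d d' where d: "d > 0" "\<forall>y\<in>ball x d. y \<in> U \<and> \<bar>DD u y v - DD u x v\<bar> < e"
    and d': "d' > 0" "\<forall>y\<in>ball x d'. y \<in> U \<and> \<bar>DD v y u - DD v x u\<bar> < e"
    using near[of u v] near[of v u] by blast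
  define r where "r = min d d'"
  define n where "n = norm u + norm v"
  have "n \<ge> 0" by (simp add: n_def)
  \<comment> \<open>Small enough that the parallelogram spanned by \<open>h *\<^sub>R u\<close> and
    \<open>h *\<^sub>R v\<close> stays in the ball of radius \<open>r\<close>; the summand
    \<open>1\<close> covers the case that \<open>u\<close> and \<open>v\<close> both vanish.\<close>
  define h where "h = r / (2 * (n + 1))"
  have "r > 0" using d d' by (simp add: r_def)
  then have "h > 0"
    using \<open>n \<ge> 0\<close> by (simp add: h_def)
  have "h * n < h * (2 * (n + 1))"
    using \<open>h > 0\<close> \<open>n \<ge> 0\<close> by (intro mult_strict_left_mono) auto
  also have "\<dots> = r"
    unfolding h_def using \<open>n \<ge> 0\<close> by (simp add: field_simps)
  finally have hr: "h * (norm u + norm v) < r" "h * (norm v + norm u) < r"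
    by (simp_all only: n_def add.commute)
  have r: "ball x r \<subseteq> ball x d" "ball x r \<subseteq> ball x d'" "ball x r \<subseteq> U"
    using d d' by (auto simp: r_def subset_iff)
  obtain p where p: "p \<in> ball x r"
    "f (x + h *\<^sub>R u + h *\<^sub>R v) - f (x + h *\<^sub>R u) - f (x + h *\<^sub>R v) + f x = h * h * DD u p v"
    using second_difference_mean_value[OF \<open>h > 0\<close> hr(1), of x f D "DD u"] D DD r(3) by blast
  obtain q where q: "q \<in> ball x r"
    "f (x + h *\<^sub>R v + h *\<^sub>R u) - f (x + h *\<^sub>R v) - f (x + h *\<^sub>R u) + f x = h * h * DD v q u"
    using second_difference_mean_value[OF \<open>h > 0\<close> hr(2), of x f D "DD v"] D DD r(3) by blast
  have "h * h * DD u p v = h * h * DD v q u"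
    unfolding p(2)[symmetric] q(2)[symmetric] by (simp add: add_ac)
  then have "DD u p v = DD v q u"
    using \<open>h > 0\<close> by simp
  moreover have "\<bar>DD u p v - DD u x v\<bar> < e" "\<bar>DD v q u - DD v x u\<bar> < e"
    using p(1) q(1) r d(2) d'(2) by auto
  moreover have "\<bar>a - b\<bar> \<le> \<bar>p - a\<bar> + \<bar>p - b\<bar>" for a b p :: real
    by linarith
  from this[of "DD u x v" "DD v x u" "DD u p v"] have "2 * e \<le> \<bar>DD u p v - DD u x v\<bar> + \<bar>DD u p v - DD v x u\<bar>"
    by (simp add: e_def)
  ultimately show False by simp
qed

definition second_derivative ::
  "('a::euclidean_space \<Rightarrow> 'b::euclidean_space) \<Rightarrow> 'a \<Rightarrow> 'a \<Rightarrow> 'a \<Rightarrow> 'b" where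
  "second_derivative f x u v = frechet_derivative (\<lambda>y. frechet_derivative f (at y) u) (at x) v"

lemma has_derivative_frechet_derivative:
  "smooth_on U f \<Longrightarrow> x \<in> U
    \<Longrightarrow> ((\<lambda>y. frechet_derivative f (at y) u) has_derivative second_derivative f x u) (at x)"
  unfolding second_derivative_def
  by (rule smooth_on_imp_has_derivative[OF smooth_on_frechet_derivative])

lemma second_derivative_commute:
  fixes f :: "'a::euclidean_space \<Rightarrow> 'b::euclidean_space"
  assumes "open U" "smooth_on U f" "x \<in> U"
  shows "second_derivative f x u v = second_derivative f x v u"
proof (rule euclidean_eqI)
  fix b :: 'b
  have cont: "continuous_on U (\<lambda>y. second_derivative f y w z)" for w z
    unfolding second_derivative_def
    by (intro smooth_on_imp_continuous_on smooth_on_frechet_derivative assms(2))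
  show "second_derivative f x u v \<bullet> b = second_derivative f x v u \<bullet> b"
    by (rule symmetric_second_derivative_real[OF assms(1,3), of "\<lambda>y. f y \<bullet> b"
          "\<lambda>y w. frechet_derivative f (at y) w \<bullet> b" "\<lambda>w y z. second_derivative f y w z \<bullet> b"])
      (intro has_derivative_inner_left smooth_on_imp_has_derivative[OF assms(2)]
        has_derivative_frechet_derivative[OF assms(2)] continuous_intros cont; assumption)+
qed

lemma frechet_derivative_expand:
  fixes f :: "'a::euclidean_space \<Rightarrow> 'b::euclidean_space"
  assumes "smooth_on U f" "x \<in> U"
  shows "frechet_derivative f (at x) w = (\<Sum>b\<in>Basis. (w \<bullet> b) *\<^sub>R frechet_derivative f (at x) b)"
proof -
  have lin: "linear (frechet_derivative f (at x))"
    by (rule has_derivative_linear[OF smooth_on_imp_has_derivative[OF assms]])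
  have "frechet_derivative f (at x) w = frechet_derivative f (at x) (\<Sum>b\<in>Basis. (w \<bullet> b) *\<^sub>R b)"
    by (simp add: euclidean_representation)
  then show ?thesis
    using lin by (simp add: linear_sum linear_scale)
qed

lemma smooth_on_frechet_derivative_apply:
  assumes "open U" "smooth_on U f" "smooth_on U w"
  shows "smooth_on U (\<lambda>y. frechet_derivative f (at y) (w y))"
proof -
  have "smooth_on U (\<lambda>y. \<Sum>b\<in>Basis. (w y \<bullet> b) *\<^sub>R frechet_derivative f (at y) b)"
    by (intro smooth_on_sum smooth_on_scaleR smooth_on_bilinear[OF bounded_bilinear_inner]
        smooth_on_frechet_derivative smooth_on_const assms)
  then show ?thesis
    by (rule smooth_on_cong[OF assms(1), rotated]) (rule frechet_derivative_expand[OF assms(2), symmetric])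
qed

text \<open>A product rule for directions that move with the point, as \<open>x ** \<xi>\<close>
  does in a left invariant frame. Expansion in \<open>Basis\<close> reduces it to derivatives in
  fixed directions.\<close>

lemma has_derivative_frechet_derivative_apply:
  fixes f :: "'a::euclidean_space \<Rightarrow> 'b::euclidean_space"
  assumes U: "open U" "x \<in> U" and f: "smooth_on U f" and w: "(w has_derivative w') (at x)"
  shows "((\<lambda>y. frechet_derivative f (at y) (w y)) has_derivative
    (\<lambda>V. second_derivative f x (w x) V + frechet_derivative f (at x) (w' V))) (at x)"
proof -
  have "((\<lambda>y. \<Sum>b\<in>Basis. (w y \<bullet> b) *\<^sub>R frechet_derivative f (at y) b) has_derivative
    (\<lambda>V. \<Sum>b\<in>Basis. (w x \<bullet> b) *\<^sub>R second_derivative f x b V + (w' V \<bullet> b) *\<^sub>R frechet_derivative f (at x) b)) (at x)"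
    by (intro has_derivative_sum has_derivative_scaleR has_derivative_inner_left w
        has_derivative_frechet_derivative[OF f U(2)])
  then have expanded: "((\<lambda>y. frechet_derivative f (at y) (w y)) has_derivative
    (\<lambda>V. \<Sum>b\<in>Basis. (w x \<bullet> b) *\<^sub>R second_derivative f x b V + (w' V \<bullet> b) *\<^sub>R frechet_derivative f (at x) b)) (at x)"
    by (rule has_derivative_transform_within_open[OF _ U]) (rule frechet_derivative_expand[OF f, symmetric])
  \<comment> \<open>Linearity of the second derivative in its first direction, obtained by
    differentiating the basis expansion and comparing derivatives.\<close>
  have sd: "second_derivative f x w0 = (\<lambda>V. \<Sum>b\<in>Basis. (w0 \<bullet> b) *\<^sub>R second_derivative f x b V)" for w0
  proof -
    have "((\<lambda>y. \<Sum>b\<in>Basis. (w0 \<bullet> b) *\<^sub>R frechet_derivative f (at y) b) has_derivative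
      (\<lambda>V. \<Sum>b\<in>Basis. (w0 \<bullet> b) *\<^sub>R second_derivative f x b V)) (at x)"
      by (intro has_derivative_sum has_derivative_scaleR_right has_derivative_frechet_derivative[OF f U(2)])
    then have "((\<lambda>y. frechet_derivative f (at y) w0) has_derivative
      (\<lambda>V. \<Sum>b\<in>Basis. (w0 \<bullet> b) *\<^sub>R second_derivative f x b V)) (at x)"
      by (rule has_derivative_transform_within_open[OF _ U]) (rule frechet_derivative_expand[OF f, symmetric])
    then show ?thesis
      using has_derivative_frechet_derivative[OF f U(2)] has_derivative_unique by blast
  qed
  have eq: "second_derivative f x (w x) V + frechet_derivative f (at x) (w' V) =
    (\<Sum>b\<in>Basis. (w x \<bullet> b) *\<^sub>R second_derivative f x b V + (w' V \<bullet> b) *\<^sub>R frechet_derivative f (at x) b)" for V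
    unfolding sum.distrib by (intro arg_cong2[where f = "(+)"] fun_cong[OF sd] frechet_derivative_expand[OF f U(2)])
  show ?thesis
    unfolding eq by (rule expanded)
qed

section \<open>Rigidity of isometries\<close>

definition commutator :: "real^'n^'n \<Rightarrow> real^'n^'n \<Rightarrow> real^'n^'n" where
  "commutator A B = A ** B - B ** A"

text \<open>The ad-invariance of the trace form. It is the reason why the alternation in
  \<open>skew_connection_unique\<close> is cyclic.\<close>

lemma trace_commutator_cyclic:
  "trace (commutator A B ** C) = trace (commutator B C ** (A :: real^'n^'n))"
proof -
  have "trace (A ** (B ** C)) = trace (B ** C ** A)" "trace (B ** A ** C) = trace (C ** (B ** A))"
    by (rule trace_mul_sym)+
  then show ?thesis
    by (simp add: commutator_def matrix_mult.diff_left trace_sub matrix_mul_assoc)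
qed

lemma trace_pairing_nondegenerate:
  fixes X :: "real^'n^'n"
  assumes "\<And>Y. trace (X ** Y) = 0"
  shows "X = 0"
  using assms[of "transpose X"] by (simp add: trace_mult_transpose)

text \<open>The argument behind the uniqueness of the Levi-Civita connection: the three-linear form
  \<open>trace (d \<eta> \<xi> ** A \<zeta>)\<close> is skew in the last two arguments, and its alternation in the first two is
  totally skew, hence is twice the form itself.\<close>

lemma skew_connection_unique:
  fixes A :: "real^'n^'n \<Rightarrow> real^'n^'n" and d :: "real^'n^'n \<Rightarrow> real^'n^'n \<Rightarrow> real^'n^'n"
  assumes A: "linear A" "\<And>\<xi> \<zeta>. trace (A \<xi> ** A \<zeta>) = trace (\<xi> ** \<zeta>)"
    and torsion: "\<And>\<eta> \<xi>. d \<eta> \<xi> - d \<xi> \<eta> = A (commutator \<eta> \<xi>) - commutator (A \<eta>) (A \<xi>)"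
    and skew: "\<And>\<eta> \<xi> \<zeta>. trace (d \<eta> \<xi> ** A \<zeta>) + trace (A \<xi> ** d \<eta> \<zeta>) = 0"
  shows "2 *\<^sub>R d \<eta> \<xi> = A (commutator \<eta> \<xi>) - commutator (A \<eta>) (A \<xi>)"
proof -
  define T where "T \<eta> \<xi> \<zeta> = trace (d \<eta> \<xi> ** A \<zeta>)" for \<eta> \<xi> \<zeta>
  define S where "S \<eta> \<xi> \<zeta> = trace ((A (commutator \<eta> \<xi>) - commutator (A \<eta>) (A \<xi>)) ** A \<zeta>)" for \<eta> \<xi> \<zeta>
  have S_eq: "S \<eta> \<xi> \<zeta> = trace (commutator \<eta> \<xi> ** \<zeta>) - trace (commutator (A \<eta>) (A \<xi>) ** A \<zeta>)" for \<eta> \<xi> \<zeta>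
    by (simp add: S_def matrix_mult.diff_left trace_sub A(2))
  have S_cyclic: "S \<eta> \<xi> \<zeta> = S \<xi> \<zeta> \<eta>" for \<eta> \<xi> \<zeta>
    unfolding S_eq using trace_commutator_cyclic by metis
  have T_S: "T \<eta> \<xi> \<zeta> - T \<xi> \<eta> \<zeta> = S \<eta> \<xi> \<zeta>" for \<eta> \<xi> \<zeta>
    unfolding T_def S_def torsion[symmetric] by (simp add: matrix_mult.diff_left trace_sub)
  have T_skew: "T \<eta> \<xi> \<zeta> = - T \<eta> \<zeta> \<xi>" for \<eta> \<xi> \<zeta>
    using skew[of \<eta> \<xi> \<zeta>] trace_mul_sym[of "A \<xi>" "d \<eta> \<zeta>"] by (simp add: T_def)
  \<comment> \<open>If \<open>a\<close>, \<open>b\<close>, \<open>c\<close> denote \<open>T\<close>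
    at the three cyclic permutations of the arguments, skewness turns the relations into
    \<open>a + b = b + c = c + a = S \<eta> \<xi> \<zeta>\<close>, hence \<open>2 * a\<close> is
    this common value.\<close>
  have "2 * T \<eta> \<xi> \<zeta> = S \<eta> \<xi> \<zeta>" for \<zeta>
    using T_S[of \<eta> \<xi> \<zeta>] T_S[of \<xi> \<zeta> \<eta>] T_S[of \<zeta> \<eta> \<xi>] T_skew[of \<xi> \<eta> \<zeta>] T_skew[of \<zeta> \<xi> \<eta>] T_skew[of \<eta> \<zeta> \<xi>]
      S_cyclic[of \<eta> \<xi> \<zeta>] S_cyclic[of \<xi> \<zeta> \<eta>] by linarith
  then have *: "trace ((2 *\<^sub>R d \<eta> \<xi> - (A (commutator \<eta> \<xi>) - commutator (A \<eta>) (A \<xi>))) ** A \<zeta>) = 0" for \<zeta>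
    by (simp only: matrix_mult.diff_left[of "2 *\<^sub>R d \<eta> \<xi>"] trace_sub matrix_mult.scaleR_left trace_scaleR
        T_def S_def diff_self)
  \<comment> \<open>Preserving a nondegenerate form makes \<open>A\<close> injective, hence
    surjective, so that \<open>A \<zeta>\<close> runs through all test matrices.\<close>
  have "inj A"
  proof (rule linear_injective_0[OF A(1), THEN iffD2, rule_format])
    fix \<xi> assume "A \<xi> = 0"
    then have "trace (\<xi> ** \<zeta>) = 0" for \<zeta>
      using A(2)[of \<xi> \<zeta>] by (simp add: matrix_mult.zero_left trace_def)
    then show "\<xi> = 0" by (rule trace_pairing_nondegenerate)
  qed
  then have "surj A"
    by (rule linear_inj_imp_surj[OF A(1)])
  then have "trace ((2 *\<^sub>R d \<eta> \<xi> - (A (commutator \<eta> \<xi>) - commutator (A \<eta>) (A \<xi>))) ** Y) = 0" for Y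
    using * by (metis surjD)
  then show ?thesis
    using trace_pairing_nondegenerate by (metis right_minus_eq)
qed

text \<open>The differential of a map \<open>f\<close>, read in the left invariant frames at \<open>x\<close> and \<open>f x\<close>.\<close>

definition frame_derivative ::
  "(real^'n^'n \<Rightarrow> real^'n^'n) \<Rightarrow> real^'n^'n \<Rightarrow> real^'n^'n \<Rightarrow> real^'n^'n" where
  "frame_derivative f x \<xi> = matrix_inv (f x) ** frechet_derivative f (at x) (x ** \<xi>)"

lemma linear_frame_derivative:
  assumes "smooth_on U f" "x \<in> U"
  shows "linear (frame_derivative f x)"
proof -
  have "linear (frechet_derivative f (at x))"
    by (rule has_derivative_linear[OF smooth_on_imp_has_derivative[OF assms]])
  then show ?thesis
    unfolding frame_derivative_def[abs_def]
    by (auto intro!: linearI simp: linear_add linear_scale matrix_mult.add_right matrix_mult.scaleR_right)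
qed

lemma smooth_on_frame_derivative:
  assumes "open U" "smooth_on U f" "\<And>x. x \<in> U \<Longrightarrow> f x \<in> GL"
  shows "smooth_on U (\<lambda>x. frame_derivative f x \<xi>)"
  unfolding frame_derivative_def
  by (intro smooth_on_matrix_mult smooth_on_matrix_inv smooth_on_frechet_derivative_apply smooth_on_id
      smooth_on_const assms)

text \<open>The Maurer-Cartan equation, pulled back by \<open>f\<close>.\<close>

lemma frame_derivative_torsion:
  fixes f :: "real^'n^'n \<Rightarrow> real^'n^'n"
  assumes U: "open U" "x \<in> U" and f: "smooth_on U f" "\<And>x. x \<in> U \<Longrightarrow> f x \<in> GL"
  defines "d \<equiv> \<lambda>\<eta> \<xi>. frechet_derivative (\<lambda>y. frame_derivative f y \<xi>) (at x) (x ** \<eta>)"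
  shows "d \<eta> \<xi> - d \<xi> \<eta> = frame_derivative f x (commutator \<eta> \<xi>)
    - commutator (frame_derivative f x \<eta>) (frame_derivative f x \<xi>)"
proof -
  let ?J = "matrix_inv (f x)" and ?D = "frechet_derivative f (at x)" and ?A = "frame_derivative f x"
  have d: "d \<eta> \<xi> = - (?A \<eta> ** ?A \<xi>) + ?J ** second_derivative f x (x ** \<xi>) (x ** \<eta>) + ?A (\<eta> ** \<xi>)" for \<eta> \<xi>
  proof -
    have inv: "((\<lambda>y. matrix_inv (f y)) has_derivative (\<lambda>V. - (?J ** ?D V ** ?J))) (at x)"
      by (rule has_derivative_compose[OF smooth_on_imp_has_derivative[OF f(1) U(2)] has_derivative_matrix_inv[OF f(2)[OF U(2)]]])
    have *: "((\<lambda>y. frame_derivative f y \<xi>) has_derivative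
      (\<lambda>V. ?J ** (second_derivative f x (x ** \<xi>) V + ?D (V ** \<xi>)) + - (?J ** ?D V ** ?J) ** ?D (x ** \<xi>))) (at x)"
      unfolding frame_derivative_def
      by (intro matrix_mult.FDERIV inv has_derivative_frechet_derivative_apply[OF U f(1)]
          bounded_linear_imp_has_derivative[OF matrix_mult.bounded_linear_left])
    have "d \<eta> \<xi> = ?J ** (second_derivative f x (x ** \<xi>) (x ** \<eta>) + ?D (x ** \<eta> ** \<xi>))
        + - (?J ** ?D (x ** \<eta>) ** ?J) ** ?D (x ** \<xi>)"
      unfolding d_def frechet_derivative_at[OF *, symmetric] by (rule refl)
    then show ?thesis
      by (simp add: frame_derivative_def matrix_mult.add_right matrix_mult.minus_left matrix_mul_assoc)
  qed
  show ?thesis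
    \<comment> \<open>The symmetric second derivative drops out of the alternation. The derivative
      of the inverse leaves the commutator of the images, and that of the moving frame leaves the
      image of the commutator.\<close>
    unfolding d second_derivative_commute[OF U(1) f(1) U(2), of "x ** \<xi>"]
    unfolding commutator_def linear_diff[OF linear_frame_derivative[OF f(1) U(2)]]
    by simp
qed

text \<open>The isometry condition makes the trace of the product constant, and its derivative is
  the skewness required by \<open>skew_connection_unique\<close>; the torsion identity holds for any
  smooth \<open>f\<close> with values in \<open>GL\<close>.\<close>

lemma frame_derivative_equation:
  fixes f :: "real^'n^'n \<Rightarrow> real^'n^'n"
  assumes U: "open U" "x \<in> U" and f: "smooth_on U f" "\<And>x. x \<in> U \<Longrightarrow> f x \<in> GL"
    and iso: "\<And>x \<xi> \<zeta>. x \<in> U \<Longrightarrow> trace (frame_derivative f x \<xi> ** frame_derivative f x \<zeta>) = trace (\<xi> ** \<zeta>)"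
  shows "2 *\<^sub>R frechet_derivative (\<lambda>y. frame_derivative f y \<xi>) (at x) (x ** \<eta>) =
    frame_derivative f x (commutator \<eta> \<xi>) - commutator (frame_derivative f x \<eta>) (frame_derivative f x \<xi>)"
proof (rule skew_connection_unique[OF linear_frame_derivative[OF f(1) U(2)] iso[OF U(2)]
      frame_derivative_torsion[OF U f]])
  fix \<eta> \<xi> \<zeta>
  let ?d = "\<lambda>\<xi>. frechet_derivative (\<lambda>y. frame_derivative f y \<xi>) (at x)"
  have der: "((\<lambda>y. frame_derivative f y \<xi>) has_derivative ?d \<xi>) (at x)" for \<xi>
    by (rule smooth_on_imp_has_derivative[OF smooth_on_frame_derivative[OF U(1) f] U(2)])
  have "((\<lambda>y. trace (frame_derivative f y \<xi> ** frame_derivative f y \<zeta>)) has_derivative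
    (\<lambda>V. trace (frame_derivative f x \<xi> ** ?d \<zeta> V + ?d \<xi> V ** frame_derivative f x \<zeta>))) (at x)"
    by (intro bounded_linear.has_derivative[OF bounded_linear_trace] matrix_mult.FDERIV der)
  then have "((\<lambda>y. trace (\<xi> ** \<zeta>)) has_derivative
    (\<lambda>V. trace (frame_derivative f x \<xi> ** ?d \<zeta> V + ?d \<xi> V ** frame_derivative f x \<zeta>))) (at x)"
    by (rule has_derivative_transform_within_open[OF _ U]) (rule iso)
  from has_derivative_unique[OF this has_derivative_const]
  have "trace (frame_derivative f x \<xi> ** ?d \<zeta> (x ** \<eta>) + ?d \<xi> (x ** \<eta>) ** frame_derivative f x \<zeta>) = 0"
    by (rule fun_cong)
  then show "trace (?d \<xi> (x ** \<eta>) ** frame_derivative f x \<zeta>) + trace (frame_derivative f x \<xi> ** ?d \<zeta> (x ** \<eta>)) = 0"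
    by (simp add: trace_add add.commute)
qed

section \<open>Estimates and propagation along segments\<close>

lemma gronwall_zero:
  fixes \<phi> :: "real \<Rightarrow> real"
  assumes "\<And>t. 0 \<le> t \<Longrightarrow> t \<le> 1 \<Longrightarrow> (\<phi> has_real_derivative \<phi>' t) (at t)"
    and "\<And>t. 0 \<le> t \<Longrightarrow> t \<le> 1 \<Longrightarrow> \<phi>' t \<le> C * \<phi> t" and "\<phi> 0 = 0" "\<phi> 1 \<ge> 0"
  shows "\<phi> 1 = 0"
proof -
  have "exp (- C * 1) * \<phi> 1 \<le> exp (- C * 0) * \<phi> 0"
  proof (rule DERIV_nonpos_imp_nonincreasing[of 0 1 "\<lambda>t. exp (- C * t) * \<phi> t"])
    fix t :: real assume t: "0 \<le> t" "t \<le> 1"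
    have "((\<lambda>t. exp (- C * t) * \<phi> t) has_real_derivative exp (- C * t) * (\<phi>' t - C * \<phi> t)) (at t)"
      by (auto intro!: derivative_eq_intros assms(1)[OF t] simp: algebra_simps)
    moreover have "exp (- C * t) * (\<phi>' t - C * \<phi> t) \<le> 0"
      using assms(2)[OF t] by (simp add: mult_le_0_iff)
    ultimately show "\<exists>y. ((\<lambda>t. exp (- C * t) * \<phi> t) has_real_derivative y) (at t) \<and> y \<le> 0"
      by blast
  qed simp
  then have "exp (- C) * \<phi> 1 \<le> 0"
    using assms(3) by simp
  then show ?thesis
    using assms(4) by (simp add: mult_le_0_iff)
qed

lemma linear_norm_le_sum_Basis:
  assumes "linear (E :: 'a::euclidean_space \<Rightarrow> 'b::real_normed_vector)"
  shows "norm (E y) \<le> norm y * (\<Sum>b\<in>Basis. norm (E b))"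
proof -
  have "E y = E (\<Sum>b\<in>Basis. (y \<bullet> b) *\<^sub>R b)"
    by (simp add: euclidean_representation)
  also have "\<dots> = (\<Sum>b\<in>Basis. (y \<bullet> b) *\<^sub>R E b)"
    using assms by (simp add: linear_sum linear_scale)
  finally have "norm (E y) = norm (\<Sum>b\<in>Basis. (y \<bullet> b) *\<^sub>R E b)"
    by (rule arg_cong)
  also have "\<dots> \<le> (\<Sum>b\<in>Basis. norm y * norm (E b))"
    by (rule sum_norm_le) (simp add: Basis_le_norm mult_right_mono)
  finally show ?thesis by (simp only: sum_distrib_left)
qed

lemma commutator_norm_bound:
  "\<exists>c>0. \<forall>A B :: real^'n^'n. norm (commutator A B) \<le> c * norm A * norm B"
proof -
  obtain K where K: "K > 0" "\<And>(A :: real^'n^'n) B :: real^'n^'n. norm (A ** B) \<le> norm A * norm B * K"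
    using matrix_mult.pos_bounded by blast
  have "norm (commutator A B) \<le> 2 * K * norm A * norm B" for A B :: "real^'n^'n"
  proof -
    have "norm (commutator A B) \<le> norm (A ** B) + norm (B ** A)"
      unfolding commutator_def by (rule norm_triangle_ineq4)
    also have "\<dots> \<le> norm A * norm B * K + norm B * norm A * K"
      by (intro add_mono K)
    finally show ?thesis by (simp add: mult_ac)
  qed
  then show ?thesis using K(1) by (intro exI[of _ "2 * K"]) auto
qed

text \<open>The identity is a constant solution of the differential equation for the frame derivative
  along a segment, so that Gronwall's inequality propagates it.\<close>

lemma frame_derivative_identity_segment:
  fixes f :: "real^'n^'n \<Rightarrow> real^'n^'n"
  assumes U: "open U" "U \<subseteq> GL" and f: "smooth_on U f" "\<And>x. x \<in> U \<Longrightarrow> f x \<in> GL"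
    and iso: "\<And>x \<xi> \<zeta>. x \<in> U \<Longrightarrow> trace (frame_derivative f x \<xi> ** frame_derivative f x \<zeta>) = trace (\<xi> ** \<zeta>)"
    and seg: "\<And>t. 0 \<le> t \<Longrightarrow> t \<le> 1 \<Longrightarrow> x + t *\<^sub>R V \<in> U"
    and start: "\<And>\<xi>. frame_derivative f x \<xi> = \<xi>"
  shows "frame_derivative f (x + V) \<xi> = \<xi>"
proof -
  define p where "p t = x + t *\<^sub>R V" for t :: real
  define E where "E t \<xi> = frame_derivative f (p t) \<xi> - \<xi>" for t \<xi>
  define E' where "E' t \<xi> = frechet_derivative (\<lambda>y. frame_derivative f y \<xi>) (at (p t)) V" for t \<xi>
  define \<eta> where "\<eta> t = matrix_inv (p t) ** V" for t
  \<comment> \<open>A bound for the operator norm of \<open>E t\<close>, in which the pointwise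
    estimates are stated.\<close>
  define s where "s t = (\<Sum>b\<in>Basis. norm (E t b))" for t
  have p: "p t \<in> U" if "t \<in> {0..1}" for t
    using that seg by (simp add: p_def)
  have smooth: "smooth_on U (\<lambda>y. frame_derivative f y \<xi>)" for \<xi>
    by (rule smooth_on_frame_derivative[OF U(1) f])
  have cont_p: "continuous_on {0..1} p"
    unfolding p_def by (intro continuous_intros)
  have linE: "linear (E t)" if "t \<in> {0..1}" for t
    unfolding E_def by (intro linear_compose_sub linear_frame_derivative[OF f(1) p[OF that]] linear_ident)
  have norm_E: "norm (E t y) \<le> norm y * s t" if "t \<in> {0..1}" for t y
    unfolding s_def by (rule linear_norm_le_sum_Basis[OF linE[OF that]])
  have s_nonneg: "0 \<le> s t" for t
    unfolding s_def by (rule sum_nonneg) simp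
  have E_der: "((\<lambda>t. E t \<xi>) has_vector_derivative E' t \<xi>) (at t)" if "t \<in> {0..1}" for t \<xi>
  proof -
    have lin: "linear (frechet_derivative (\<lambda>y. frame_derivative f y \<xi>) (at (p t)))"
      by (rule has_derivative_linear[OF smooth_on_imp_has_derivative[OF smooth p[OF that]]])
    have "(p has_derivative (\<lambda>h. h *\<^sub>R V)) (at t)"
      unfolding p_def by (auto intro!: derivative_eq_intros)
    from has_derivative_compose[OF this smooth_on_imp_has_derivative[OF smooth[of \<xi>] p[OF that]]]
    have "((\<lambda>t. frame_derivative f (p t) \<xi>) has_derivative (\<lambda>h. h *\<^sub>R E' t \<xi>)) (at t)"
      unfolding E'_def linear_scale[OF lin] .
    then show ?thesis
      unfolding has_vector_derivative_def E_def by (auto intro!: derivative_eq_intros)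
  qed
  \<comment> \<open>Substituting \<open>E t + id\<close> for the frame derivative cancels the terms
    free of \<open>E t\<close>, because the identity solves the equation. Three linear terms and a
    quadratic one remain.\<close>
  have E'_eq: "2 *\<^sub>R E' t \<xi> = E t (commutator (\<eta> t) \<xi>) - commutator (E t (\<eta> t)) \<xi> - commutator (\<eta> t) (E t \<xi>)
      - commutator (E t (\<eta> t)) (E t \<xi>)" if t: "t \<in> {0..1}" for t \<xi>
  proof -
    have "p t ** \<eta> t = V"
      unfolding \<eta>_def using p[OF t] U(2) by (intro matrix_inv_cancel(1)) auto
    then have "2 *\<^sub>R E' t \<xi> = frame_derivative f (p t) (commutator (\<eta> t) \<xi>)
        - commutator (frame_derivative f (p t) (\<eta> t)) (frame_derivative f (p t) \<xi>)"
      unfolding E'_def using frame_derivative_equation[OF U(1) p[OF t] f iso, of \<xi> "\<eta> t"] by simp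
    also have "\<dots> = (E t (commutator (\<eta> t) \<xi>) + commutator (\<eta> t) \<xi>) - commutator (E t (\<eta> t) + \<eta> t) (E t \<xi> + \<xi>)"
      by (simp add: E_def)
    finally show ?thesis
      by (simp add: commutator_def matrix_mult.add_left matrix_mult.add_right)
  qed
  obtain c where c: "c > 0" "\<And>A B :: real^'n^'n. norm (commutator A B) \<le> c * norm A * norm B"
    using commutator_norm_bound by blast
  have "continuous_on {0..1} \<eta>"
    unfolding \<eta>_def using p U(2)
    by (intro matrix_mult.continuous_on continuous_on_const
        continuous_on_compose2[OF smooth_on_imp_continuous_on[OF smooth_on_matrix_inv_GL] cont_p]) auto
  then have "bounded (\<eta> ` {0..1})"
    by (intro compact_imp_bounded compact_continuous_image compact_Icc)
  then obtain K where K: "K > 0" "\<And>t. t \<in> {0..1} \<Longrightarrow> norm (\<eta> t) \<le> K"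
    unfolding bounded_pos by auto
  have "continuous_on {0..1} s"
    unfolding s_def E_def using p
    by (intro continuous_intros continuous_on_compose2[OF smooth_on_imp_continuous_on[OF smooth] cont_p]) auto
  then have "bounded (s ` {0..1})"
    by (intro compact_imp_bounded compact_continuous_image compact_Icc)
  then obtain M where M: "M > 0" "\<And>t. t \<in> {0..1} \<Longrightarrow> s t \<le> M"
    unfolding bounded_pos by (auto simp: abs_le_iff)
  \<comment> \<open>Each of the three linear terms contributes \<open>c * K\<close>, and the
    quadratic one \<open>c * K * M\<close>, after one of its factors is bounded by
    \<open>M\<close>.\<close>
  define L where "L = c * K * (3 + M)"
  have norm_E': "norm (E' t b) \<le> L * s t" if t: "t \<in> {0..1}" and b: "b \<in> Basis" for t b
  proof -
    have [simp]: "norm b = 1" using b by simp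
    have \<eta>: "norm (\<eta> t) * s t \<le> K * s t"
      using K(2)[OF t] s_nonneg by (rule mult_right_mono)
    have "norm (E t (commutator (\<eta> t) b)) \<le> norm (commutator (\<eta> t) b) * s t"
      by (rule norm_E[OF t])
    also have "\<dots> \<le> (c * norm (\<eta> t) * norm b) * s t"
      by (rule mult_right_mono[OF c(2) s_nonneg])
    also have "\<dots> = c * (norm (\<eta> t) * s t)"
      by simp
    also have "\<dots> \<le> c * (K * s t)"
      using \<eta> c(1) by simp
    finally have 1: "norm (E t (commutator (\<eta> t) b)) \<le> c * (K * s t)" .
    have E\<eta>: "norm (E t (\<eta> t)) \<le> K * s t"
      using norm_E[OF t, of "\<eta> t"] \<eta> by linarith
    have "norm (commutator (E t (\<eta> t)) b) \<le> c * norm (E t (\<eta> t)) * norm b"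
      by (rule c(2))
    also have "\<dots> \<le> c * (K * s t)"
      using E\<eta> c(1) by simp
    finally have 2: "norm (commutator (E t (\<eta> t)) b) \<le> c * (K * s t)" .
    have Eb: "norm (E t b) \<le> s t"
      using norm_E[OF t, of b] by simp
    have "norm (commutator (\<eta> t) (E t b)) \<le> c * norm (\<eta> t) * norm (E t b)"
      by (rule c(2))
    also have "\<dots> \<le> c * K * s t"
      using K(2)[OF t] K(1) Eb c(1) by (intro mult_mono) auto
    finally have 3: "norm (commutator (\<eta> t) (E t b)) \<le> c * (K * s t)"
      by (simp add: mult.assoc)
    have "norm (commutator (E t (\<eta> t)) (E t b)) \<le> c * norm (E t (\<eta> t)) * norm (E t b)"
      by (rule c(2))
    also have "\<dots> \<le> c * (K * s t) * M"
      using E\<eta> Eb M(2)[OF t] M(1) K(1) c(1) s_nonneg[of t] by (intro mult_mono) auto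
    finally have 4: "norm (commutator (E t (\<eta> t)) (E t b)) \<le> c * (K * s t) * M" .
    have "2 * norm (E' t b) = norm (2 *\<^sub>R E' t b)"
      by simp
    also have "\<dots> \<le> norm (E t (commutator (\<eta> t) b)) + norm (commutator (E t (\<eta> t)) b)
        + norm (commutator (\<eta> t) (E t b)) + norm (commutator (E t (\<eta> t)) (E t b))"
      unfolding E'_eq[OF t] by (intro norm_triangle_le_diff add_mono order_refl)
    also have "\<dots> \<le> c * (K * s t) + c * (K * s t) + c * (K * s t) + c * (K * s t) * M"
      using 1 2 3 4 by linarith
    also have "\<dots> = L * s t"
      by (simp add: L_def algebra_simps)
    finally show ?thesis
      using norm_ge_zero[of "E' t b"] by linarith
  qed
  have "L \<ge> 0"
    using c(1) K(1) M(1) by (simp add: L_def)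
  \<comment> \<open>Gronwall's inequality needs a differentiable quantity, which the sum of norms
    \<open>s\<close> need not be; the sum of squares is differentiable.\<close>
  define \<phi> where "\<phi> t = (\<Sum>b\<in>Basis. E t b \<bullet> E t b)" for t
  have "\<phi> 1 = 0"
  proof (rule gronwall_zero[where \<phi>' = "\<lambda>t. \<Sum>b\<in>Basis. 2 * (E t b \<bullet> E' t b)"])
    fix t :: real assume "0 \<le> t" "t \<le> 1"
    then have t: "t \<in> {0..1}" by simp
    have "((\<lambda>t. E t b \<bullet> E t b) has_derivative (\<lambda>h. 2 * (E t b \<bullet> E' t b) * h)) (at t)" for b
      using has_derivative_inner[OF E_der[OF t, unfolded has_vector_derivative_def, of b]
          E_der[OF t, unfolded has_vector_derivative_def, of b]]
      by (rule has_derivative_eq_rhs) (simp add: fun_eq_iff inner_commute algebra_simps)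
    then show "(\<phi> has_real_derivative (\<Sum>b\<in>Basis. 2 * (E t b \<bullet> E' t b))) (at t)"
      unfolding \<phi>_def by (intro DERIV_sum) (simp add: has_field_derivative_def)
    have "(\<Sum>b\<in>Basis. 2 * (E t b \<bullet> E' t b)) \<le> (\<Sum>b\<in>Basis. 2 * (norm (E t b) * (L * s t)))"
    proof (rule sum_mono)
      fix b :: "real^'n^'n" assume "b \<in> Basis"
      have "E t b \<bullet> E' t b \<le> norm (E t b) * norm (E' t b)"
        by (rule norm_cauchy_schwarz)
      also have "\<dots> \<le> norm (E t b) * (L * s t)"
        by (intro mult_left_mono norm_E'[OF t \<open>b \<in> Basis\<close>]) simp
      finally show "2 * (E t b \<bullet> E' t b) \<le> 2 * (norm (E t b) * (L * s t))" by simp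
    qed
    also have "\<dots> = 2 * L * (s t)\<^sup>2"
      unfolding s_def power2_eq_square sum_distrib_left[symmetric] sum_distrib_right[symmetric] by simp
    \<comment> \<open>The Cauchy-Schwarz inequality over the basis returns from \<open>s\<close> to
      \<open>\<phi>\<close> at the cost of the dimension, whence the constant
      \<open>2 * L * DIM(real^'n^'n)\<close>.\<close>
    also have "\<dots> \<le> 2 * L * (\<phi> t * DIM(real^'n^'n))"
    proof (rule mult_left_mono)
      show "(s t)\<^sup>2 \<le> \<phi> t * DIM(real^'n^'n)"
        unfolding s_def \<phi>_def power2_norm_eq_inner[symmetric] by (rule sum_squared_le_sum_of_squares)
    qed (use \<open>L \<ge> 0\<close> in simp)
    finally show "(\<Sum>b\<in>Basis. 2 * (E t b \<bullet> E' t b)) \<le> 2 * L * DIM(real^'n^'n) * \<phi> t"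
      by (simp only: mult_ac)
  next
    show "\<phi> 0 = 0"
      by (simp add: \<phi>_def E_def p_def start)
    show "0 \<le> \<phi> 1"
      unfolding \<phi>_def by (intro sum_nonneg inner_ge_zero)
  qed
  then have "E 1 b = 0" if "b \<in> Basis" for b
    using that unfolding \<phi>_def by (subst (asm) sum_nonneg_eq_0_iff) auto
  then have "s 1 = 0"
    by (simp add: s_def)
  then have "E 1 \<xi> = 0"
    using norm_E[of 1 \<xi>] by simp
  then show ?thesis
    by (simp add: E_def p_def)
qed

text \<open>The set \<open>Z\<close> of points fixed to first order is closed in \<open>U\<close> by
  continuity of \<open>f\<close> and its derivative. It is open because a ball around a point of
  \<open>Z\<close> is filled by segments from its centre, along which the identity
  propagates.\<close>

lemma isometry_rigidity:
  fixes f :: "real^'n^'n \<Rightarrow> real^'n^'n"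
  assumes U: "open U" "connected U" "U \<subseteq> GL" and f: "smooth_on U f" "\<And>x. x \<in> U \<Longrightarrow> f x \<in> GL"
    and iso: "\<And>x V W. x \<in> U \<Longrightarrow>
      trace_metric (f x) (frechet_derivative f (at x) V) (frechet_derivative f (at x) W) = trace_metric x V W"
    and P: "P \<in> U" "f P = P" "\<And>V. frechet_derivative f (at P) V = V"
    and x: "x \<in> U"
  shows "f x = x"
proof -
  have iso': "trace (frame_derivative f x \<xi> ** frame_derivative f x \<zeta>) = trace (\<xi> ** \<zeta>)" if "x \<in> U" for x \<xi> \<zeta>
    using iso[OF that, of "x ** \<xi>" "x ** \<zeta>"] trace_metric_left_mult[of x \<xi> \<zeta>] that U(3)
    by (simp add: frame_derivative_def trace_metric_def matrix_mul_assoc subset_iff)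
  define Z where "Z = {x \<in> U. f x = x \<and> (\<forall>V. frechet_derivative f (at x) V = V)}"
  have "openin (top_of_set U) Z"
    unfolding openin_open_eq[OF U(1)] open_contains_ball
  proof (intro conjI ballI)
    show "Z \<subseteq> U" by (auto simp: Z_def)
    fix x0 assume x0: "x0 \<in> Z"
    then obtain r where r: "r > 0" "ball x0 r \<subseteq> U"
      using U(1) open_contains_ball unfolding Z_def by blast
    have x0': "x0 \<in> U" "x0 \<in> GL" "f x0 = x0"
      using x0 U(3) by (auto simp: Z_def)
    have start: "frame_derivative f x0 \<xi> = \<xi>" for \<xi>
      using x0 x0' by (simp add: frame_derivative_def Z_def matrix_inv_cancel(2))
    have frame: "frame_derivative f y \<xi> = \<xi>" if y: "y \<in> ball x0 r" for y \<xi>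
    proof -
      have "x0 + t *\<^sub>R (y - x0) \<in> U" if "0 \<le> t" "t \<le> 1" for t
      proof -
        have "(1 - t) *\<^sub>R x0 + t *\<^sub>R y \<in> ball x0 r"
          using convexD[OF convex_ball, of x0 x0 r y "1 - t" t] that y r(1) by simp
        moreover have "(1 - t) *\<^sub>R x0 + t *\<^sub>R y = x0 + t *\<^sub>R (y - x0)"
          by (simp add: algebra_simps)
        ultimately show ?thesis using r(2) by auto
      qed
      then show ?thesis
        using frame_derivative_identity_segment[OF U(1,3) f iso' _ start, of "y - x0" \<xi>] by simp
    qed
    have D: "frechet_derivative f (at y) V = f y ** matrix_inv y ** V" if y: "y \<in> ball x0 r" for y V
    proof -
      have GL: "y \<in> GL" "f y \<in> GL"
        using y r(2) U(3) f(2) by auto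
      have "f y ** frame_derivative f y (matrix_inv y ** V) = f y ** (matrix_inv y ** V)"
        by (simp only: frame[OF y])
      then have "frechet_derivative f (at y) V = f y ** (matrix_inv y ** V)"
        unfolding frame_derivative_def matrix_inv_cancel(1)[OF GL(1)] matrix_inv_cancel(1)[OF GL(2)] .
      then show ?thesis
        by (simp only: matrix_mul_assoc)
    qed
    \<comment> \<open>By \<open>D\<close> the derivative of \<open>f\<close> at \<open>y\<close> is
      left multiplication by \<open>f y ** matrix_inv y\<close>, so the two terms of the product
      rule for this very expression cancel.\<close>
    have const: "f y ** matrix_inv y = f x0 ** matrix_inv x0" if y: "y \<in> ball x0 r" for y
    proof (rule has_derivative_zero_unique[OF convex_ball _ y])
      show "x0 \<in> ball x0 r" using r(1) by simp
      fix z assume z: "z \<in> ball x0 r"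
      then have GL: "z \<in> U" "z \<in> GL"
        using r(2) U(3) by auto
      have "((\<lambda>y. f y ** matrix_inv y) has_derivative
          (\<lambda>V. f z ** - (matrix_inv z ** V ** matrix_inv z) + frechet_derivative f (at z) V ** matrix_inv z)) (at z)"
        by (intro matrix_mult.FDERIV smooth_on_imp_has_derivative[OF f(1) GL(1)] has_derivative_matrix_inv[OF GL(2)])
      moreover have "f z ** - (matrix_inv z ** V ** matrix_inv z) + frechet_derivative f (at z) V ** matrix_inv z = 0" for V
        unfolding D[OF z] matrix_mult.minus_right matrix_mul_assoc by simp
      ultimately show "((\<lambda>y. f y ** matrix_inv y) has_derivative (\<lambda>V. 0)) (at z within ball x0 r)"
        by (simp only: has_derivative_at_withinI)
    qed
    have fixed: "f y = y" if y: "y \<in> ball x0 r" for y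
    proof -
      have GL: "y \<in> GL" using y r(2) U(3) by auto
      have "f y ** matrix_inv y = mat 1"
        using const[OF y] by (simp add: x0'(3) matrix_inv_right[OF x0'(2)])
      then have "f y ** matrix_inv y ** y = mat 1 ** y"
        by (rule arg_cong)
      then show ?thesis
        by (simp only: matrix_inv_cancel(4)[OF GL] matrix_mul_lid)
    qed
    have "y \<in> Z" if y: "y \<in> ball x0 r" for y
    proof -
      have GL: "y \<in> GL" using y r(2) U(3) by auto
      have "frechet_derivative f (at y) V = V" for V
        unfolding D[OF y] fixed[OF y] by (simp add: matrix_inv_right[OF GL])
      then show ?thesis
        using y r(2) fixed[OF y] by (auto simp: Z_def)
    qed
    then show "\<exists>e>0. ball x0 e \<subseteq> Z"
      using r(1) by blast
  qed
  moreover have "closedin (top_of_set U) Z"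
  proof -
    \<comment> \<open>Pairing the two conditions writes \<open>Z\<close> as an intersection of
      preimages of \<open>0\<close>, one for each direction \<open>V\<close>.\<close>
    have eq: "Z = (\<Inter>V. {x \<in> U. (f x - x, frechet_derivative f (at x) V - V) = 0})"
      by (auto simp: Z_def zero_prod_def)
    have "closedin (top_of_set U) {x \<in> U. (f x - x, frechet_derivative f (at x) V - V) = 0}" for V
      by (intro continuous_closedin_preimage_constant continuous_intros
          smooth_on_imp_continuous_on smooth_on_frechet_derivative f(1))
    then show ?thesis
      unfolding eq by (intro closedin_INT) auto
  qed
  moreover have "P \<in> Z"
    using P by (simp add: Z_def)
  ultimately have "Z = U"
    using U(2) unfolding connected_clopen by blast
  then show ?thesis
    using x by (auto simp: Z_def)
qed

section \<open>Uniqueness of the symmetries\<close>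

text \<open>The group \<open>GLplus\<close> is, isometrically up to the factor \<open>CARD('n)\<close>, the product of \<open>SL\<close> and the
  half line. Taking the product of an isometry of \<open>SL\<close> with the identity reduces rigidity on \<open>SL\<close> to
  rigidity on an open set.\<close>

definition radial_extension :: "(real^'n^'n \<Rightarrow> real^'n^'n) \<Rightarrow> real^'n^'n \<Rightarrow> real^'n^'n" where
  "radial_extension h X = det_root X *\<^sub>R h (normalize_det X)"

lemma smooth_on_normalize_det_compose:
  assumes "smooth_map SL h"
  shows "smooth_on GLplus (\<lambda>X. h (normalize_det X))"
  using normalize_det_in_SL
  by (intro smooth_map_imp_smooth_on[OF open_GLplus] smooth_map_compose[OF _ _ assms]
      smooth_on_imp_smooth_map[OF open_GLplus smooth_on_normalize_det]) auto

lemma smooth_on_radial_extension: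
  "smooth_map SL h \<Longrightarrow> smooth_on GLplus (radial_extension h)"
  unfolding radial_extension_def[abs_def]
  by (intro smooth_on_scaleR open_GLplus smooth_on_det_root smooth_on_normalize_det_compose)

text \<open>A direction at \<open>x\<close> splits into the radial part
  \<open>\<tau> V *\<^sub>R x\<close> and a part tangent to the level set of \<open>det\<close>. The
  extension sends the first to a radial vector, and on the second it acts as the differential of
  \<open>h\<close> at the normalized point.\<close>

lemma radial_extension_derivative:
  fixes h :: "real^'n^'n \<Rightarrow> real^'n^'n"
  assumes h: "smooth_map SL h" and x: "x \<in> GLplus"
  defines "\<tau> \<equiv> \<lambda>V. trace (matrix_inv x ** V) / CARD('n)"
  shows "V - \<tau> V *\<^sub>R x \<in> (\<lambda>v. det_root x *\<^sub>R v) ` tangent_space SL (normalize_det x)"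
    and "frechet_derivative (radial_extension h) (at x) V = (det_root x * \<tau> V) *\<^sub>R h (normalize_det x)
      + det_root x *\<^sub>R differential SL h (normalize_det x) (inverse (det_root x) *\<^sub>R (V - \<tau> V *\<^sub>R x))"
proof -
  have tan: "V \<in> tangent_space GLplus x" for V
    using tangent_space_open[OF open_GLplus x] by blast
  have norm_smooth: "smooth_map GLplus (normalize_det :: real^'n^'n \<Rightarrow> real^'n^'n)"
    by (rule smooth_on_imp_smooth_map[OF open_GLplus smooth_on_normalize_det subset_refl])
  have im: "normalize_det ` GLplus \<subseteq> (SL :: (real^'n^'n) set)"
    using normalize_det_in_SL by blast
  have D: "differential GLplus normalize_det x V = inverse (det_root x) *\<^sub>R (V - \<tau> V *\<^sub>R x)" for V
    unfolding \<tau>_def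
    by (rule differential_eq[OF tan open_GLplus x has_derivative_normalize_det[OF x]]) simp
  have "inverse (det_root x) *\<^sub>R (V - \<tau> V *\<^sub>R x) \<in> tangent_space SL (normalize_det x)"
    using differential_in_tangent_space[OF norm_smooth x im tan, of V] unfolding D .
  then show "V - \<tau> V *\<^sub>R x \<in> (\<lambda>v. det_root x *\<^sub>R v) ` tangent_space SL (normalize_det x)"
    using det_root_pos[OF x] by (intro image_eqI) auto
  let ?k = "\<lambda>X. h (normalize_det X)"
  have k: "(?k has_derivative frechet_derivative ?k (at x)) (at x)"
    by (rule smooth_on_imp_has_derivative[OF smooth_on_normalize_det_compose[OF h] x])
  have "frechet_derivative ?k (at x) V = differential GLplus (h \<circ> normalize_det) x V"
    by (rule differential_eq[OF tan open_GLplus x k, symmetric]) simp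
  also have "\<dots> = differential SL h (normalize_det x) (inverse (det_root x) *\<^sub>R (V - \<tau> V *\<^sub>R x))"
    unfolding differential_compose[OF norm_smooth x im h tan] D by (rule refl)
  finally have k': "frechet_derivative ?k (at x) V = differential SL h (normalize_det x) (inverse (det_root x) *\<^sub>R (V - \<tau> V *\<^sub>R x))" .
  have "(radial_extension h has_derivative (\<lambda>V. det_root x *\<^sub>R frechet_derivative ?k (at x) V
      + (det_root x * trace (matrix_inv x ** V) / CARD('n)) *\<^sub>R h (normalize_det x))) (at x)"
    unfolding radial_extension_def[abs_def]
    by (intro has_derivative_scaleR has_derivative_det_root x k)
  from fun_cong[OF frechet_derivative_at[OF this], of V]
  show "frechet_derivative (radial_extension h) (at x) V = (det_root x * \<tau> V) *\<^sub>R h (normalize_det x)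
      + det_root x *\<^sub>R differential SL h (normalize_det x) (inverse (det_root x) *\<^sub>R (V - \<tau> V *\<^sub>R x))"
    unfolding k' \<tau>_def by (simp add: add.commute)
qed

section \<open>Dilations and the radial splitting of the metric\<close>

lemma matrix_inv_scaleR:
  assumes "c \<noteq> 0" "A \<in> GL"
  shows "matrix_inv (c *\<^sub>R A :: real^'n^'n) = inverse c *\<^sub>R matrix_inv A"
  by (rule matrix_inv_unique)
    (use assms in \<open>simp add: matrix_mult.scaleR_left matrix_mult.scaleR_right matrix_inv_right\<close>)

lemma trace_metric_scaleR:
  assumes "c \<noteq> 0" "A \<in> GL"
  shows "trace_metric (c *\<^sub>R A :: real^'n^'n) (c *\<^sub>R V) (c *\<^sub>R W) = trace_metric A V W"
  using assms by (simp add: trace_metric_def matrix_inv_scaleR matrix_mult.scaleR_left matrix_mult.scaleR_right)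

text \<open>Pairing \<open>A\<close> with \<open>v\<close> gives
  \<open>trace (matrix_inv A ** v)\<close>, so the mixed terms vanish on the kernel, and pairing
  \<open>A\<close> with itself gives \<open>trace (mat 1)\<close>.\<close>

lemma trace_metric_radial:
  fixes A :: "real^'n^'n"
  assumes "A \<in> GL" "trace (matrix_inv A ** v) = 0" "trace (matrix_inv A ** w) = 0"
  shows "trace_metric A (a *\<^sub>R A + v) (b *\<^sub>R A + w) = a * b * CARD('n) + trace_metric A v w"
  using assms
  by (simp add: trace_metric_def matrix_mult.add_left matrix_mult.add_right matrix_mult.scaleR_left
      matrix_mult.scaleR_right trace_add trace_scaleR matrix_inv_left matrix_inv_cancel(3,4) trace_I)

text \<open>Invariance under dilations moves the comparison to the points \<open>q\<close> and
  \<open>h q\<close> of \<open>SL\<close>. There the metric splits orthogonally: the radial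
  coefficients are unchanged, and \<open>h\<close> preserves the tangential part.\<close>

lemma isometry_radial_extension:
  fixes h :: "real^'n^'n \<Rightarrow> real^'n^'n"
  assumes h: "isometry SL trace_metric h" and x: "x \<in> GLplus"
  defines "F \<equiv> radial_extension h"
  shows "trace_metric (F x) (frechet_derivative F (at x) V) (frechet_derivative F (at x) W) = trace_metric x V W"
proof -
  define s where "s = det_root x"
  define q where "q = normalize_det x"
  define \<tau> where "\<tau> V = trace (matrix_inv x ** V) / CARD('n)" for V
  define v where "v V = inverse s *\<^sub>R (V - \<tau> V *\<^sub>R x)" for V
  have s: "s > 0" unfolding s_def by (rule det_root_pos[OF x])
  have q: "q \<in> SL" "h q \<in> SL" "q \<in> GL" "h q \<in> GL"
    using normalize_det_in_SL[OF x] isometry_image[OF h] SL_subset_GL by (auto simp: q_def)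
  have x_eq: "x = s *\<^sub>R q"
    using s by (simp add: q_def s_def normalize_det_def)
  have tan: "v V \<in> tangent_space SL q" for V
    using radial_extension_derivative(1)[OF isometry_smooth_map[OF h] x, of V] s
    unfolding v_def s_def q_def \<tau>_def by auto
  have dh: "differential SL h q (v V) \<in> tangent_space SL (h q)" for V
    by (rule differential_in_tangent_space[OF isometry_smooth_map[OF h] q(1) _ tan])
      (simp add: isometry_image[OF h])
  have D: "frechet_derivative F (at x) V = s *\<^sub>R (\<tau> V *\<^sub>R h q + differential SL h q (v V))" for V
    unfolding F_def radial_extension_derivative(2)[OF isometry_smooth_map[OF h] x]
    by (simp add: s_def q_def \<tau>_def v_def scaleR_add_right)
  have Fx: "F x = s *\<^sub>R h q"
    by (simp add: F_def radial_extension_def s_def q_def)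
  have V_eq: "V = s *\<^sub>R (\<tau> V *\<^sub>R q + v V)" for V
    using s by (simp add: v_def x_eq scaleR_add_right algebra_simps)
  have "trace_metric (F x) (frechet_derivative F (at x) V) (frechet_derivative F (at x) W)
      = trace_metric (h q) (\<tau> V *\<^sub>R h q + differential SL h q (v V)) (\<tau> W *\<^sub>R h q + differential SL h q (v W))"
    unfolding D Fx using s by (intro trace_metric_scaleR q) simp
  also have "\<dots> = \<tau> V * \<tau> W * CARD('n) + trace_metric (h q) (differential SL h q (v V)) (differential SL h q (v W))"
    using dh[unfolded tangent_space_SL[OF q(2)]] by (intro trace_metric_radial q) auto
  also have "\<dots> = \<tau> V * \<tau> W * CARD('n) + trace_metric q (v V) (v W)"
    using h q(1) tan unfolding isometry_def by simp
  also have "\<dots> = trace_metric q (\<tau> V *\<^sub>R q + v V) (\<tau> W *\<^sub>R q + v W)"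
    using tan[unfolded tangent_space_SL[OF q(1)]] by (intro trace_metric_radial[symmetric] q) auto
  also have "\<dots> = trace_metric (s *\<^sub>R q) (s *\<^sub>R (\<tau> V *\<^sub>R q + v V)) (s *\<^sub>R (\<tau> W *\<^sub>R q + v W))"
    using s by (intro trace_metric_scaleR[symmetric] q) simp
  also have "\<dots> = trace_metric x V W"
    by (simp only: V_eq[symmetric] x_eq[symmetric])
  finally show ?thesis .
qed

text \<open>At \<open>P\<close> the derivative of the extension fixes the radial direction by
  construction and the tangent directions by assumption, so \<open>isometry_rigidity\<close> applies
  on \<open>GLplus\<close>; on \<open>SL\<close> the extension is \<open>h\<close> itself.\<close>

lemma isometry_SL_rigidity:
  fixes h :: "real^'n^'n \<Rightarrow> real^'n^'n"
  assumes h: "isometry SL trace_metric h" and P: "P \<in> SL" "h P = P"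
    and dh: "\<And>v. v \<in> tangent_space SL P \<Longrightarrow> differential SL h P v = v"
    and x: "x \<in> SL"
  shows "h x = x"
proof -
  let ?F = "radial_extension h"
  have smooth: "smooth_on GLplus ?F"
    by (rule smooth_on_radial_extension[OF isometry_smooth_map[OF h]])
  have GL: "?F y \<in> GL" if "y \<in> GLplus" for y
  proof -
    have "h (normalize_det y) \<in> SL"
      using normalize_det_in_SL[OF that] isometry_image[OF h] by blast
    then show ?thesis
      using det_root_pos[OF that] by (simp add: radial_extension_def GL_iff det_scaleR SL_def)
  qed
  have F_SL: "?F y = h y" if "y \<in> SL" for y
    using that by (simp add: radial_extension_def det_root_eq_1 normalize_det_id)
  have P': "P \<in> GLplus" using P(1) SL_subset_GLplus by blast
  have DF: "frechet_derivative ?F (at P) V = V" for V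
  proof -
    let ?\<tau> = "trace (matrix_inv P ** V) / CARD('n)"
    have "V - ?\<tau> *\<^sub>R P \<in> tangent_space SL P"
      using radial_extension_derivative(1)[OF isometry_smooth_map[OF h] P', of V] P(1)
      by (simp add: det_root_eq_1 normalize_det_id)
    then show ?thesis
      unfolding radial_extension_derivative(2)[OF isometry_smooth_map[OF h] P']
      using P by (simp add: det_root_eq_1 normalize_det_id dh)
  qed
  have "?F x = x"
    by (rule isometry_rigidity[OF open_GLplus connected_GLplus GLplus_subset_GL smooth GL
          isometry_radial_extension[OF h] P' _ DF])
      (use x SL_subset_GLplus P F_SL[OF P(1)] in auto)
  then show ?thesis using F_SL[OF x] by simp
qed

lemma symmetric_space_SL: "symmetric_space (SL :: (real^'n^'n) set) trace_metric"
  unfolding symmetric_space_def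
proof (intro conjI ballI)
  fix P :: "real^'n^'n" assume P: "P \<in> SL"
  let ?\<psi> = "right_translation P \<circ> left_translation P \<circ> matrix_inv"
  have \<psi>: "symmetry_at SL trace_metric P ?\<psi>"
    by (rule symmetry_at_SL[OF P])
  have "\<zeta> x = ?\<psi> x" if \<zeta>: "symmetry_at SL trace_metric P \<zeta>" and x: "x \<in> SL" for \<zeta> x
  proof -
    have iso: "isometry SL trace_metric \<zeta>" "isometry SL trace_metric ?\<psi>" and "\<zeta> P = P" "?\<psi> P = P"
      using \<zeta> \<psi> unfolding symmetry_at_def by auto
    have \<zeta>SL: "\<zeta> ` SL \<subseteq> SL"
      using isometry_image[OF iso(1)] by simp
    have "(?\<psi> \<circ> \<zeta>) x = x"
    proof (rule isometry_SL_rigidity[OF isometry_compose[OF iso(2,1)] P _ _ x])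
      show "(?\<psi> \<circ> \<zeta>) P = P"
        using \<open>\<zeta> P = P\<close> \<open>?\<psi> P = P\<close> by simp
      fix v assume v: "v \<in> tangent_space SL P"
      have "differential SL \<zeta> P v = - v"
        using \<zeta> v unfolding symmetry_at_def by blast
      \<comment> \<open>The property of \<open>?\<psi>\<close> is stated for tangent vectors only;
        \<open>- v\<close> is one, being the image of \<open>v\<close> under the differential of
        \<open>\<zeta>\<close>.\<close>
      moreover from this have "- v \<in> tangent_space SL P"
        using differential_in_tangent_space[OF isometry_smooth_map[OF iso(1)] P \<zeta>SL v] \<open>\<zeta> P = P\<close> by simp
      then have "differential SL ?\<psi> P (- v) = - (- v)"
        using \<psi> unfolding symmetry_at_def by blast
      ultimately show "differential SL (?\<psi> \<circ> \<zeta>) P v = v"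
        using differential_compose[OF isometry_smooth_map[OF iso(1)] P \<zeta>SL isometry_smooth_map[OF iso(2)] v]
          \<open>\<zeta> P = P\<close> by simp
    qed
    then have "?\<psi> (?\<psi> (\<zeta> x)) = ?\<psi> x" by simp
    \<comment> \<open>As \<open>?\<psi>\<close> is an involution of \<open>SL\<close>, applying it
      to both sides of \<open>?\<psi> (\<zeta> x) = x\<close> isolates
      \<open>\<zeta> x\<close>.\<close>
    moreover have "?\<psi> (?\<psi> y) = y" if "y \<in> SL" for y
    proof -
      have GL: "P \<in> GL" "y \<in> GL" "matrix_inv y \<in> GL" "P ** matrix_inv y \<in> GL"
        using P that SL_subset_GL by (auto simp: matrix_inv_in_GL GL_iff det_mul det_matrix_inv SL_def)
      show ?thesis
        by (simp add: left_translation_def right_translation_def matrix_inv_mult GL matrix_inv_matrix_inv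
            matrix_mul_assoc matrix_inv_right matrix_inv_cancel(4))
    qed
    ultimately show ?thesis
      using \<zeta>SL x by auto
  qed
  then show "\<exists>\<zeta>. symmetry_at SL trace_metric P \<zeta> \<and> (\<forall>\<zeta>'. symmetry_at SL trace_metric P \<zeta>' \<longrightarrow> (\<forall>x\<in>SL. \<zeta>' x = \<zeta> x))"
    using \<psi> by blast
qed (rule semi_riemannian_SL connected_SL)+

theorem proposition4p1:
  shows "semi_riemannian_submanifold (SL :: (real^'n^'n) set) GL trace_metric
    \<and> symmetric_space (SL :: (real^'n^'n) set) trace_metric
    \<and> has_signature (SL :: (real^'n^'n) set) trace_metric
        (CARD('n) * (CARD('n) + 1) div 2 - 1, CARD('n) * (CARD('n) - 1) div 2)
    \<and> homogeneous (SL :: (real^'n^'n) set) trace_metric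
    \<and> (\<forall>f \<in> compositions
          ({left_translation G | G. G \<in> (SL :: (real^'n^'n) set)}
           \<union> {right_translation G | G. G \<in> SL}
           \<union> {congruence G | G. G \<in> SL}
           \<union> {conjugacy G | G. G \<in> GL}
           \<union> {transpose, matrix_inv}).
         isometry SL trace_metric f)
    \<and> (\<forall>P \<in> (SL :: (real^'n^'n) set).
         symmetry_at SL trace_metric P (right_translation P \<circ> left_translation P \<circ> matrix_inv))"
proof (intro conjI ballI)
  fix f :: "real^'n^'n \<Rightarrow> real^'n^'n"
  assume "f \<in> compositions ({left_translation G | G. G \<in> SL} \<union> {right_translation G | G. G \<in> SL}
    \<union> {congruence G | G. G \<in> SL} \<union> {conjugacy G | G. G \<in> GL} \<union> {transpose, matrix_inv})"
  then show "isometry SL trace_metric f"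
    by (rule isometry_compositions)
      (use isometry_left_translation isometry_right_translation isometry_congruence isometry_conjugacy
        isometry_transpose isometry_matrix_inv in blast)
qed (rule semi_riemannian_submanifold_SL symmetric_space_SL has_signature_SL homogeneous_SL | erule symmetry_at_SL)+

end
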